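(* Let $\mathcal K$ be a representable plumbus with enhanced 2-classifier $u:\Omega_\bullet\to\Omega$, and let $(T,i,m)$ be an opfibrantly cartesian enhanced 2-monad on $\mathcal K$, so that $u$, with its canonical lax $T$-algebra structure, is an enhanced 2-classifier of $\mathrm{LaxAlg}(T)$. Let $p:E\to B$ be a small discrete opfibration in $\mathrm{LaxAlg}(T)$. Then its classifying map $dp:B\rightsquigarrow\Omega$ is a pseudo-$T$-morphism if and only if $p$ is $T$-cartesian.
   Context: Enhanced 2-categories. An enhanced 2-category $\mathcal K$ is a 2-category, whose 1-cells are called loose (written $\rightsquigarrow$), with a wide and locally full sub-2-category whose 1-cells are called tight (written $\to$). It is repletely enhanced if $f$ tight and $f\cong g$ imply $g$ tight. An enhanced 2-monad $(T,i,m)$ is a 2-monad with $T$ preserving tight 1-cells and $i,m$ having tight components. A tight terminal object is a terminal object $1$ all of whose maps $X\to 1$ are tight. Algebras. A lax $T$-algebra is $(A,\alpha,\upsilon,\mu)$ with $\alpha:TA\to A$ tight, $\upsilon:\mathrm{id}_A\Rightarrow\alpha i_A$ and $\mu:\alpha\circ T\alpha\Rightarrow\alpha\circ m_A$ such that $(\mu\, i_{TA})(\upsilon\alpha)=\mathrm{id}_\alpha$, $(\mu\, Ti_A)(\alpha\, T\upsilon)=\mathrm{id}_\alpha$, $(\mu\, m_{TA})(\mu\, T^2\alpha)=(\mu\, Tm_A)(\alpha\, T\mu)$. A lax $T$-morphism $(f,\bar f):(A,\alpha)\rightsquigarrow(B,\beta)$ is a loose $f$ with $\bar f:\beta\circ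 Tf\Rightarrow f\circ\alpha$ such that $f\upsilon_A=(\bar f i_A)(\upsilon_B f)$ and $(f\mu_A)(\bar f\,T\alpha)(\beta\,T\bar f)=(\bar f m_A)(\mu_B\,T^2f)$; it is pseudo if $\bar f$ is invertible and strict if $\bar f$ is an identity. A $T$-2-morphism $f\Rightarrow f'$ is a 2-cell $\varphi$ with $(\varphi\alpha)\bar f=\bar f'(\beta\,T\varphi)$. $\mathrm{LaxAlg}(T)$ is the enhanced 2-category of lax $T$-algebras, lax $T$-morphisms as loose 1-cells, pseudo-$T$-morphisms with tight underlying 1-cell as tight 1-cells, and $T$-2-morphisms. Discrete opfibrations and plumbuses. A tight discrete opfibration is a tight $p:E\to B$ such that for all $e:X\rightsquigarrow E$, $b:X\rightsquigarrow B$, $\varphi:pe\Rightarrow b$ there is a unique 2-cell $\lambda$ with domain $e$ and $p\lambda=\varphi$. A left-tight pullback of a tight $f:B\to C$ along a loose $g:A\rightsquigarrow C$ is a (strict 2-categorical) pullback whose projection $p_A$ to $A$ is tight and detects tightness: $h$ is tight whenever $p_Ah$ is. A smallness structure is a class of tight discrete opfibrations, called small, stable under left-tight pullback along arbitrary loose 1-cells, with strictly functorial chosen such pullbacks. A plumbus is a repletely enhanced 2-category with a tight terminal object and a smallness structure. $\mathrm{LaxAlg}(T)$ is a plumbus whose small discrete opfibrations are the strict $T$-morphisms whose underlying map is small in $\mathcal K$. Representability. An enhanced 2-classifier is a small discrete opfibration $u:\Omega_\bullet\to\Omega$ such that: (1) every small $p:E\to B$ has a chosen pullback square $(d_\bullet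 p:E\rightsquigarrow\Omega_\bullet,\ dp:B\rightsquigarrow\Omega)$ from $p$ to $u$; (2) for every commuting square $(g,f)$ with loose sides from small $p$ to small $p'$ there is a unique pair of 2-cells $\gamma_\bullet:d_\bullet p\Rightarrow d_\bullet p'\circ g$, $\gamma:dp\Rightarrow dp'\circ f$ with $u\gamma_\bullet=\gamma p$; (3) these are invertible if the square is a pullback; (4) $(d_\bullet u,du)\cong(\mathrm{id},\mathrm{id})$ compatibly with $u$. The map $dp$ is the classifying map of $p$. A plumbus with an enhanced 2-classifier is representable; one always assumes then that $\mathrm{id}_1$ is small. $(T,i,m)$ is opfibrantly cartesian if (A) $Tu$ is a small discrete opfibration, (B) $T$ preserves pullbacks of $u$, (C) $\omega:=d(Tu):T\Omega\to\Omega$ is tight. The canonical lax algebra structures on $\Omega_\bullet,\Omega$ have structure maps $\omega_\bullet:=d_\bullet(Tu)$ and $\omega$, with unitors the unique pair of 2-cells $\mathrm{id}\Rightarrow\omega_\bullet i$, $\mathrm{id}\Rightarrow\omega i$ and multiplicators the unique pair $\omega_\bullet T\omega_\bullet\Rightarrow\omega_\bullet m$, $\omega T\omega\Rightarrow\omega m$ compatible with $u$; then $u$ is strict. $T$-cartesianness. For a strict $T$-morphism $f:(A,\alpha)\to(B,\beta)$, its $T$-cartesianness defect is the comparison map $\delta_f:TA\to\beta^*A$ into the pullback of $f$ along $\beta:TB\to B$ induced by $Tf:TA\to TB$ and $\alpha:TA\to A$. $f$ is $T$-cartesian if $\delta_f$ is a split equivalence, i.e. there are $j$ and an isomorphism $\varepsilon:j\delta_f\cong\mathrm{id}$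 with $\delta_f j=\mathrm{id}$. *)

theory Defs
  imports Main
begin

section \<open>Enhanced 2-categories\<close>

text \<open>\<open>Obj\<close>, \<open>Loose\<close> and \<open>Cell\<close> are the objects, 1-cells and 2-cells of the ambient 2-category;
  \<open>Tight\<close> is the class of tight 1-cells. All operations are written in the classical order,
  \<open>g \<odot> f\<close> being "g after f", and are only meaningful on composable arguments.\<close>

record ('o, 'm, 'c) enhanced_2cat =
  Obj :: "'o set"
  Loose :: "'m set"
  Tight :: "'m set"
  Cell :: "'c set"
  Dom :: "'m \<Rightarrow> 'o"
  Cod :: "'m \<Rightarrow> 'o"
  Src :: "'c \<Rightarrow> 'm"
  Tgt :: "'c \<Rightarrow> 'm"
  Id1 :: "'o \<Rightarrow> 'm"
  Id2 :: "'m \<Rightarrow> 'c"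
  Comp :: "'m \<Rightarrow> 'm \<Rightarrow> 'm"  (infixl "\<odot>\<index>" 75)
  Vcomp :: "'c \<Rightarrow> 'c \<Rightarrow> 'c"  (infixl "\<cdot>\<index>" 65)
  Hcomp :: "'c \<Rightarrow> 'c \<Rightarrow> 'c"  (infixl "\<star>\<index>" 70)

abbreviation whisker_left (infixl "\<lhd>\<index>" 70) where
  "f \<lhd>\<^bsub>K\<^esub> \<phi> \<equiv> Id2 K f \<star>\<^bsub>K\<^esub> \<phi>"

abbreviation whisker_right (infixl "\<rhd>\<index>" 70) where
  "\<phi> \<rhd>\<^bsub>K\<^esub> f \<equiv> \<phi> \<star>\<^bsub>K\<^esub> Id2 K f"

definition hom :: "('o, 'm, 'c, 'z) enhanced_2cat_scheme \<Rightarrow> 'o \<Rightarrow> 'o \<Rightarrow> 'm set" where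
  "hom K A B = {f \<in> Loose K. Dom K f = A \<and> Cod K f = B}"

definition cells :: "('o, 'm, 'c, 'z) enhanced_2cat_scheme \<Rightarrow> 'm \<Rightarrow> 'm \<Rightarrow> 'c set" where
  "cells K f g = {\<phi> \<in> Cell K. Src K \<phi> = f \<and> Tgt K \<phi> = g}"

definition invertible_cell :: "('o, 'm, 'c, 'z) enhanced_2cat_scheme \<Rightarrow> 'c \<Rightarrow> bool" where
  "invertible_cell K \<phi> \<longleftrightarrow> \<phi> \<in> Cell K \<and>
     (\<exists>\<psi> \<in> cells K (Tgt K \<phi>) (Src K \<phi>).
        \<psi> \<cdot>\<^bsub>K\<^esub> \<phi> = Id2 K (Src K \<phi>) \<and> \<phi> \<cdot>\<^bsub>K\<^esub> \<psi> = Id2 K (Tgt K \<phi>))"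

locale two_category =
  fixes K :: "('o, 'm, 'c, 'z) enhanced_2cat_scheme" (structure)
  assumes Dom_Obj: "f \<in> Loose K \<Longrightarrow> Dom K f \<in> Obj K"
    and Cod_Obj: "f \<in> Loose K \<Longrightarrow> Cod K f \<in> Obj K"
    and Id1_hom: "A \<in> Obj K \<Longrightarrow> Id1 K A \<in> hom K A A"
    and Comp_hom: "\<lbrakk>f \<in> hom K A B; g \<in> hom K B C\<rbrakk> \<Longrightarrow> g \<odot> f \<in> hom K A C"
    and Comp_assoc: "\<lbrakk>f \<in> hom K A B; g \<in> hom K B C; h \<in> hom K C D\<rbrakk>
      \<Longrightarrow> (h \<odot> g) \<odot> f = h \<odot> (g \<odot> f)"
    and Comp_Id1_left: "f \<in> hom K A B \<Longrightarrow> Id1 K B \<odot> f = f"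
    and Comp_Id1_right: "f \<in> hom K A B \<Longrightarrow> f \<odot> Id1 K A = f"
    and Src_Loose: "\<phi> \<in> Cell K \<Longrightarrow> Src K \<phi> \<in> Loose K"
    and Tgt_Loose: "\<phi> \<in> Cell K \<Longrightarrow> Tgt K \<phi> \<in> Loose K"
    and Dom_Tgt: "\<phi> \<in> Cell K \<Longrightarrow> Dom K (Tgt K \<phi>) = Dom K (Src K \<phi>)"
    and Cod_Tgt: "\<phi> \<in> Cell K \<Longrightarrow> Cod K (Tgt K \<phi>) = Cod K (Src K \<phi>)"
    and Id2_cells: "f \<in> Loose K \<Longrightarrow> Id2 K f \<in> cells K f f"
    and Vcomp_cells: "\<lbrakk>\<phi> \<in> cells K f g; \<psi> \<in> cells K g h\<rbrakk> \<Longrightarrow> \<psi> \<cdot> \<phi> \<in> cells K f h"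
    and Vcomp_assoc: "\<lbrakk>\<phi> \<in> cells K f g; \<psi> \<in> cells K g h; \<chi> \<in> cells K h k\<rbrakk>
      \<Longrightarrow> (\<chi> \<cdot> \<psi>) \<cdot> \<phi> = \<chi> \<cdot> (\<psi> \<cdot> \<phi>)"
    and Vcomp_Id2_left: "\<phi> \<in> cells K f g \<Longrightarrow> Id2 K g \<cdot> \<phi> = \<phi>"
    and Vcomp_Id2_right: "\<phi> \<in> cells K f g \<Longrightarrow> \<phi> \<cdot> Id2 K f = \<phi>"
    and Hcomp_cells: "\<lbrakk>\<phi> \<in> cells K f f'; \<psi> \<in> cells K g g'; Cod K f = Dom K g\<rbrakk>
      \<Longrightarrow> \<psi> \<star> \<phi> \<in> cells K (g \<odot> f) (g' \<odot> f')"
    and Hcomp_assoc: "\<lbrakk>\<phi> \<in> cells K f f'; \<psi> \<in> cells K g g'; \<chi> \<in> cells K h h';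
        Cod K f = Dom K g; Cod K g = Dom K h\<rbrakk>
      \<Longrightarrow> (\<chi> \<star> \<psi>) \<star> \<phi> = \<chi> \<star> (\<psi> \<star> \<phi>)"
    and Hcomp_Id_left: "\<phi> \<in> cells K f f' \<Longrightarrow> Id2 K (Id1 K (Cod K f)) \<star> \<phi> = \<phi>"
    and Hcomp_Id_right: "\<phi> \<in> cells K f f' \<Longrightarrow> \<phi> \<star> Id2 K (Id1 K (Dom K f)) = \<phi>"
    and Hcomp_Id2: "\<lbrakk>f \<in> hom K A B; g \<in> hom K B C\<rbrakk> \<Longrightarrow> Id2 K g \<star> Id2 K f = Id2 K (g \<odot> f)"
    and interchange: "\<lbrakk>\<phi> \<in> cells K f f'; \<phi>' \<in> cells K f' f''; \<psi> \<in> cells K g g';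
        \<psi>' \<in> cells K g' g''; Cod K f = Dom K g\<rbrakk>
      \<Longrightarrow> (\<psi>' \<cdot> \<psi>) \<star> (\<phi>' \<cdot> \<phi>) = (\<psi>' \<star> \<phi>') \<cdot> (\<psi> \<star> \<phi>)"

text \<open>Local fullness needs no axiom: the 2-cells between tight 1-cells are all the 2-cells of
  the ambient 2-category.\<close>

locale enhanced_2_category = two_category K
  for K :: "('o, 'm, 'c, 'z) enhanced_2cat_scheme" (structure) +
  assumes Tight_Loose: "Tight K \<subseteq> Loose K"
    and Id1_Tight: "A \<in> Obj K \<Longrightarrow> Id1 K A \<in> Tight K"
    and Comp_Tight: "\<lbrakk>f \<in> Tight K; g \<in> Tight K; Cod K f = Dom K g\<rbrakk> \<Longrightarrow> g \<odot> f \<in> Tight K"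

locale repletely_enhanced_2_category = enhanced_2_category K
  for K :: "('o, 'm, 'c, 'z) enhanced_2cat_scheme" (structure) +
  assumes Tight_replete:
    "\<lbrakk>invertible_cell K \<phi>; Src K \<phi> \<in> Tight K\<rbrakk> \<Longrightarrow> Tgt K \<phi> \<in> Tight K"

definition tight_terminal :: "('o, 'm, 'c, 'z) enhanced_2cat_scheme \<Rightarrow> 'o \<Rightarrow> bool" where
  "tight_terminal K t \<longleftrightarrow> t \<in> Obj K \<and>
     (\<forall>X \<in> Obj K. \<exists>!f. f \<in> hom K X t) \<and>
     (\<forall>X \<in> Obj K. \<forall>f \<in> hom K X t. \<forall>g \<in> hom K X t. \<exists>!\<phi>. \<phi> \<in> cells K f g) \<and>
     (\<forall>X \<in> Obj K. hom K X t \<subseteq> Tight K)"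


section \<open>Discrete opfibrations, pullbacks and plumbuses\<close>

definition tight_discrete_opfibration ::
  "('o, 'm, 'c, 'z) enhanced_2cat_scheme \<Rightarrow> 'm \<Rightarrow> bool" where
  "tight_discrete_opfibration K p \<longleftrightarrow> p \<in> Tight K \<and>
     (\<forall>X e b \<phi>. e \<in> hom K X (Dom K p) \<longrightarrow> b \<in> hom K X (Cod K p) \<longrightarrow>
        \<phi> \<in> cells K (p \<odot>\<^bsub>K\<^esub> e) b \<longrightarrow>
        (\<exists>!l. l \<in> Cell K \<and> Src K l = e \<and> p \<lhd>\<^bsub>K\<^esub> l = \<phi>))"

text \<open>\<open>is_pullback K p b q h\<close>: the square with left side \<open>q\<close>, right side \<open>p\<close>, bottom \<open>b\<close> and
  top \<open>h\<close> (so \<open>p h = b q\<close>) is a strict 2-categorical pullback, with its one- and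
  two-dimensional universal properties.\<close>

definition is_pullback ::
  "('o, 'm, 'c, 'z) enhanced_2cat_scheme \<Rightarrow> 'm \<Rightarrow> 'm \<Rightarrow> 'm \<Rightarrow> 'm \<Rightarrow> bool" where
  "is_pullback K p b q h \<longleftrightarrow>
     p \<in> Loose K \<and> b \<in> hom K (Dom K b) (Cod K p) \<and>
     q \<in> hom K (Dom K q) (Dom K b) \<and> h \<in> hom K (Dom K q) (Dom K p) \<and>
     p \<odot>\<^bsub>K\<^esub> h = b \<odot>\<^bsub>K\<^esub> q \<and>
     (\<forall>X x y. x \<in> hom K X (Dom K b) \<longrightarrow> y \<in> hom K X (Dom K p) \<longrightarrow>
        p \<odot>\<^bsub>K\<^esub> y = b \<odot>\<^bsub>K\<^esub> x \<longrightarrow>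
        (\<exists>!t. t \<in> hom K X (Dom K q) \<and> q \<odot>\<^bsub>K\<^esub> t = x \<and> h \<odot>\<^bsub>K\<^esub> t = y)) \<and>
     (\<forall>X x x' y y' \<phi> \<psi>. x \<in> hom K X (Dom K b) \<longrightarrow> x' \<in> hom K X (Dom K b) \<longrightarrow>
        y \<in> hom K X (Dom K p) \<longrightarrow> y' \<in> hom K X (Dom K p) \<longrightarrow>
        \<phi> \<in> cells K x x' \<longrightarrow> \<psi> \<in> cells K y y' \<longrightarrow> p \<lhd>\<^bsub>K\<^esub> \<psi> = b \<lhd>\<^bsub>K\<^esub> \<phi> \<longrightarrow>
        (\<exists>!\<chi>. \<chi> \<in> Cell K \<and> Dom K (Src K \<chi>) = X \<and> Cod K (Src K \<chi>) = Dom K q \<and>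
           q \<lhd>\<^bsub>K\<^esub> \<chi> = \<phi> \<and> h \<lhd>\<^bsub>K\<^esub> \<chi> = \<psi>))"

definition left_tight_pullback ::
  "('o, 'm, 'c, 'z) enhanced_2cat_scheme \<Rightarrow> 'm \<Rightarrow> 'm \<Rightarrow> 'm \<Rightarrow> 'm \<Rightarrow> bool" where
  "left_tight_pullback K p b q h \<longleftrightarrow> p \<in> Tight K \<and> is_pullback K p b q h \<and> q \<in> Tight K \<and>
     (\<forall>X. \<forall>k \<in> hom K X (Dom K q). q \<odot>\<^bsub>K\<^esub> k \<in> Tight K \<longrightarrow> k \<in> Tight K)"

text \<open>A smallness structure: the class of small discrete opfibrations, and for small \<open>p\<close> and
  loose \<open>b\<close> the chosen pullback \<open>Pb p b\<close> of \<open>p\<close> along \<open>b\<close> with its other projection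
  \<open>PbTop p b\<close> to the domain of \<open>p\<close>.\<close>

record 'm smallness =
  Small :: "'m set"
  Pb :: "'m \<Rightarrow> 'm \<Rightarrow> 'm"
  PbTop :: "'m \<Rightarrow> 'm \<Rightarrow> 'm"

locale plumbus = repletely_enhanced_2_category K
  for K :: "('o, 'm, 'c, 'z) enhanced_2cat_scheme" (structure)
    and S :: "'m smallness" +
  assumes terminal: "\<exists>t. tight_terminal K t"
    and Small_opfib: "p \<in> Small S \<Longrightarrow> tight_discrete_opfibration K p"
    and Small_stable: "\<lbrakk>p \<in> Small S; left_tight_pullback K p b q h\<rbrakk> \<Longrightarrow> q \<in> Small S"
    and Pb_pullback: "\<lbrakk>p \<in> Small S; b \<in> hom K A (Cod K p)\<rbrakk>
      \<Longrightarrow> left_tight_pullback K p b (Pb S p b) (PbTop S p b)"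
    and Pb_Id1: "p \<in> Small S \<Longrightarrow> Pb S p (Id1 K (Cod K p)) = p"
    and PbTop_Id1: "p \<in> Small S \<Longrightarrow> PbTop S p (Id1 K (Cod K p)) = Id1 K (Dom K p)"
    and Pb_Comp: "\<lbrakk>p \<in> Small S; b \<in> hom K A (Cod K p); c \<in> hom K A' A\<rbrakk>
      \<Longrightarrow> Pb S p (b \<odot> c) = Pb S (Pb S p b) c"
    and PbTop_Comp: "\<lbrakk>p \<in> Small S; b \<in> hom K A (Cod K p); c \<in> hom K A' A\<rbrakk>
      \<Longrightarrow> PbTop S p (b \<odot> c) = PbTop S p b \<odot> PbTop S (Pb S p b) c"


section \<open>Enhanced 2-classifiers\<close>

text \<open>\<open>cl_u\<close> is the universal small discrete opfibration \<open>u\<close>; for small \<open>p\<close> the chosen square from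
  \<open>p\<close> to \<open>u\<close> has top \<open>cl_top p\<close> (the map \<open>d\<^sub>\<bullet>p\<close>) and bottom \<open>cl_map p\<close> (the classifying map
  \<open>dp\<close>).\<close>

record 'm classifier =
  cl_u :: 'm
  cl_top :: "'m \<Rightarrow> 'm"
  cl_map :: "'m \<Rightarrow> 'm"

definition compatible_pair ::
  "('o, 'm, 'c, 'z) enhanced_2cat_scheme \<Rightarrow> 'm \<Rightarrow> 'm \<Rightarrow> 'm \<Rightarrow> 'm \<Rightarrow> 'm \<Rightarrow> 'm \<Rightarrow> 'c \<times> 'c \<Rightarrow> bool" where
  "compatible_pair K u p x x' y y' = (\<lambda>(\<gamma>\<^sub>1, \<gamma>).
     \<gamma>\<^sub>1 \<in> cells K x x' \<and> \<gamma> \<in> cells K y y' \<and> u \<lhd>\<^bsub>K\<^esub> \<gamma>\<^sub>1 = \<gamma> \<rhd>\<^bsub>K\<^esub> p)"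

definition enhanced_2_classifier ::
  "('o, 'm, 'c, 'z) enhanced_2cat_scheme \<Rightarrow> 'm set \<Rightarrow> 'm classifier \<Rightarrow> bool" where
  "enhanced_2_classifier K small D \<longleftrightarrow>
     cl_u D \<in> small \<and>
     (\<forall>p \<in> small. is_pullback K (cl_u D) (cl_map D p) p (cl_top D p)) \<and>
     (\<forall>p \<in> small. \<forall>p' \<in> small. \<forall>g \<in> hom K (Dom K p) (Dom K p'). \<forall>f \<in> hom K (Cod K p) (Cod K p').
        p' \<odot>\<^bsub>K\<^esub> g = f \<odot>\<^bsub>K\<^esub> p \<longrightarrow>
        (\<exists>!\<gamma>s. compatible_pair K (cl_u D) p (cl_top D p) (cl_top D p' \<odot>\<^bsub>K\<^esub> g)
           (cl_map D p) (cl_map D p' \<odot>\<^bsub>K\<^esub> f) \<gamma>s)) \<and>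
     (\<forall>p \<in> small. \<forall>p' \<in> small. \<forall>g f. is_pullback K p' f p g \<longrightarrow>
        (\<forall>\<gamma>\<^sub>1 \<gamma>. compatible_pair K (cl_u D) p (cl_top D p) (cl_top D p' \<odot>\<^bsub>K\<^esub> g)
           (cl_map D p) (cl_map D p' \<odot>\<^bsub>K\<^esub> f) (\<gamma>\<^sub>1, \<gamma>) \<longrightarrow>
           invertible_cell K \<gamma>\<^sub>1 \<and> invertible_cell K \<gamma>)) \<and>
     (\<exists>\<iota>\<^sub>1 \<iota>. compatible_pair K (cl_u D) (cl_u D)
        (cl_top D (cl_u D)) (Id1 K (Dom K (cl_u D)))
        (cl_map D (cl_u D)) (Id1 K (Cod K (cl_u D))) (\<iota>\<^sub>1, \<iota>) \<and>
        invertible_cell K \<iota>\<^sub>1 \<and> invertible_cell K \<iota>)"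

locale representable_plumbus = plumbus K S
  for K :: "('o, 'm, 'c, 'z) enhanced_2cat_scheme" (structure)
    and S :: "'m smallness"
    and D :: "'m classifier" +
  assumes classifier: "enhanced_2_classifier K (Small S) D"
    and Id1_terminal_Small: "tight_terminal K t \<Longrightarrow> Id1 K t \<in> Small S"


section \<open>Enhanced 2-monads\<close>

record ('o, 'm, 'c) two_monad =
  TO :: "'o \<Rightarrow> 'o"
  TM :: "'m \<Rightarrow> 'm"
  TC :: "'c \<Rightarrow> 'c"
  eta :: "'o \<Rightarrow> 'm"
  mu :: "'o \<Rightarrow> 'm"

locale enhanced_2_monad = enhanced_2_category K
  for K :: "('o, 'm, 'c, 'z) enhanced_2cat_scheme" (structure)
    and T :: "('o, 'm, 'c) two_monad" +
  assumes TO_Obj: "A \<in> Obj K \<Longrightarrow> TO T A \<in> Obj K"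
    and TM_hom: "f \<in> hom K A B \<Longrightarrow> TM T f \<in> hom K (TO T A) (TO T B)"
    and TM_Tight: "f \<in> Tight K \<Longrightarrow> TM T f \<in> Tight K"
    and TC_cells: "\<phi> \<in> cells K f g \<Longrightarrow> TC T \<phi> \<in> cells K (TM T f) (TM T g)"
    and TM_Id1: "A \<in> Obj K \<Longrightarrow> TM T (Id1 K A) = Id1 K (TO T A)"
    and TM_Comp: "\<lbrakk>f \<in> hom K A B; g \<in> hom K B C\<rbrakk> \<Longrightarrow> TM T (g \<odot> f) = TM T g \<odot> TM T f"
    and TC_Id2: "f \<in> Loose K \<Longrightarrow> TC T (Id2 K f) = Id2 K (TM T f)"
    and TC_Vcomp: "\<lbrakk>\<phi> \<in> cells K f g; \<psi> \<in> cells K g h\<rbrakk> \<Longrightarrow> TC T (\<psi> \<cdot> \<phi>) = TC T \<psi> \<cdot> TC T \<phi>"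
    and TC_Hcomp: "\<lbrakk>\<phi> \<in> cells K f f'; \<psi> \<in> cells K g g'; Cod K f = Dom K g\<rbrakk>
      \<Longrightarrow> TC T (\<psi> \<star> \<phi>) = TC T \<psi> \<star> TC T \<phi>"
    and eta_hom: "A \<in> Obj K \<Longrightarrow> eta T A \<in> hom K A (TO T A)"
    and eta_Tight: "A \<in> Obj K \<Longrightarrow> eta T A \<in> Tight K"
    and eta_natural: "f \<in> hom K A B \<Longrightarrow> TM T f \<odot> eta T A = eta T B \<odot> f"
    and eta_natural2: "\<lbrakk>f \<in> hom K A B; \<phi> \<in> cells K f g\<rbrakk>
      \<Longrightarrow> TC T \<phi> \<rhd> eta T A = eta T B \<lhd> \<phi>"
    and mu_hom: "A \<in> Obj K \<Longrightarrow> mu T A \<in> hom K (TO T (TO T A)) (TO T A)"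
    and mu_Tight: "A \<in> Obj K \<Longrightarrow> mu T A \<in> Tight K"
    and mu_natural: "f \<in> hom K A B \<Longrightarrow> TM T f \<odot> mu T A = mu T B \<odot> TM T (TM T f)"
    and mu_natural2: "\<lbrakk>f \<in> hom K A B; \<phi> \<in> cells K f g\<rbrakk>
      \<Longrightarrow> TC T \<phi> \<rhd> mu T A = mu T B \<lhd> TC T (TC T \<phi>)"
    and mu_eta: "A \<in> Obj K \<Longrightarrow> mu T A \<odot> eta T (TO T A) = Id1 K (TO T A)"
    and mu_T_eta: "A \<in> Obj K \<Longrightarrow> mu T A \<odot> TM T (eta T A) = Id1 K (TO T A)"
    and mu_assoc: "A \<in> Obj K \<Longrightarrow> mu T A \<odot> mu T (TO T A) = mu T A \<odot> TM T (mu T A)"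


section \<open>The enhanced 2-category of lax algebras\<close>

datatype ('o, 'm, 'c) lax_alg =
  LaxAlg (carr: 'o) (act: 'm) (unitor: 'c) (multor: 'c)

datatype ('o, 'm, 'c) lax_mor =
  LaxMor (lm_dom: "('o, 'm, 'c) lax_alg") (lm_cod: "('o, 'm, 'c) lax_alg") (und: 'm) (bar: 'c)

datatype ('o, 'm, 'c) lax_cell =
  LaxCell (lc_src: "('o, 'm, 'c) lax_mor") (lc_tgt: "('o, 'm, 'c) lax_mor") (und_cell: 'c)

definition lax_algebra ::
  "('o, 'm, 'c, 'z) enhanced_2cat_scheme \<Rightarrow> ('o, 'm, 'c) two_monad \<Rightarrow> ('o, 'm, 'c) lax_alg \<Rightarrow> bool"
where
  "lax_algebra K T X \<longleftrightarrow>
     (let A = carr X; \<alpha> = act X; \<upsilon> = unitor X; \<mu> = multor X in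
       A \<in> Obj K \<and> \<alpha> \<in> hom K (TO T A) A \<and> \<alpha> \<in> Tight K \<and>
       \<upsilon> \<in> cells K (Id1 K A) (\<alpha> \<odot>\<^bsub>K\<^esub> eta T A) \<and>
       \<mu> \<in> cells K (\<alpha> \<odot>\<^bsub>K\<^esub> TM T \<alpha>) (\<alpha> \<odot>\<^bsub>K\<^esub> mu T A) \<and>
       (\<mu> \<rhd>\<^bsub>K\<^esub> eta T (TO T A)) \<cdot>\<^bsub>K\<^esub> (\<upsilon> \<rhd>\<^bsub>K\<^esub> \<alpha>) = Id2 K \<alpha> \<and>
       (\<mu> \<rhd>\<^bsub>K\<^esub> TM T (eta T A)) \<cdot>\<^bsub>K\<^esub> (\<alpha> \<lhd>\<^bsub>K\<^esub> TC T \<upsilon>) = Id2 K \<alpha> \<and>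
       (\<mu> \<rhd>\<^bsub>K\<^esub> mu T (TO T A)) \<cdot>\<^bsub>K\<^esub> (\<mu> \<rhd>\<^bsub>K\<^esub> TM T (TM T \<alpha>)) =
         (\<mu> \<rhd>\<^bsub>K\<^esub> TM T (mu T A)) \<cdot>\<^bsub>K\<^esub> (\<alpha> \<lhd>\<^bsub>K\<^esub> TC T \<mu>))"

definition lax_morphism ::
  "('o, 'm, 'c, 'z) enhanced_2cat_scheme \<Rightarrow> ('o, 'm, 'c) two_monad \<Rightarrow> ('o, 'm, 'c) lax_mor \<Rightarrow> bool"
where
  "lax_morphism K T F \<longleftrightarrow>
     (let X = lm_dom F; Y = lm_cod F; A = carr X; B = carr Y; \<alpha> = act X; \<beta> = act Y;
          f = und F; f' = bar F in
       lax_algebra K T X \<and> lax_algebra K T Y \<and>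
       f \<in> hom K A B \<and> f' \<in> cells K (\<beta> \<odot>\<^bsub>K\<^esub> TM T f) (f \<odot>\<^bsub>K\<^esub> \<alpha>) \<and>
       f \<lhd>\<^bsub>K\<^esub> unitor X = (f' \<rhd>\<^bsub>K\<^esub> eta T A) \<cdot>\<^bsub>K\<^esub> (unitor Y \<rhd>\<^bsub>K\<^esub> f) \<and>
       (f \<lhd>\<^bsub>K\<^esub> multor X) \<cdot>\<^bsub>K\<^esub> (f' \<rhd>\<^bsub>K\<^esub> TM T \<alpha>) \<cdot>\<^bsub>K\<^esub> (\<beta> \<lhd>\<^bsub>K\<^esub> TC T f') =
         (f' \<rhd>\<^bsub>K\<^esub> mu T A) \<cdot>\<^bsub>K\<^esub> (multor Y \<rhd>\<^bsub>K\<^esub> TM T (TM T f)))"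

definition pseudo_morphism ::
  "('o, 'm, 'c, 'z) enhanced_2cat_scheme \<Rightarrow> ('o, 'm, 'c) two_monad \<Rightarrow> ('o, 'm, 'c) lax_mor \<Rightarrow> bool"
where
  "pseudo_morphism K T F \<longleftrightarrow> lax_morphism K T F \<and> invertible_cell K (bar F)"

definition strict_morphism ::
  "('o, 'm, 'c, 'z) enhanced_2cat_scheme \<Rightarrow> ('o, 'm, 'c) two_monad \<Rightarrow> ('o, 'm, 'c) lax_mor \<Rightarrow> bool"
where
  "strict_morphism K T F \<longleftrightarrow>
     lax_morphism K T F \<and> bar F = Id2 K (und F \<odot>\<^bsub>K\<^esub> act (lm_dom F))"

definition T_2_morphism ::
  "('o, 'm, 'c, 'z) enhanced_2cat_scheme \<Rightarrow> ('o, 'm, 'c) two_monad \<Rightarrow> ('o, 'm, 'c) lax_cell \<Rightarrow> bool"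
where
  "T_2_morphism K T \<Phi> \<longleftrightarrow>
     (let F = lc_src \<Phi>; F' = lc_tgt \<Phi>; \<phi> = und_cell \<Phi> in
       lax_morphism K T F \<and> lax_morphism K T F' \<and>
       lm_dom F = lm_dom F' \<and> lm_cod F = lm_cod F' \<and>
       \<phi> \<in> cells K (und F) (und F') \<and>
       (\<phi> \<rhd>\<^bsub>K\<^esub> act (lm_dom F)) \<cdot>\<^bsub>K\<^esub> bar F = bar F' \<cdot>\<^bsub>K\<^esub> (act (lm_cod F) \<lhd>\<^bsub>K\<^esub> TC T \<phi>))"

definition lax_comp ::
  "('o, 'm, 'c, 'z) enhanced_2cat_scheme \<Rightarrow> ('o, 'm, 'c) two_monad \<Rightarrow>
   ('o, 'm, 'c) lax_mor \<Rightarrow> ('o, 'm, 'c) lax_mor \<Rightarrow> ('o, 'm, 'c) lax_mor"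
where
  "lax_comp K T G F = LaxMor (lm_dom F) (lm_cod G) (und G \<odot>\<^bsub>K\<^esub> und F)
     ((und G \<lhd>\<^bsub>K\<^esub> bar F) \<cdot>\<^bsub>K\<^esub> (bar G \<rhd>\<^bsub>K\<^esub> TM T (und F)))"

definition LAXALG ::
  "('o, 'm, 'c, 'z) enhanced_2cat_scheme \<Rightarrow> ('o, 'm, 'c) two_monad \<Rightarrow>
   (('o, 'm, 'c) lax_alg, ('o, 'm, 'c) lax_mor, ('o, 'm, 'c) lax_cell) enhanced_2cat"
where
  "LAXALG K T = \<lparr>
     Obj = {X. lax_algebra K T X},
     Loose = {F. lax_morphism K T F},
     Tight = {F. pseudo_morphism K T F \<and> und F \<in> Tight K},
     Cell = {\<Phi>. T_2_morphism K T \<Phi>},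
     Dom = lm_dom,
     Cod = lm_cod,
     Src = lc_src,
     Tgt = lc_tgt,
     Id1 = (\<lambda>X. LaxMor X X (Id1 K (carr X)) (Id2 K (act X))),
     Id2 = (\<lambda>F. LaxCell F F (Id2 K (und F))),
     Comp = lax_comp K T,
     Vcomp = (\<lambda>\<Psi> \<Phi>. LaxCell (lc_src \<Phi>) (lc_tgt \<Psi>) (und_cell \<Psi> \<cdot>\<^bsub>K\<^esub> und_cell \<Phi>)),
     Hcomp = (\<lambda>\<Psi> \<Phi>. LaxCell (lax_comp K T (lc_src \<Psi>) (lc_src \<Phi>))
       (lax_comp K T (lc_tgt \<Psi>) (lc_tgt \<Phi>)) (und_cell \<Psi> \<star>\<^bsub>K\<^esub> und_cell \<Phi>)) \<rparr>"

definition lax_Small ::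
  "('o, 'm, 'c, 'z) enhanced_2cat_scheme \<Rightarrow> 'm smallness \<Rightarrow> ('o, 'm, 'c) two_monad \<Rightarrow>
   ('o, 'm, 'c) lax_mor set"
where
  "lax_Small K S T = {F. strict_morphism K T F \<and> und F \<in> Small S}"


section \<open>Opfibrantly cartesian 2-monads and the lifted classifier\<close>

definition opfibrantly_cartesian ::
  "('o, 'm, 'c, 'z) enhanced_2cat_scheme \<Rightarrow> 'm smallness \<Rightarrow> 'm classifier \<Rightarrow>
   ('o, 'm, 'c) two_monad \<Rightarrow> bool"
where
  "opfibrantly_cartesian K S D T \<longleftrightarrow>
     TM T (cl_u D) \<in> Small S \<and>
     (\<forall>b q h. is_pullback K (cl_u D) b q h \<longrightarrow>
        is_pullback K (TM T (cl_u D)) (TM T b) (TM T q) (TM T h)) \<and>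
     cl_map D (TM T (cl_u D)) \<in> Tight K"

definition omega_top :: "'m classifier \<Rightarrow> ('o, 'm, 'c) two_monad \<Rightarrow> 'm" where
  "omega_top D T = cl_top D (TM T (cl_u D))"

definition omega :: "'m classifier \<Rightarrow> ('o, 'm, 'c) two_monad \<Rightarrow> 'm" where
  "omega D T = cl_map D (TM T (cl_u D))"

definition omega_unitors ::
  "('o, 'm, 'c, 'z) enhanced_2cat_scheme \<Rightarrow> 'm classifier \<Rightarrow> ('o, 'm, 'c) two_monad \<Rightarrow> 'c \<times> 'c"
where
  "omega_unitors K D T = (let u = cl_u D in
     THE \<gamma>s. compatible_pair K u u
       (Id1 K (Dom K u)) (omega_top D T \<odot>\<^bsub>K\<^esub> eta T (Dom K u))
       (Id1 K (Cod K u)) (omega D T \<odot>\<^bsub>K\<^esub> eta T (Cod K u)) \<gamma>s)"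

definition omega_multors ::
  "('o, 'm, 'c, 'z) enhanced_2cat_scheme \<Rightarrow> 'm classifier \<Rightarrow> ('o, 'm, 'c) two_monad \<Rightarrow> 'c \<times> 'c"
where
  "omega_multors K D T = (let u = cl_u D in
     THE \<gamma>s. compatible_pair K u (TM T (TM T u))
       (omega_top D T \<odot>\<^bsub>K\<^esub> TM T (omega_top D T)) (omega_top D T \<odot>\<^bsub>K\<^esub> mu T (Dom K u))
       (omega D T \<odot>\<^bsub>K\<^esub> TM T (omega D T)) (omega D T \<odot>\<^bsub>K\<^esub> mu T (Cod K u)) \<gamma>s)"

definition Omega_top_alg ::
  "('o, 'm, 'c, 'z) enhanced_2cat_scheme \<Rightarrow> 'm classifier \<Rightarrow> ('o, 'm, 'c) two_monad \<Rightarrow>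
   ('o, 'm, 'c) lax_alg"
where
  "Omega_top_alg K D T = LaxAlg (Dom K (cl_u D)) (omega_top D T)
     (fst (omega_unitors K D T)) (fst (omega_multors K D T))"

definition Omega_alg ::
  "('o, 'm, 'c, 'z) enhanced_2cat_scheme \<Rightarrow> 'm classifier \<Rightarrow> ('o, 'm, 'c) two_monad \<Rightarrow>
   ('o, 'm, 'c) lax_alg"
where
  "Omega_alg K D T = LaxAlg (Cod K (cl_u D)) (omega D T)
     (snd (omega_unitors K D T)) (snd (omega_multors K D T))"

text \<open>For a strict \<open>p : (E,\<epsilon>) \<rightarrow> (B,\<beta>)\<close> with small underlying map, the classifying square of the
  underlying map underlies a square of lax morphisms; their structure 2-cells
  \<open>\<omega>\<^sub>\<bullet> T(d\<^sub>\<bullet>p) \<Rightarrow> d\<^sub>\<bullet>p \<epsilon>\<close> and \<open>\<omega> T(dp) \<Rightarrow> dp \<beta>\<close> are the unique pair compatible with \<open>u\<close>.\<close>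

definition classifying_bars ::
  "('o, 'm, 'c, 'z) enhanced_2cat_scheme \<Rightarrow> 'm classifier \<Rightarrow> ('o, 'm, 'c) two_monad \<Rightarrow>
   ('o, 'm, 'c) lax_mor \<Rightarrow> 'c \<times> 'c"
where
  "classifying_bars K D T P = (let p = und P in
     THE \<gamma>s. compatible_pair K (cl_u D) (TM T p)
       (omega_top D T \<odot>\<^bsub>K\<^esub> TM T (cl_top D p)) (cl_top D p \<odot>\<^bsub>K\<^esub> act (lm_dom P))
       (omega D T \<odot>\<^bsub>K\<^esub> TM T (cl_map D p)) (cl_map D p \<odot>\<^bsub>K\<^esub> act (lm_cod P)) \<gamma>s)"

definition lax_classifier ::
  "('o, 'm, 'c, 'z) enhanced_2cat_scheme \<Rightarrow> 'm classifier \<Rightarrow> ('o, 'm, 'c) two_monad \<Rightarrow>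
   ('o, 'm, 'c) lax_mor classifier"
where
  "lax_classifier K D T = \<lparr>
     cl_u = LaxMor (Omega_top_alg K D T) (Omega_alg K D T) (cl_u D)
       (Id2 K (cl_u D \<odot>\<^bsub>K\<^esub> omega_top D T)),
     cl_top = (\<lambda>P. LaxMor (lm_dom P) (Omega_top_alg K D T) (cl_top D (und P))
       (fst (classifying_bars K D T P))),
     cl_map = (\<lambda>P. LaxMor (lm_cod P) (Omega_alg K D T) (cl_map D (und P))
       (snd (classifying_bars K D T P))) \<rparr>"


section \<open>T-cartesian morphisms\<close>

definition split_equivalence :: "('o, 'm, 'c, 'z) enhanced_2cat_scheme \<Rightarrow> 'm \<Rightarrow> bool" where
  "split_equivalence K \<delta> \<longleftrightarrow> \<delta> \<in> Loose K \<and>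
     (\<exists>j \<in> hom K (Cod K \<delta>) (Dom K \<delta>). \<delta> \<odot>\<^bsub>K\<^esub> j = Id1 K (Cod K \<delta>) \<and>
        (\<exists>\<epsilon> \<in> cells K (j \<odot>\<^bsub>K\<^esub> \<delta>) (Id1 K (Dom K \<delta>)). invertible_cell K \<epsilon>))"

text \<open>For a strict \<open>f : (A,\<alpha>) \<rightarrow> (B,\<beta>)\<close> and a pullback \<open>q : \<beta>\<^sup>*A \<rightarrow> TB\<close> of \<open>f\<close> along \<open>\<beta>\<close> with other
  projection \<open>h : \<beta>\<^sup>*A \<rightarrow> A\<close>, the comparison map \<open>\<delta>\<close> is determined by \<open>q \<delta> = Tf\<close> and \<open>h \<delta> = \<alpha>\<close>.
  Being a split equivalence does not depend on which pullback is used.\<close>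

definition T_cartesian ::
  "('o, 'm, 'c, 'z) enhanced_2cat_scheme \<Rightarrow> ('o, 'm, 'c) two_monad \<Rightarrow> ('o, 'm, 'c) lax_mor \<Rightarrow> bool"
where
  "T_cartesian K T F \<longleftrightarrow> strict_morphism K T F \<and>
     (\<exists>q h \<delta>. left_tight_pullback K (und F) (act (lm_cod F)) q h \<and>
        \<delta> \<in> hom K (TO T (carr (lm_dom F))) (Dom K q) \<and>
        q \<odot>\<^bsub>K\<^esub> \<delta> = TM T (und F) \<and> h \<odot>\<^bsub>K\<^esub> \<delta> = act (lm_dom F) \<and>
        split_equivalence K \<delta>)"

end

theory Submission
  imports Defs
begin

text \<open>Pullback squares over \<open>u\<close> are initial: if \<open>(h, b)\<close> is a pullback square from \<open>q\<close> to \<open>u\<close>, then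
  every commuting square from \<open>q\<close> to \<open>u\<close> receives exactly one pair of 2-cells from \<open>(h, b)\<close> that is
  compatible with \<open>u\<close> (\<open>cartesian_squares_initial\<close>). Read in the arrow 2-category of \<open>K\<close>, whose
  objects are the 1-cells of \<open>K\<close>, whose 1-cells are commuting squares and whose 2-cells are
  compatible pairs, this says that such a square is an initial object of the hom-category from \<open>q\<close>
  to \<open>u\<close>. The 2-monad acts on the arrow 2-category, and since it preserves pullbacks of \<open>u\<close> and
  the square \<open>(\<omega>\<^sub>\<bullet>, \<omega>)\<close> is a pullback, \<open>(\<omega>\<^sub>\<bullet>, \<omega>) \<circ> T s\<close> is again a pullback square for every pullback
  square \<open>s\<close> into \<open>u\<close>.

  These two facts produce all the algebra. An object \<open>u\<close> of a 2-category with a 2-monad, together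
  with \<open>w : T u \<rightarrow> u\<close> and a class of initial 1-cells into \<open>u\<close> closed under \<open>s \<mapsto> w \<circ> T s\<close>, is a lax
  algebra in exactly one way, and a 1-cell of the class out of a lax algebra is a lax morphism in
  exactly one way: both sides of each axiom are 2-cells out of an initial 1-cell
  (locale \<open>initial_lifting\<close>). A strict morphism of lax algebras is a lax algebra in the
  arrow 2-category, so this one argument yields the lax algebras \<open>\<Omega>\<^sub>\<bullet>\<close> and \<open>\<Omega>\<close>, the lax morphisms
  \<open>d\<^sub>\<bullet>p\<close> and \<open>dp\<close>, and the fact that they form an initial lax square over \<open>u\<close>.

  For the theorem itself let \<open>p : (E, \<epsilon>) \<rightarrow> (B, \<beta>)\<close> and let \<open>\<delta> : T E \<rightarrow> \<beta>\<^sup>*E\<close> be the comparison map. The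
  structure 2-cell of \<open>dp\<close> is the bottom of the unique pair
  \<open>(\<omega>\<^sub>\<bullet> T(d\<^sub>\<bullet>p), \<omega> T(dp)) \<Rightarrow> (d\<^sub>\<bullet>p \<epsilon>, dp \<beta>)\<close> of squares from \<open>T p\<close> to \<open>u\<close>. The source is a pullback
  square. If \<open>\<delta>\<close> is invertible then the target is one as well, because it is the pullback square
  on \<open>\<beta>\<^sup>*E\<close> precomposed with \<open>\<delta>\<close>; both squares are then initial and the pair is invertible.
  Conversely, lifting the inverse of the bottom 2-cell along the discrete opfibration \<open>u\<close> gives a
  map \<open>\<beta>\<^sup>*E \<rightarrow> T E\<close>, and uniqueness of lifts makes it inverse to \<open>\<delta>\<close>
  (\<open>invertible_bottom_gives_inverse\<close>). Finally, \<open>\<delta>\<close> is a split equivalence just when it is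
  invertible, since it lives over the discrete opfibration \<open>T p\<close>, along which identities lift only
  to identities (\<open>split_equivalence_over_unique_lifts\<close>).

  Any other enhanced 2-classifier of the lax algebras on the same \<open>u\<close> gives a lax square from \<open>p\<close> to
  \<open>u\<close> with a map to the lifted square by its own universal property, and from it by initiality of
  the lifted square. Both round trips are identities, so the two classifying maps are isomorphic
  lax morphisms, and isomorphic lax morphisms are pseudo together (\<open>bar_invertible_iff\<close>).\<close>

section \<open>Calculus in a 2-category\<close>

lemma in_hom: "f \<in> hom K A B \<longleftrightarrow> f \<in> Loose K \<and> Dom K f = A \<and> Cod K f = B"
  by (simp add: hom_def)

lemma in_cells: "\<phi> \<in> cells K f g \<longleftrightarrow> \<phi> \<in> Cell K \<and> Src K \<phi> = f \<and> Tgt K \<phi> = g"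
  by (simp add: cells_def)

context two_category
begin

declare Dom_Obj [simp] Cod_Obj [simp] Src_Loose [simp] Tgt_Loose [simp] Dom_Tgt [simp] Cod_Tgt
    [simp]

lemma Id1_simps [simp]:
  assumes "A \<in> Obj K"
  shows "Id1 K A \<in> Loose K" "Dom K (Id1 K A) = A" "Cod K (Id1 K A) = A"
  using Id1_hom[OF assms] by (simp_all add: in_hom)

lemma Comp_simps [simp]:
  assumes "f \<in> Loose K" "g \<in> Loose K" "Cod K f = Dom K g"
  shows "g \<odot> f \<in> Loose K" "Dom K (g \<odot> f) = Dom K f" "Cod K (g \<odot> f) = Cod K g"
  using Comp_hom[of f "Dom K f" "Dom K g" g "Cod K g"] assms by (simp_all add: in_hom)

lemma Comp_Id1 [simp]:
  "\<lbrakk>f \<in> Loose K; Dom K f = A\<rbrakk> \<Longrightarrow> f \<odot> Id1 K A = f"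
  "\<lbrakk>f \<in> Loose K; Cod K f = A\<rbrakk> \<Longrightarrow> Id1 K A \<odot> f = f"
  using Comp_Id1_left Comp_Id1_right by (auto simp add: in_hom)

lemma Comp_assoc_simp [simp]:
  "\<lbrakk>f \<in> Loose K; g \<in> Loose K; h \<in> Loose K; Cod K f = Dom K g; Cod K g = Dom K h\<rbrakk>
    \<Longrightarrow> (h \<odot> g) \<odot> f = h \<odot> (g \<odot> f)"
  using Comp_assoc by (simp add: in_hom)

lemma Comp_extend:
  assumes "g \<odot> f = e" "f \<in> Loose K" "g \<in> Loose K" "x \<in> Loose K" "Cod K x = Dom K f"
    "Cod K f = Dom K g"
  shows "g \<odot> (f \<odot> x) = e \<odot> x"
  using assms Comp_assoc_simp[of x f g] by simp

lemma Id2_simps [simp]: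
  assumes "f \<in> Loose K"
  shows "Id2 K f \<in> Cell K" "Src K (Id2 K f) = f" "Tgt K (Id2 K f) = f"
  using Id2_cells[OF assms] by (simp_all add: in_cells)

lemma Vcomp_simps [simp]:
  assumes "\<phi> \<in> Cell K" "\<psi> \<in> Cell K" "Tgt K \<phi> = Src K \<psi>"
  shows "\<psi> \<cdot> \<phi> \<in> Cell K" "Src K (\<psi> \<cdot> \<phi>) = Src K \<phi>" "Tgt K (\<psi> \<cdot> \<phi>) = Tgt K \<psi>"
  using Vcomp_cells[of \<phi> "Src K \<phi>" "Tgt K \<phi>" \<psi> "Tgt K \<psi>"] assms by (simp_all add: in_cells)

lemma Vcomp_Id2 [simp]:
  "\<lbrakk>\<phi> \<in> Cell K; Src K \<phi> = f\<rbrakk> \<Longrightarrow> \<phi> \<cdot> Id2 K f = \<phi>"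
  "\<lbrakk>\<phi> \<in> Cell K; Tgt K \<phi> = f\<rbrakk> \<Longrightarrow> Id2 K f \<cdot> \<phi> = \<phi>"
  using Vcomp_Id2_left Vcomp_Id2_right by (auto simp add: in_cells)

lemma Vcomp_assoc_simp [simp]:
  "\<lbrakk>\<phi> \<in> Cell K; \<psi> \<in> Cell K; \<chi> \<in> Cell K; Tgt K \<phi> = Src K \<psi>; Tgt K \<psi> = Src K \<chi>\<rbrakk>
    \<Longrightarrow> (\<chi> \<cdot> \<psi>) \<cdot> \<phi> = \<chi> \<cdot> (\<psi> \<cdot> \<phi>)"
  using Vcomp_assoc by (simp add: in_cells)

lemma Hcomp_simps [simp]:
  assumes "\<phi> \<in> Cell K" "\<psi> \<in> Cell K" "Cod K (Src K \<phi>) = Dom K (Src K \<psi>)"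
  shows "\<psi> \<star> \<phi> \<in> Cell K" "Src K (\<psi> \<star> \<phi>) = Src K \<psi> \<odot> Src K \<phi>"
    "Tgt K (\<psi> \<star> \<phi>) = Tgt K \<psi> \<odot> Tgt K \<phi>"
  using Hcomp_cells[of \<phi> "Src K \<phi>" "Tgt K \<phi>" \<psi> "Src K \<psi>" "Tgt K \<psi>"] assms
  by (simp_all add: in_cells)

lemma Hcomp_assoc_simp [simp]:
  "\<lbrakk>\<phi> \<in> Cell K; \<psi> \<in> Cell K; \<chi> \<in> Cell K; Cod K (Src K \<phi>) = Dom K (Src K \<psi>);
    Cod K (Src K \<psi>) = Dom K (Src K \<chi>)\<rbrakk>
    \<Longrightarrow> (\<chi> \<star> \<psi>) \<star> \<phi> = \<chi> \<star> (\<psi> \<star> \<phi>)"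
  using Hcomp_assoc by (simp add: in_cells)

lemma Hcomp_Id [simp]:
  "\<lbrakk>\<phi> \<in> Cell K; Cod K (Src K \<phi>) = A\<rbrakk> \<Longrightarrow> Id2 K (Id1 K A) \<star> \<phi> = \<phi>"
  "\<lbrakk>\<phi> \<in> Cell K; Dom K (Src K \<phi>) = A\<rbrakk> \<Longrightarrow> \<phi> \<star> Id2 K (Id1 K A) = \<phi>"
  using Hcomp_Id_left Hcomp_Id_right by (auto simp add: in_cells)

lemma Hcomp_Id2_simp [simp]:
  "\<lbrakk>f \<in> Loose K; g \<in> Loose K; Cod K f = Dom K g\<rbrakk> \<Longrightarrow> Id2 K g \<star> Id2 K f = Id2 K (g \<odot> f)"
  using Hcomp_Id2 by (simp add: in_hom)

lemma Hcomp_Id2_merge [simp]: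
  assumes "f \<in> Loose K" "g \<in> Loose K" "Cod K f = Dom K g" "\<phi> \<in> Cell K"
    and "Cod K (Src K \<phi>) = Dom K f"
  shows "Id2 K g \<star> (Id2 K f \<star> \<phi>) = Id2 K (g \<odot> f) \<star> \<phi>"
  using Hcomp_assoc_simp[of \<phi> "Id2 K f" "Id2 K g"] assms by simp

lemma interchange_simp:
  "\<lbrakk>\<phi> \<in> Cell K; \<phi>' \<in> Cell K; \<psi> \<in> Cell K; \<psi>' \<in> Cell K; Tgt K \<phi> = Src K \<phi>';
    Tgt K \<psi> = Src K \<psi>'; Cod K (Src K \<phi>) = Dom K (Src K \<psi>)\<rbrakk>
    \<Longrightarrow> (\<psi>' \<cdot> \<psi>) \<star> (\<phi>' \<cdot> \<phi>) = (\<psi>' \<star> \<phi>') \<cdot> (\<psi> \<star> \<phi>)"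
  using interchange by (simp add: in_cells)

lemma whisker_left_Vcomp [simp]:
  assumes "f \<in> Loose K" "\<phi> \<in> Cell K" "\<psi> \<in> Cell K" "Tgt K \<phi> = Src K \<psi>"
    and "Cod K (Src K \<phi>) = Dom K f"
  shows "f \<lhd> (\<psi> \<cdot> \<phi>) = (f \<lhd> \<psi>) \<cdot> (f \<lhd> \<phi>)"
  using interchange_simp[of \<phi> \<psi> "Id2 K f" "Id2 K f"] assms by simp

lemma whisker_right_Vcomp [simp]:
  assumes "f \<in> Loose K" "\<phi> \<in> Cell K" "\<psi> \<in> Cell K" "Tgt K \<phi> = Src K \<psi>"
    and "Cod K f = Dom K (Src K \<phi>)"
  shows "(\<psi> \<cdot> \<phi>) \<rhd> f = (\<psi> \<rhd> f) \<cdot> (\<phi> \<rhd> f)"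
  using interchange_simp[of "Id2 K f" "Id2 K f" \<phi> \<psi>] assms by simp

text \<open>Both sides are the horizontal composite of \<open>\<psi>\<close> and \<open>\<phi>\<close>.\<close>

lemma whisker_exchange:
  assumes "\<phi> \<in> cells K f f'" "\<psi> \<in> cells K g g'" "Cod K f = Dom K g"
  shows "(\<psi> \<rhd> f') \<cdot> (g \<lhd> \<phi>) = (g' \<lhd> \<phi>) \<cdot> (\<psi> \<rhd> f)"
  using assms interchange_simp[of \<phi> "Id2 K f'" "Id2 K g" \<psi>]
    interchange_simp[of "Id2 K f" \<phi> \<psi> "Id2 K g'"]
  by (auto simp add: in_cells)

subsection \<open>Invertible 2-cells\<close>

lemma invertible_cellI:
  assumes "\<phi> \<in> cells K f g" "\<psi> \<in> cells K g f" "\<psi> \<cdot> \<phi> = Id2 K f" "\<phi> \<cdot> \<psi> = Id2 K g"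
  shows "invertible_cell K \<phi>"
  using assms by (auto simp: invertible_cell_def in_cells)

lemma invertible_cellE:
  assumes "invertible_cell K \<phi>" "\<phi> \<in> cells K f g"
  obtains \<psi> where "\<psi> \<in> cells K g f" "\<psi> \<cdot> \<phi> = Id2 K f" "\<phi> \<cdot> \<psi> = Id2 K g"
  using assms by (auto simp: invertible_cell_def in_cells)

lemma invertible_Id2: "f \<in> Loose K \<Longrightarrow> invertible_cell K (Id2 K f)"
  by (rule invertible_cellI[of _ f f "Id2 K f"]) (simp_all add: in_cells)

lemma invertible_Vcomp:
  assumes "invertible_cell K \<phi>" "invertible_cell K \<psi>" "Tgt K \<phi> = Src K \<psi>"
  shows "invertible_cell K (\<psi> \<cdot> \<phi>)"
proof -
  have c: "\<phi> \<in> Cell K" "\<psi> \<in> Cell K" using assms by (auto simp: invertible_cell_def)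
  obtain \<phi>' where 1: "\<phi>' \<in> cells K (Tgt K \<phi>) (Src K \<phi>)" "\<phi>' \<cdot> \<phi> = Id2 K (Src K \<phi>)"
    "\<phi> \<cdot> \<phi>' = Id2 K (Tgt K \<phi>)" using assms by (auto simp: invertible_cell_def)
  obtain \<psi>' where 2: "\<psi>' \<in> cells K (Tgt K \<psi>) (Src K \<psi>)" "\<psi>' \<cdot> \<psi> = Id2 K (Src K \<psi>)"
    "\<psi> \<cdot> \<psi>' = Id2 K (Tgt K \<psi>)" using assms by (auto simp: invertible_cell_def)
  have t: "\<phi>' \<in> Cell K" "Src K \<phi>' = Src K \<psi>" "Tgt K \<phi>' = Src K \<phi>"
    "\<psi>' \<in> Cell K" "Src K \<psi>' = Tgt K \<psi>" "Tgt K \<psi>' = Src K \<psi>"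
    using 1 2 assms(3) by (auto simp: in_cells)
  have "(\<phi>' \<cdot> \<psi>') \<cdot> (\<psi> \<cdot> \<phi>) = \<phi>' \<cdot> ((\<psi>' \<cdot> \<psi>) \<cdot> \<phi>)"
    using c t assms(3) by simp
  also have "\<dots> = Id2 K (Src K \<phi>)" using 1 2 c t assms(3) by simp
  finally have a: "(\<phi>' \<cdot> \<psi>') \<cdot> (\<psi> \<cdot> \<phi>) = Id2 K (Src K \<phi>)" .
  have "(\<psi> \<cdot> \<phi>) \<cdot> (\<phi>' \<cdot> \<psi>') = \<psi> \<cdot> ((\<phi> \<cdot> \<phi>') \<cdot> \<psi>')"
    using c t assms(3) by simp
  also have "\<dots> = Id2 K (Tgt K \<psi>)" using 1 2 c t assms(3) by simp
  finally show ?thesis using a c t assms(3)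
    by (intro invertible_cellI[of _ "Src K \<phi>" "Tgt K \<psi>" "\<phi>' \<cdot> \<psi>'"]) (simp_all add: in_cells)
qed

lemma invertible_inverse:
  assumes "invertible_cell K \<phi>"
  obtains \<psi> where "\<psi> \<in> cells K (Tgt K \<phi>) (Src K \<phi>)" "\<psi> \<cdot> \<phi> = Id2 K (Src K \<phi>)"
    "\<phi> \<cdot> \<psi> = Id2 K (Tgt K \<phi>)" "invertible_cell K \<psi>"
proof -
  have c: "\<phi> \<in> cells K (Src K \<phi>) (Tgt K \<phi>)" using assms by (simp add: invertible_cell_def in_cells)
  show thesis using invertible_cellE[OF assms c] invertible_cellI[OF _ c] that by metis
qed

lemma invertible_cancel_right:
  assumes "invertible_cell K (\<psi> \<cdot> \<phi>)" "invertible_cell K \<phi>" "\<psi> \<in> Cell K" "Tgt K \<phi> = Src K \<psi>"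
  shows "invertible_cell K \<psi>"
proof -
  have c: "\<phi> \<in> Cell K" using assms by (auto simp: invertible_cell_def)
  obtain \<phi>' where 1: "\<phi>' \<in> cells K (Tgt K \<phi>) (Src K \<phi>)"
    "\<phi>' \<cdot> \<phi> = Id2 K (Src K \<phi>)" "\<phi> \<cdot> \<phi>' = Id2 K (Tgt K \<phi>)"
    "invertible_cell K \<phi>'" using invertible_inverse[OF assms(2)] .
  have t: "\<phi>' \<in> Cell K" "Src K \<phi>' = Src K \<psi>" "Tgt K \<phi>' = Src K \<phi>"
    using 1 assms(4) by (auto simp: in_cells)
  have "(\<psi> \<cdot> \<phi>) \<cdot> \<phi>' = \<psi>" using c t 1 assms by simp
  moreover have "invertible_cell K ((\<psi> \<cdot> \<phi>) \<cdot> \<phi>')"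
    by (rule invertible_Vcomp) (use c t assms 1 in simp_all)
  ultimately show ?thesis by metis
qed

lemma invertible_cancel_left:
  assumes "invertible_cell K (\<psi> \<cdot> \<phi>)" "invertible_cell K \<psi>" "\<phi> \<in> Cell K" "Tgt K \<phi> = Src K \<psi>"
  shows "invertible_cell K \<phi>"
proof -
  have c: "\<psi> \<in> Cell K" using assms by (auto simp: invertible_cell_def)
  obtain \<psi>' where 1: "\<psi>' \<in> cells K (Tgt K \<psi>) (Src K \<psi>)" "\<psi>' \<cdot> \<psi> = Id2 K (Src K \<psi>)"
    "\<psi> \<cdot> \<psi>' = Id2 K (Tgt K \<psi>)" "invertible_cell K \<psi>'" using invertible_inverse[OF assms(2)] .
  have t: "\<psi>' \<in> Cell K" "Src K \<psi>' = Tgt K \<psi>" "Tgt K \<psi>' = Src K \<psi>"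
    using 1 by (auto simp: in_cells)
  have "\<psi>' \<cdot> (\<psi> \<cdot> \<phi>) = (\<psi>' \<cdot> \<psi>) \<cdot> \<phi>" using c t assms by simp
  then have "\<psi>' \<cdot> (\<psi> \<cdot> \<phi>) = \<phi>" using c t 1 assms by simp
  moreover have "invertible_cell K (\<psi>' \<cdot> (\<psi> \<cdot> \<phi>))"
    by (rule invertible_Vcomp) (use c t assms 1 in simp_all)
  ultimately show ?thesis by metis
qed

lemma invertible_whisker_left:
  assumes "invertible_cell K \<phi>" "f \<in> Loose K" "Cod K (Src K \<phi>) = Dom K f"
  shows "invertible_cell K (f \<lhd> \<phi>)"
proof -
  have c: "\<phi> \<in> Cell K" using assms by (auto simp: invertible_cell_def)
  obtain \<psi> where 1: "\<psi> \<in> cells K (Tgt K \<phi>) (Src K \<phi>)" "\<psi> \<cdot> \<phi> = Id2 K (Src K \<phi>)"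
    "\<phi> \<cdot> \<psi> = Id2 K (Tgt K \<phi>)" "invertible_cell K \<psi>" using invertible_inverse[OF assms(1)] .
  show ?thesis
    using c 1 assms whisker_left_Vcomp[of f \<phi> \<psi>] whisker_left_Vcomp[of f \<psi> \<phi>]
    by (intro invertible_cellI[of _ "f \<odot> Src K \<phi>" "f \<odot> Tgt K \<phi>" "f \<lhd> \<psi>"]) (simp_all add: in_cells)
qed

lemma invertible_whisker_right:
  assumes "invertible_cell K \<phi>" "f \<in> Loose K" "Cod K f = Dom K (Src K \<phi>)"
  shows "invertible_cell K (\<phi> \<rhd> f)"
proof -
  have c: "\<phi> \<in> Cell K" using assms by (auto simp: invertible_cell_def)
  obtain \<psi> where 1: "\<psi> \<in> cells K (Tgt K \<phi>) (Src K \<phi>)" "\<psi> \<cdot> \<phi> = Id2 K (Src K \<phi>)"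
    "\<phi> \<cdot> \<psi> = Id2 K (Tgt K \<phi>)" "invertible_cell K \<psi>" using invertible_inverse[OF assms(1)] .
  show ?thesis
    using c 1 assms whisker_right_Vcomp[of f \<phi> \<psi>] whisker_right_Vcomp[of f \<psi> \<phi>]
    by (intro invertible_cellI[of _ "Src K \<phi> \<odot> f" "Tgt K \<phi> \<odot> f" "\<psi> \<rhd> f"]) (simp_all add: in_cells)
qed

end

subsection \<open>1-cells that are initial in their hom-category\<close>

definition initial_1cell :: "('o, 'm, 'c, 'z) enhanced_2cat_scheme \<Rightarrow> 'm \<Rightarrow> bool" where
  "initial_1cell K s \<longleftrightarrow> s \<in> Loose K \<and>
     (\<forall>t \<in> hom K (Dom K s) (Cod K s). \<exists>!\<phi>. \<phi> \<in> cells K s t)"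

definition initial_cell :: "('o, 'm, 'c, 'z) enhanced_2cat_scheme \<Rightarrow> 'm \<Rightarrow> 'm \<Rightarrow> 'c" where
  "initial_cell K s t = (THE \<phi>. \<phi> \<in> cells K s t)"

context two_category
begin

lemma initial_1cell_unique:
  assumes "initial_1cell K s" "\<phi> \<in> cells K s t" "\<psi> \<in> cells K s t"
  shows "\<phi> = \<psi>"
proof -
  have "\<phi> \<in> Cell K" "Src K \<phi> = s" "Tgt K \<phi> = t" using assms by (auto simp: in_cells)
  then have "t \<in> hom K (Dom K s) (Cod K s)" by (auto simp: in_hom)
  then show ?thesis using assms by (auto simp: initial_1cell_def)
qed

lemma initial_cell_in:
  assumes "initial_1cell K s" "t \<in> hom K (Dom K s) (Cod K s)"
  shows "initial_cell K s t \<in> cells K s t"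
  unfolding initial_cell_def by (rule theI') (use assms in \<open>simp add: initial_1cell_def\<close>)

lemma initial_cell_eq:
  "\<lbrakk>initial_1cell K s; \<phi> \<in> cells K s t\<rbrakk> \<Longrightarrow> initial_cell K s t = \<phi>"
  unfolding initial_cell_def by (rule the_equality) (auto dest: initial_1cell_unique)

lemma initial_1cells_invertible:
  assumes "initial_1cell K s" "initial_1cell K t" "\<phi> \<in> cells K s t"
  shows "invertible_cell K \<phi>"
proof -
  have c: "\<phi> \<in> Cell K" "Src K \<phi> = s" "Tgt K \<phi> = t" using assms by (auto simp: in_cells)
  have "s \<in> hom K (Dom K t) (Cod K t)"
    using c Dom_Tgt[of \<phi>] Cod_Tgt[of \<phi>] Src_Loose[of \<phi>] by (simp add: in_hom)
  then have d: "initial_cell K t s \<in> cells K t s" using assms by (intro initial_cell_in)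
  have "initial_cell K t s \<cdot> \<phi> = Id2 K s"
    using c d assms Src_Loose[of \<phi>]
    by (intro initial_1cell_unique[OF assms(1)]) (auto simp: in_cells)
  moreover have "\<phi> \<cdot> initial_cell K t s = Id2 K t"
    using c d assms Tgt_Loose[of \<phi>]
    by (intro initial_1cell_unique[OF assms(2)]) (auto simp: in_cells)
  ultimately show ?thesis using assms d by (intro invertible_cellI)
qed

lemma initial_1cell_iso:
  assumes s: "initial_1cell K s" and i: "invertible_cell K \<phi>" and p: "\<phi> \<in> cells K s t"
  shows "initial_1cell K t"
proof -
  have c: "\<phi> \<in> Cell K" "Src K \<phi> = s" "Tgt K \<phi> = t" using p by (auto simp: in_cells)
  then have t: "t \<in> Loose K" "Dom K t = Dom K s" "Cod K t = Cod K s"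
    using Tgt_Loose[of \<phi>] Dom_Tgt[of \<phi>] Cod_Tgt[of \<phi>] by auto
  obtain \<psi> where e: "\<psi> \<in> cells K t s" "\<psi> \<cdot> \<phi> = Id2 K s" "\<phi> \<cdot> \<psi> = Id2 K t"
    using invertible_cellE[OF i p] .
  have q: "\<psi> \<in> Cell K" "Src K \<psi> = t" "Tgt K \<psi> = s" using e by (auto simp: in_cells)
  have "\<exists>!\<theta>. \<theta> \<in> cells K t r" if r: "r \<in> hom K (Dom K t) (Cod K t)" for r
  proof
    have a: "initial_cell K s r \<in> cells K s r" using r t s by (intro initial_cell_in) auto
    show "initial_cell K s r \<cdot> \<psi> \<in> cells K t r" using a q by (auto simp: in_cells)
    fix \<theta> assume "\<theta> \<in> cells K t r"
    then have th: "\<theta> \<in> Cell K" "Src K \<theta> = t" "Tgt K \<theta> = r" by (auto simp: in_cells)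
    then have "\<theta> \<cdot> \<phi> = initial_cell K s r"
      using c a by (intro initial_1cell_unique[OF s _ a]) (auto simp: in_cells)
    then have "initial_cell K s r \<cdot> \<psi> = \<theta> \<cdot> (\<phi> \<cdot> \<psi>)"
      using th c q by (metis Vcomp_assoc_simp)
    then show "\<theta> = initial_cell K s r \<cdot> \<psi>" using th e by simp
  qed
  then show ?thesis using t by (simp add: initial_1cell_def)
qed

lemma initial_1cell_precomp_iso:
  assumes s: "initial_1cell K s" and k: "k \<in> hom K A (Dom K s)" and k': "k' \<in> hom K (Dom K s) A"
    and kk': "k \<odot> k' = Id1 K (Dom K s)" and k'k: "k' \<odot> k = Id1 K A"
  shows "initial_1cell K (s \<odot> k)"
proof -
  have t: "s \<in> Loose K" "k \<in> Loose K" "Dom K k = A" "Cod K k = Dom K s"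
    "k' \<in> Loose K" "Dom K k' = Dom K s" "Cod K k' = A" "A \<in> Obj K"
    using assms by (auto simp: in_hom initial_1cell_def)
  have "\<exists>!\<theta>. \<theta> \<in> cells K (s \<odot> k) r" if r: "r \<in> hom K A (Cod K s)" for r
  proof
    have r': "r \<in> Loose K" "Dom K r = A" "Cod K r = Cod K s" using r by (auto simp: in_hom)
    have "initial_cell K s (r \<odot> k') \<in> cells K s (r \<odot> k')"
      using r' t s by (intro initial_cell_in) (auto simp: in_hom)
    then have a: "initial_cell K s (r \<odot> k') \<in> Cell K" "Src K (initial_cell K s (r \<odot> k')) = s"
      "Tgt K (initial_cell K s (r \<odot> k')) = r \<odot> k'" by (auto simp: in_cells)
    show "initial_cell K s (r \<odot> k') \<rhd> k \<in> cells K (s \<odot> k) r"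
      using a t r' k'k by (simp add: in_cells)
    fix \<theta> assume "\<theta> \<in> cells K (s \<odot> k) r"
    then have th: "\<theta> \<in> Cell K" "Src K \<theta> = s \<odot> k" "Tgt K \<theta> = r" by (auto simp: in_cells)
    then have "\<theta> \<rhd> k' = initial_cell K s (r \<odot> k')"
      using t a kk' by (intro initial_1cell_unique[OF s]) (auto simp: in_cells)
    then have "initial_cell K s (r \<odot> k') \<rhd> k = \<theta> \<star> (Id2 K k' \<star> Id2 K k)"
      using th t by (metis Hcomp_assoc_simp Id2_simps Comp_simps)
    then show "\<theta> = initial_cell K s (r \<odot> k') \<rhd> k" using th t k'k by simp
  qed
  then show ?thesis using t by (simp add: initial_1cell_def)
qed

end

section \<open>Lax algebra structures from initiality\<close>

context enhanced_2_category
begin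

lemma Tight_is_Loose [simp]: "f \<in> Tight K \<Longrightarrow> f \<in> Loose K"
  using Tight_Loose by blast

end

context enhanced_2_monad
begin

declare TO_Obj [simp] TM_Id1 [simp] TC_Id2 [simp] eta_Tight [simp] mu_Tight [simp] TM_Tight [simp]
  mu_eta [simp] mu_T_eta [simp]

lemma TM_simps [simp]:
  assumes "f \<in> Loose K"
  shows "TM T f \<in> Loose K" "Dom K (TM T f) = TO T (Dom K f)" "Cod K (TM T f) = TO T (Cod K f)"
  using TM_hom[of f "Dom K f" "Cod K f"] assms by (simp_all add: in_hom)

lemma TC_simps [simp]:
  assumes "\<phi> \<in> Cell K"
  shows "TC T \<phi> \<in> Cell K" "Src K (TC T \<phi>) = TM T (Src K \<phi>)" "Tgt K (TC T \<phi>) = TM T (Tgt K \<phi>)"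
  using TC_cells[of \<phi> "Src K \<phi>" "Tgt K \<phi>"] assms by (simp_all add: in_cells)

lemma eta_simps [simp]:
  assumes "A \<in> Obj K"
  shows "Dom K (eta T A) = A" "Cod K (eta T A) = TO T A"
  using eta_hom[OF assms] by (simp_all add: in_hom)

lemma mu_simps [simp]:
  assumes "A \<in> Obj K"
  shows "Dom K (mu T A) = TO T (TO T A)" "Cod K (mu T A) = TO T A"
  using mu_hom[OF assms] by (simp_all add: in_hom)

lemma TM_Comp_simp [simp]:
  "\<lbrakk>f \<in> Loose K; g \<in> Loose K; Cod K f = Dom K g\<rbrakk> \<Longrightarrow> TM T (g \<odot> f) = TM T g \<odot> TM T f"
  using TM_Comp by (simp add: in_hom)

lemma TC_Vcomp_simp [simp]:
  "\<lbrakk>\<phi> \<in> Cell K; \<psi> \<in> Cell K; Tgt K \<phi> = Src K \<psi>\<rbrakk> \<Longrightarrow> TC T (\<psi> \<cdot> \<phi>) = TC T \<psi> \<cdot> TC T \<phi>"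
  using TC_Vcomp by (simp add: in_cells)

lemma TC_Hcomp_simp [simp]:
  "\<lbrakk>\<phi> \<in> Cell K; \<psi> \<in> Cell K; Cod K (Src K \<phi>) = Dom K (Src K \<psi>)\<rbrakk>
    \<Longrightarrow> TC T (\<psi> \<star> \<phi>) = TC T \<psi> \<star> TC T \<phi>"
  using TC_Hcomp by (simp add: in_cells)

lemma eta_natural_simp [simp]:
  "\<lbrakk>f \<in> Loose K; Dom K f = A\<rbrakk> \<Longrightarrow> TM T f \<odot> eta T A = eta T (Cod K f) \<odot> f"
  using eta_natural by (auto simp add: in_hom)

lemma mu_natural_simp [simp]:
  "\<lbrakk>f \<in> Loose K; Dom K f = A\<rbrakk> \<Longrightarrow> TM T f \<odot> mu T A = mu T (Cod K f) \<odot> TM T (TM T f)"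
  using mu_natural by (auto simp add: in_hom)

lemma mu_assoc_simp [simp]:
  "A \<in> Obj K \<Longrightarrow> mu T A \<odot> TM T (mu T A) = mu T A \<odot> mu T (TO T A)"
  using mu_assoc by simp

lemma mu_natural_extend [simp]:
  "\<lbrakk>f \<in> Loose K; Dom K f = A; y \<in> Loose K; Cod K y = TO T (TO T A)\<rbrakk>
    \<Longrightarrow> TM T f \<odot> (mu T A \<odot> y) = mu T (Cod K f) \<odot> (TM T (TM T f) \<odot> y)"
  by (auto simp: Comp_extend[OF mu_natural_simp])

lemma mu_extend [simp]:
  "\<lbrakk>A \<in> Obj K; x \<in> Loose K; Cod K x = TO T A\<rbrakk> \<Longrightarrow> mu T A \<odot> (TM T (eta T A) \<odot> x) = x"
  "\<lbrakk>A \<in> Obj K; y \<in> Loose K; Cod K y = TO T (TO T (TO T A))\<rbrakk>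
    \<Longrightarrow> mu T A \<odot> (TM T (mu T A) \<odot> y) = mu T A \<odot> (mu T (TO T A) \<odot> y)"
  by (simp_all add: Comp_extend[OF mu_T_eta] Comp_extend[OF mu_assoc_simp])

end

text \<open>In the application \<open>C\<close> is the class of pullback squares into the classifier. Starting from the
  identity, its closure under \<open>s \<mapsto> w (T s)\<close> provides the 1-cells \<open>w\<close>, \<open>w (T w)\<close> and \<open>w (T w) (T\<^sup>2 w)\<close>
  from which the structure cells and the sides of the axioms start.\<close>

locale initial_lifting = enhanced_2_monad K T
  for K :: "('o, 'm, 'c, 'z) enhanced_2cat_scheme" (structure)
    and T :: "('o, 'm, 'c) two_monad" +
  fixes u :: 'o and w :: 'm and C :: "'m set"
  assumes u_Obj: "u \<in> Obj K"
    and w_Tight: "w \<in> Tight K" and w_hom: "w \<in> hom K (TO T u) u"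
    and C_initial: "s \<in> C \<Longrightarrow> initial_1cell K s"
    and C_Cod: "s \<in> C \<Longrightarrow> Cod K s = u"
    and C_Id1: "Id1 K u \<in> C"
    and C_step: "s \<in> C \<Longrightarrow> w \<odot> TM T s \<in> C"
begin

definition base_alg :: "('o, 'm, 'c) lax_alg" where
  "base_alg = LaxAlg u w (initial_cell K (Id1 K u) (w \<odot> eta T u))
     (initial_cell K (w \<odot> TM T w) (w \<odot> mu T u))"

definition initial_mor :: "('o, 'm, 'c) lax_alg \<Rightarrow> 'm \<Rightarrow> ('o, 'm, 'c) lax_mor" where
  "initial_mor X s = LaxMor X base_alg s (initial_cell K (w \<odot> TM T s) (s \<odot> act X))"

lemma w_simps [simp]: "w \<in> Loose K" "Dom K w = TO T u" "Cod K w = u" "u \<in> Obj K"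
  using w_hom u_Obj by (simp_all add: in_hom)

lemma C_simps [simp]:
  "s \<in> C \<Longrightarrow> s \<in> Loose K" "s \<in> C \<Longrightarrow> Cod K s = u"
  using C_initial C_Cod by (auto simp: initial_1cell_def)

lemma w_in_C: "w \<in> C"
  using C_step[OF C_Id1] by simp

lemma base_unitor: "unitor base_alg \<in> cells K (Id1 K u) (w \<odot> eta T u)"
  unfolding base_alg_def using initial_cell_in[OF C_initial[OF C_Id1], of "w \<odot> eta T u"]
  by (simp add: in_hom)

lemma base_multor: "multor base_alg \<in> cells K (w \<odot> TM T w) (w \<odot> mu T u)"
  unfolding base_alg_def
  using initial_cell_in[OF C_initial[OF C_step[OF w_in_C]], of "w \<odot> mu T u"]
  by (simp add: in_hom)

text \<open>Each axiom equates two 2-cells with source \<open>w\<close>, \<open>w\<close> and \<open>w (T w) (T\<^sup>2 w)\<close> respectively, and these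
  1-cells lie in \<open>C\<close>.\<close>

lemma lax_algebra_base_alg: "lax_algebra K T base_alg"
proof -
  define \<upsilon> \<mu> where "\<upsilon> = unitor base_alg" and "\<mu> = multor base_alg"
  have b: "base_alg = LaxAlg u w \<upsilon> \<mu>" by (simp add: \<upsilon>_def \<mu>_def base_alg_def)
  have v: "\<upsilon> \<in> Cell K" "Src K \<upsilon> = Id1 K u" "Tgt K \<upsilon> = w \<odot> eta T u"
    using base_unitor by (auto simp: in_cells \<upsilon>_def)
  have m: "\<mu> \<in> Cell K" "Src K \<mu> = w \<odot> TM T w" "Tgt K \<mu> = w \<odot> mu T u"
    using base_multor by (auto simp: in_cells \<mu>_def)
  have ww: "w \<odot> TM T (w \<odot> TM T w) \<in> C" by (intro C_step w_in_C)
  have "(\<mu> \<rhd> eta T (TO T u)) \<cdot> (\<upsilon> \<rhd> w) = Id2 K w"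
    by (rule initial_1cell_unique[OF C_initial[OF w_in_C]]) (simp_all add: in_cells v m)
  moreover have "(\<mu> \<rhd> TM T (eta T u)) \<cdot> (w \<lhd> TC T \<upsilon>) = Id2 K w"
    by (rule initial_1cell_unique[OF C_initial[OF w_in_C]]) (simp_all add: in_cells v m)
  moreover have "(\<mu> \<rhd> mu T (TO T u)) \<cdot> (\<mu> \<rhd> TM T (TM T w)) =
      (\<mu> \<rhd> TM T (mu T u)) \<cdot> (w \<lhd> TC T \<mu>)"
    by (rule initial_1cell_unique[OF C_initial[OF ww]]) (simp_all add: in_cells v m)
  ultimately show ?thesis
    unfolding lax_algebra_def b using w_Tight v m by (simp add: in_hom in_cells)
qed

lemma initial_mor_bar:
  assumes X: "lax_algebra K T X" and s: "s \<in> C" "Dom K s = carr X"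
  shows "bar (initial_mor X s) \<in> cells K (w \<odot> TM T s) (s \<odot> act X)"
  unfolding initial_mor_def
  using initial_cell_in[OF C_initial[OF C_step[OF s(1)]], of "s \<odot> act X"] X s
  by (simp add: in_hom lax_algebra_def Let_def)

text \<open>The unit axiom is an equation of 2-cells out of \<open>s\<close>, the multiplication axiom one of 2-cells out
  of \<open>w (T w) (T\<^sup>2 s)\<close>.\<close>

lemma lax_morphism_initial_mor:
  assumes X: "lax_algebra K T X" and s: "s \<in> C" "Dom K s = carr X"
  shows "lax_morphism K T (initial_mor X s)"
proof -
  obtain A a \<upsilon> \<mu> where X': "X = LaxAlg A a \<upsilon> \<mu>" by (cases X)
  have x: "A \<in> Obj K" "a \<in> Loose K" "Dom K a = TO T A" "Cod K a = A"
    "\<upsilon> \<in> Cell K" "Src K \<upsilon> = Id1 K A" "Tgt K \<upsilon> = a \<odot> eta T A"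
    "\<mu> \<in> Cell K" "Src K \<mu> = a \<odot> TM T a" "Tgt K \<mu> = a \<odot> mu T A"
    using X by (auto simp: X' lax_algebra_def Let_def in_hom in_cells)
  define \<gamma> where "\<gamma> = bar (initial_mor X s)"
  have s': "Dom K s = A" using s X' by simp
  have f: "initial_mor X s = LaxMor X base_alg s \<gamma>" by (simp add: \<gamma>_def initial_mor_def)
  have g: "\<gamma> \<in> Cell K" "Src K \<gamma> = w \<odot> TM T s" "Tgt K \<gamma> = s \<odot> a"
    using initial_mor_bar[OF assms] by (auto simp: in_cells \<gamma>_def X')
  have v: "unitor base_alg \<in> Cell K" "Src K (unitor base_alg) = Id1 K u"
    "Tgt K (unitor base_alg) = w \<odot> eta T u"
    using base_unitor by (auto simp: in_cells)
  have m: "multor base_alg \<in> Cell K" "Src K (multor base_alg) = w \<odot> TM T w"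
    "Tgt K (multor base_alg) = w \<odot> mu T u"
    using base_multor by (auto simp: in_cells)
  have c: "carr base_alg = u" "act base_alg = w" by (simp_all add: base_alg_def)
  have ss: "w \<odot> TM T (w \<odot> TM T s) \<in> C" by (intro C_step s)
  have "s \<lhd> \<upsilon> = (\<gamma> \<rhd> eta T A) \<cdot> (unitor base_alg \<rhd> s)"
    by (rule initial_1cell_unique[OF C_initial[OF s(1)]]) (simp_all add: in_cells v x g s(1) s')
  moreover have "(s \<lhd> \<mu>) \<cdot> (\<gamma> \<rhd> TM T a) \<cdot> (w \<lhd> TC T \<gamma>) =
      (\<gamma> \<rhd> mu T A) \<cdot> (multor base_alg \<rhd> TM T (TM T s))"
    by (rule initial_1cell_unique[OF C_initial[OF ss]]) (simp_all add: in_cells m x g s(1) s')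
  ultimately show ?thesis
    unfolding lax_morphism_def f using X lax_algebra_base_alg
    by (simp add: in_hom in_cells c X' x g s(1) s')
qed

text \<open>So \<open>initial_mor X s\<close> is initial also among the lax morphisms from \<open>X\<close>: the defining equation of a
  2-morphism is one between 2-cells out of the initial 1-cell \<open>w (T s)\<close>.\<close>

lemma T_2_morphism_initial:
  assumes F: "lax_morphism K T F" "lm_cod F = base_alg"
    and s: "s \<in> C" "Dom K s = carr (lm_dom F)" and \<theta>: "\<theta> \<in> cells K s (und F)"
  shows "T_2_morphism K T (LaxCell (initial_mor (lm_dom F) s) F \<theta>)"
proof -
  obtain A a \<upsilon> \<mu> where X': "lm_dom F = LaxAlg A a \<upsilon> \<mu>" by (cases "lm_dom F")
  have X: "lax_algebra K T (lm_dom F)" using F by (auto simp: lax_morphism_def Let_def)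
  then have x: "A \<in> Obj K" "a \<in> Loose K" "Dom K a = TO T A" "Cod K a = A"
    by (auto simp: X' lax_algebra_def Let_def in_hom in_cells)
  have c: "carr base_alg = u" "act base_alg = w" by (simp_all add: base_alg_def)
  have f: "und F \<in> Loose K" "Dom K (und F) = A" "Cod K (und F) = u"
    "bar F \<in> Cell K" "Src K (bar F) = w \<odot> TM T (und F)" "Tgt K (bar F) = und F \<odot> a"
    using F by (auto simp: lax_morphism_def Let_def in_hom in_cells c X')
  have s': "Dom K s = A" using s X' by simp
  have g: "bar (initial_mor (lm_dom F) s) \<in> Cell K"
    "Src K (bar (initial_mor (lm_dom F) s)) = w \<odot> TM T s"
    "Tgt K (bar (initial_mor (lm_dom F) s)) = s \<odot> a"
    using initial_mor_bar[OF X s] by (auto simp: in_cells X')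
  have t: "\<theta> \<in> Cell K" "Src K \<theta> = s" "Tgt K \<theta> = und F" using \<theta> by (auto simp: in_cells)
  have "(\<theta> \<rhd> a) \<cdot> bar (initial_mor (lm_dom F) s) = bar F \<cdot> (w \<lhd> TC T \<theta>)"
    by (rule initial_1cell_unique[OF C_initial[OF C_step[OF s(1)]]])
      (simp_all add: in_cells x f g t s(1) s')
  then show ?thesis
    using F lax_morphism_initial_mor[OF X s] \<theta>
    by (simp add: T_2_morphism_def initial_mor_def Let_def X' c)
qed

end

section \<open>The arrow 2-category\<close>

datatype 'm square = Square (sq_dom: 'm) (sq_cod: 'm) (sq_top: 'm) (sq_bot: 'm)

datatype ('m, 'c) square_cell =
  SquareCell (sc_src: "'m square") (sc_tgt: "'m square") (sc_top: 'c) (sc_bot: 'c)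

definition is_square :: "('o, 'm, 'c, 'z) enhanced_2cat_scheme \<Rightarrow> 'm square \<Rightarrow> bool" where
  "is_square K s \<longleftrightarrow> sq_dom s \<in> Loose K \<and> sq_cod s \<in> Loose K \<and>
     sq_top s \<in> hom K (Dom K (sq_dom s)) (Dom K (sq_cod s)) \<and>
     sq_bot s \<in> hom K (Cod K (sq_dom s)) (Cod K (sq_cod s)) \<and>
     sq_cod s \<odot>\<^bsub>K\<^esub> sq_top s = sq_bot s \<odot>\<^bsub>K\<^esub> sq_dom s"

definition is_square_cell ::
  "('o, 'm, 'c, 'z) enhanced_2cat_scheme \<Rightarrow> ('m, 'c) square_cell \<Rightarrow> bool" where
  "is_square_cell K \<gamma> \<longleftrightarrow> is_square K (sc_src \<gamma>) \<and> is_square K (sc_tgt \<gamma>) \<and>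
     sq_dom (sc_tgt \<gamma>) = sq_dom (sc_src \<gamma>) \<and> sq_cod (sc_tgt \<gamma>) = sq_cod (sc_src \<gamma>) \<and>
     compatible_pair K (sq_cod (sc_src \<gamma>)) (sq_dom (sc_src \<gamma>))
       (sq_top (sc_src \<gamma>)) (sq_top (sc_tgt \<gamma>)) (sq_bot (sc_src \<gamma>)) (sq_bot (sc_tgt \<gamma>))
       (sc_top \<gamma>, sc_bot \<gamma>)"

definition sq_comp ::
  "('o, 'm, 'c, 'z) enhanced_2cat_scheme \<Rightarrow> 'm square \<Rightarrow> 'm square \<Rightarrow> 'm square" where
  "sq_comp K t s = Square (sq_dom s) (sq_cod t)
     (sq_top t \<odot>\<^bsub>K\<^esub> sq_top s) (sq_bot t \<odot>\<^bsub>K\<^esub> sq_bot s)"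

text \<open>The 2-category of functors from the arrow category to \<open>K\<close>, strict 2-natural transformations
  and modifications. Working in it turns every statement about a pair of 2-cells
  compatible with \<open>u\<close> into a statement about one 2-cell.\<close>

definition arrow_2cat ::
  "('o, 'm, 'c, 'z) enhanced_2cat_scheme \<Rightarrow> ('m, 'm square, ('m, 'c) square_cell) enhanced_2cat"
where
  "arrow_2cat K = \<lparr>
     Obj = Loose K,
     Loose = {s. is_square K s},
     Tight = {s. is_square K s \<and> sq_top s \<in> Tight K \<and> sq_bot s \<in> Tight K},
     Cell = {\<gamma>. is_square_cell K \<gamma>},
     Dom = sq_dom,
     Cod = sq_cod,
     Src = sc_src,
     Tgt = sc_tgt,
     Id1 = (\<lambda>p. Square p p (Id1 K (Dom K p)) (Id1 K (Cod K p))),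
     Id2 = (\<lambda>s. SquareCell s s (Id2 K (sq_top s)) (Id2 K (sq_bot s))),
     Comp = sq_comp K,
     Vcomp = (\<lambda>\<delta> \<gamma>. SquareCell (sc_src \<gamma>) (sc_tgt \<delta>)
       (sc_top \<delta> \<cdot>\<^bsub>K\<^esub> sc_top \<gamma>) (sc_bot \<delta> \<cdot>\<^bsub>K\<^esub> sc_bot \<gamma>)),
     Hcomp = (\<lambda>\<delta> \<gamma>. SquareCell (sq_comp K (sc_src \<delta>) (sc_src \<gamma>))
       (sq_comp K (sc_tgt \<delta>) (sc_tgt \<gamma>))
       (sc_top \<delta> \<star>\<^bsub>K\<^esub> sc_top \<gamma>) (sc_bot \<delta> \<star>\<^bsub>K\<^esub> sc_bot \<gamma>)) \<rparr>"

definition arrow_monad ::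
  "('o, 'm, 'c, 'z) enhanced_2cat_scheme \<Rightarrow> ('o, 'm, 'c) two_monad \<Rightarrow>
   ('m, 'm square, ('m, 'c) square_cell) two_monad"
where
  "arrow_monad K T = (let
       ts = (\<lambda>s. Square (TM T (sq_dom s)) (TM T (sq_cod s)) (TM T (sq_top s)) (TM T (sq_bot s)))
     in \<lparr>
     TO = TM T,
     TM = ts,
     TC = (\<lambda>\<gamma>. SquareCell (ts (sc_src \<gamma>)) (ts (sc_tgt \<gamma>)) (TC T (sc_top \<gamma>)) (TC T (sc_bot \<gamma>))),
     eta = (\<lambda>p. Square p (TM T p) (eta T (Dom K p)) (eta T (Cod K p))),
     mu = (\<lambda>p. Square (TM T (TM T p)) (TM T p) (mu T (Dom K p)) (mu T (Cod K p))) \<rparr>)"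

lemmas square_simps = in_hom in_cells is_square_def is_square_cell_def compatible_pair_def
    sq_comp_def

lemma arrow_2cat_simps [simp]:
  "Obj (arrow_2cat K) = Loose K"
  "s \<in> Loose (arrow_2cat K) \<longleftrightarrow> is_square K s"
  "s \<in> Tight (arrow_2cat K) \<longleftrightarrow> is_square K s \<and> sq_top s \<in> Tight K \<and> sq_bot s \<in> Tight K"
  "\<gamma> \<in> Cell (arrow_2cat K) \<longleftrightarrow> is_square_cell K \<gamma>"
  "Dom (arrow_2cat K) s = sq_dom s" "Cod (arrow_2cat K) s = sq_cod s"
  "Src (arrow_2cat K) \<gamma> = sc_src \<gamma>" "Tgt (arrow_2cat K) \<gamma> = sc_tgt \<gamma>"
  "Id1 (arrow_2cat K) p = Square p p (Id1 K (Dom K p)) (Id1 K (Cod K p))"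
  "Id2 (arrow_2cat K) s = SquareCell s s (Id2 K (sq_top s)) (Id2 K (sq_bot s))"
  "t \<odot>\<^bsub>arrow_2cat K\<^esub> s = sq_comp K t s"
  "\<delta> \<cdot>\<^bsub>arrow_2cat K\<^esub> \<gamma> = SquareCell (sc_src \<gamma>) (sc_tgt \<delta>)
     (sc_top \<delta> \<cdot>\<^bsub>K\<^esub> sc_top \<gamma>) (sc_bot \<delta> \<cdot>\<^bsub>K\<^esub> sc_bot \<gamma>)"
  "\<delta> \<star>\<^bsub>arrow_2cat K\<^esub> \<gamma> = SquareCell (sq_comp K (sc_src \<delta>) (sc_src \<gamma>))
     (sq_comp K (sc_tgt \<delta>) (sc_tgt \<gamma>))
     (sc_top \<delta> \<star>\<^bsub>K\<^esub> sc_top \<gamma>) (sc_bot \<delta> \<star>\<^bsub>K\<^esub> sc_bot \<gamma>)"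
  by (simp_all add: arrow_2cat_def)

lemma arrow_monad_simps [simp]:
  "TO (arrow_monad K T) p = TM T p"
  "TM (arrow_monad K T) s =
     Square (TM T (sq_dom s)) (TM T (sq_cod s)) (TM T (sq_top s)) (TM T (sq_bot s))"
  "TC (arrow_monad K T) \<gamma> = SquareCell (TM (arrow_monad K T) (sc_src \<gamma>))
     (TM (arrow_monad K T) (sc_tgt \<gamma>)) (TC T (sc_top \<gamma>)) (TC T (sc_bot \<gamma>))"
  "eta (arrow_monad K T) p = Square p (TM T p) (eta T (Dom K p)) (eta T (Cod K p))"
  "mu (arrow_monad K T) p = Square (TM T (TM T p)) (TM T p) (mu T (Dom K p)) (mu T (Cod K p))"
  by (simp_all add: arrow_monad_def Let_def)

context two_category
begin

lemma is_square_comp: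
  assumes s: "is_square K s" and t: "is_square K t" and st: "sq_cod s = sq_dom t"
  shows "is_square K (sq_comp K t s)"
proof -
  have a: "sq_cod s \<odot> sq_top s = sq_bot s \<odot> sq_dom s"
    "sq_cod t \<odot> sq_top t = sq_bot t \<odot> sq_dom t"
    using s t by (simp_all add: is_square_def)
  have l: "sq_dom s \<in> Loose K" "sq_top s \<in> Loose K" "sq_bot s \<in> Loose K" "sq_cod s \<in> Loose K"
    "sq_top t \<in> Loose K" "sq_bot t \<in> Loose K" "sq_cod t \<in> Loose K"
    "Dom K (sq_top s) = Dom K (sq_dom s)" "Cod K (sq_top s) = Dom K (sq_cod s)"
    "Dom K (sq_bot s) = Cod K (sq_dom s)" "Cod K (sq_bot s) = Cod K (sq_cod s)"
    "Dom K (sq_top t) = Dom K (sq_cod s)" "Cod K (sq_top t) = Dom K (sq_cod t)"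
    "Dom K (sq_bot t) = Cod K (sq_cod s)" "Cod K (sq_bot t) = Cod K (sq_cod t)"
    using s t st by (simp_all add: is_square_def in_hom)
  have "sq_cod t \<odot> (sq_top t \<odot> sq_top s) = (sq_cod t \<odot> sq_top t) \<odot> sq_top s"
    using l by simp
  also have "\<dots> = sq_bot t \<odot> (sq_cod s \<odot> sq_top s)"
    unfolding a(2) st[symmetric] using l by simp
  also have "\<dots> = (sq_bot t \<odot> sq_bot s) \<odot> sq_dom s"
    unfolding a(1) using l by simp
  finally have "sq_cod t \<odot> (sq_top t \<odot> sq_top s) = (sq_bot t \<odot> sq_bot s) \<odot> sq_dom s" .
  then show ?thesis
    using l by (simp add: is_square_def in_hom sq_comp_def)
qed

lemma is_square_cell_Hcomp:
  assumes g: "is_square_cell K \<gamma>" and d: "is_square_cell K \<delta>"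
    and gd: "sq_cod (sc_src \<gamma>) = sq_dom (sc_src \<delta>)"
  shows "is_square_cell K (\<delta> \<star>\<^bsub>arrow_2cat K\<^esub> \<gamma>)"
proof -
  obtain p q x y x' y' \<gamma>1 \<gamma>0 where G: "\<gamma> = SquareCell (Square p q x y) (Square p q x' y') \<gamma>1 \<gamma>0"
    using g by (cases \<gamma>; cases "sc_src \<gamma>"; cases "sc_tgt \<gamma>") (auto simp: is_square_cell_def)
  obtain r z w z' w' \<delta>1 \<delta>0 where D: "\<delta> = SquareCell (Square q r z w) (Square q r z' w') \<delta>1 \<delta>0"
    using d gd G by (cases \<delta>; cases "sc_src \<delta>"; cases "sc_tgt \<delta>") (auto simp: is_square_cell_def)
  have e: "q \<lhd> \<gamma>1 = \<gamma>0 \<rhd> p" "r \<lhd> \<delta>1 = \<delta>0 \<rhd> q"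
    using g d by (simp_all add: G D is_square_cell_def compatible_pair_def)
  have a: "r \<lhd> (\<delta>1 \<star> \<gamma>1) = (r \<lhd> \<delta>1) \<star> \<gamma>1"
    using g d by (subst Hcomp_assoc_simp) (auto simp: G D square_simps)
  have b: "(r \<lhd> \<delta>1) \<star> \<gamma>1 = \<delta>0 \<star> (q \<lhd> \<gamma>1)"
    unfolding e(2) using g d by (subst Hcomp_assoc_simp) (auto simp: G D square_simps)
  have c: "\<delta>0 \<star> (q \<lhd> \<gamma>1) = (\<delta>0 \<star> \<gamma>0) \<rhd> p"
    unfolding e(1) using g d by (subst Hcomp_assoc_simp) (auto simp: G D square_simps)
  have sq: "is_square K (sq_comp K (sc_src \<delta>) (sc_src \<gamma>))"
    "is_square K (sq_comp K (sc_tgt \<delta>) (sc_tgt \<gamma>))"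
    using g d gd by (auto intro!: is_square_comp simp: is_square_cell_def)
  then show ?thesis
    using g d gd a b c
    by (auto simp: G D is_square_cell_def compatible_pair_def sq_comp_def is_square_def in_hom
        in_cells)
qed

lemma two_category_arrow: "two_category (arrow_2cat K)"
  \<comment> \<open>The cases not left to componentwise rewriting are composition of 1-cells, horizontal
    composition of 2-cells, and its associativity.\<close>
proof (unfold_locales, goal_cases)
  case (4 f A B g C)
  then show ?case using is_square_comp[of f g]
    by (auto simp add: in_hom) (simp_all add: sq_comp_def)
next
  case (17 \<phi> f f' \<psi> g g')
  then show ?case using is_square_cell_Hcomp[of \<phi> \<psi>] by (auto simp add: in_cells)
next
  case (18 \<phi> f f' \<psi> g g' \<chi> h h')
  then show ?case by (auto simp: square_simps)
qed (auto simp: square_simps interchange_simp square.expand square_cell.expand)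

end

context enhanced_2_monad
begin

lemma is_square_TM:
  assumes "is_square K s"
  shows "is_square K (TM (arrow_monad K T) s)"
proof -
  have "TM T (sq_cod s) \<odot> TM T (sq_top s) = TM T (sq_cod s \<odot> sq_top s)"
    using assms by (subst TM_Comp_simp) (auto simp: is_square_def in_hom)
  also have "\<dots> = TM T (sq_bot s \<odot> sq_dom s)"
    using assms by (simp add: is_square_def)
  also have "\<dots> = TM T (sq_bot s) \<odot> TM T (sq_dom s)"
    using assms by (subst TM_Comp_simp) (auto simp: is_square_def in_hom)
  finally show ?thesis using assms by (simp add: is_square_def in_hom)
qed

lemma is_square_cell_TC:
  assumes "is_square_cell K \<gamma>"
  shows "is_square_cell K (TC (arrow_monad K T) \<gamma>)"
proof -
  have "TM T (sq_cod (sc_src \<gamma>)) \<lhd> TC T (sc_top \<gamma>) = TC T (sq_cod (sc_src \<gamma>) \<lhd> sc_top \<gamma>)"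
    using assms by (subst TC_Hcomp_simp) (auto simp: square_simps)
  also have "\<dots> = TC T (sc_bot \<gamma> \<rhd> sq_dom (sc_src \<gamma>))"
    using assms by (simp add: is_square_cell_def compatible_pair_def)
  also have "\<dots> = TC T (sc_bot \<gamma>) \<rhd> TM T (sq_dom (sc_src \<gamma>))"
    using assms by (subst TC_Hcomp_simp) (auto simp: square_simps)
  finally have "TM T (sq_cod (sc_src \<gamma>)) \<lhd> TC T (sc_top \<gamma>)
      = TC T (sc_bot \<gamma>) \<rhd> TM T (sq_dom (sc_src \<gamma>))" .
  then show ?thesis
    using assms is_square_TM[of "sc_src \<gamma>"] is_square_TM[of "sc_tgt \<gamma>"]
    by (simp add: is_square_cell_def compatible_pair_def in_cells)
qed

lemma enhanced_2_monad_arrow: "enhanced_2_monad (arrow_2cat K) (arrow_monad K T)"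
proof -
  interpret A: two_category "arrow_2cat K" by (rule two_category_arrow)
  \<comment> \<open>In case 5 \<open>T\<close> acts on squares, in case 7 on square cells; 13 to 20 rest on naturality of the
    unit and the multiplication; the remaining axioms hold componentwise.\<close>
  show ?thesis
  proof (unfold_locales, goal_cases)
    case 1 then show ?case by auto
  next
    case 2 then show ?case by (auto simp: square_simps Id1_Tight)
  next
    case (3 f g) then show ?case using A.Comp_simps(1)[of f g]
      by (auto simp: square_simps Comp_Tight)
  next
    case 4 then show ?case by simp
  next
    case (5 f A B) then show ?case using is_square_TM[of f] by (auto simp: in_hom)
  next
    case (6 f) then show ?case using is_square_TM[of f] by auto
  next
    case (7 \<phi> f g) then show ?case using is_square_cell_TC[of \<phi>] by (auto simp: in_cells)
  next
    case (13 p)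
    then show ?case using eta_natural_simp[of p "Dom K p"] by (auto simp: square_simps)
  next
    case (14 p)
    then show ?case using eta_natural_simp[of p "Dom K p"] by (auto simp: square_simps)
  next
    case (17 p)
    then show ?case using mu_natural_simp[of p "Dom K p"] by (auto simp: square_simps)
  next
    case (18 p)
    then show ?case using mu_natural_simp[of p "Dom K p"] by (auto simp: square_simps)
  next
    case (16 f A B \<phi> g)
    then show ?case
      using eta_natural2[of "sq_top f" _ _ "sc_top \<phi>"] eta_natural2[of "sq_bot f" _ _ "sc_bot \<phi>"]
      by (auto simp: square_simps)
  next
    case (20 f A B \<phi> g)
    then show ?case
      using mu_natural2[of "sq_top f" _ _ "sc_top \<phi>"] mu_natural2[of "sq_bot f" _ _ "sc_bot \<phi>"]
      by (auto simp: square_simps)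
  qed (auto simp: square_simps square.expand square_cell.expand eta_natural2 mu_natural2)
qed

end

subsection \<open>Projecting lax structures along top and bottom\<close>

definition top_alg ::
  "('o, 'm, 'c, 'z) enhanced_2cat_scheme \<Rightarrow> ('m, 'm square, ('m, 'c) square_cell) lax_alg \<Rightarrow>
   ('o, 'm, 'c) lax_alg" where
  "top_alg K X = LaxAlg (Dom K (carr X)) (sq_top (act X)) (sc_top (unitor X)) (sc_top (multor X))"

definition bot_alg ::
  "('o, 'm, 'c, 'z) enhanced_2cat_scheme \<Rightarrow> ('m, 'm square, ('m, 'c) square_cell) lax_alg \<Rightarrow>
   ('o, 'm, 'c) lax_alg" where
  "bot_alg K X = LaxAlg (Cod K (carr X)) (sq_bot (act X)) (sc_bot (unitor X)) (sc_bot (multor X))"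

definition top_mor ::
  "('o, 'm, 'c, 'z) enhanced_2cat_scheme \<Rightarrow> ('m, 'm square, ('m, 'c) square_cell) lax_mor \<Rightarrow>
   ('o, 'm, 'c) lax_mor" where
  "top_mor K F = LaxMor (top_alg K (lm_dom F)) (top_alg K (lm_cod F))
     (sq_top (und F)) (sc_top (bar F))"

definition bot_mor ::
  "('o, 'm, 'c, 'z) enhanced_2cat_scheme \<Rightarrow> ('m, 'm square, ('m, 'c) square_cell) lax_mor \<Rightarrow>
   ('o, 'm, 'c) lax_mor" where
  "bot_mor K F = LaxMor (bot_alg K (lm_dom F)) (bot_alg K (lm_cod F))
     (sq_bot (und F)) (sc_bot (bar F))"

text \<open>The axioms of a strict morphism say exactly that its square of structure maps and its pairs of
  unitors and of multiplicators are a 1-cell and 2-cells of the arrow 2-category.\<close>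

definition arrow_alg ::
  "('o, 'm, 'c, 'z) enhanced_2cat_scheme \<Rightarrow> ('o, 'm, 'c) two_monad \<Rightarrow> ('o, 'm, 'c) lax_mor \<Rightarrow>
   ('m, 'm square, ('m, 'c) square_cell) lax_alg" where
  "arrow_alg K T P = (let p = und P; X = lm_dom P; Y = lm_cod P;
       L = arrow_2cat K; M = arrow_monad K T;
       a = Square (TM T p) p (act X) (act Y)
     in LaxAlg p a
       (SquareCell (Id1 L p) (a \<odot>\<^bsub>L\<^esub> eta M p) (unitor X) (unitor Y))
       (SquareCell (a \<odot>\<^bsub>L\<^esub> TM M a) (a \<odot>\<^bsub>L\<^esub> mu M p) (multor X) (multor Y)))"

definition arrow_mor ::
  "('o, 'm, 'c, 'z) enhanced_2cat_scheme \<Rightarrow> ('o, 'm, 'c) two_monad \<Rightarrow> ('o, 'm, 'c) lax_mor \<Rightarrow>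
   ('o, 'm, 'c) lax_mor \<Rightarrow> ('o, 'm, 'c) lax_mor \<Rightarrow> ('o, 'm, 'c) lax_mor \<Rightarrow>
   ('m, 'm square, ('m, 'c) square_cell) lax_mor" where
  "arrow_mor K T P Q F\<^sub>1 F = (let L = arrow_2cat K; M = arrow_monad K T;
       X = arrow_alg K T P; Y = arrow_alg K T Q;
       s = Square (und P) (und Q) (und F\<^sub>1) (und F)
     in LaxMor X Y s
       (SquareCell (act Y \<odot>\<^bsub>L\<^esub> TM M s) (s \<odot>\<^bsub>L\<^esub> act X) (bar F\<^sub>1) (bar F)))"

context enhanced_2_monad
begin

lemma lax_alg_typing:
  assumes "lax_algebra K T X"
  shows "carr X \<in> Obj K" "act X \<in> Loose K" "Dom K (act X) = TO T (carr X)" "Cod K (act X) = carr X"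
    "act X \<in> Tight K"
    "unitor X \<in> Cell K" "Src K (unitor X) = Id1 K (carr X)"
    "Tgt K (unitor X) = act X \<odot> eta T (carr X)"
    "multor X \<in> Cell K" "Src K (multor X) = act X \<odot> TM T (act X)"
    "Tgt K (multor X) = act X \<odot> mu T (carr X)"
  using assms by (auto simp: lax_algebra_def Let_def in_hom in_cells)

lemma lax_mor_typing:
  assumes "lax_morphism K T F"
  shows "lax_algebra K T (lm_dom F)" "lax_algebra K T (lm_cod F)"
    "und F \<in> Loose K" "Dom K (und F) = carr (lm_dom F)" "Cod K (und F) = carr (lm_cod F)"
    "bar F \<in> Cell K" "Src K (bar F) = act (lm_cod F) \<odot> TM T (und F)"
    "Tgt K (bar F) = und F \<odot> act (lm_dom F)"
  using assms by (auto simp: lax_morphism_def Let_def in_hom in_cells)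

text \<open>Sending a 1-cell to its domain or to its codomain is a strict 2-functor from the arrow 2-category
  to \<open>K\<close> that commutes with the 2-monads, and such 2-functors preserve all lax structure.\<close>

lemma lax_algebra_projections:
  assumes "lax_algebra (arrow_2cat K) (arrow_monad K T) X"
  shows "lax_algebra K T (top_alg K X)" "lax_algebra K T (bot_alg K X)"
proof -
  let ?L = "arrow_2cat K" and ?M = "arrow_monad K T"
  interpret A: enhanced_2_monad ?L ?M by (rule enhanced_2_monad_arrow)
  note t = A.lax_alg_typing[OF assms]
  have sq: "is_square K (act X)" "is_square_cell K (unitor X)" "is_square_cell K (multor X)"
    "carr X \<in> Loose K" "sq_dom (act X) = TM T (carr X)" "sq_cod (act X) = carr X"
    using t by simp_all
  have ty: "sq_top (act X) \<in> Loose K" "sq_bot (act X) \<in> Loose K"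
    "Dom K (sq_top (act X)) = TO T (Dom K (carr X))" "Cod K (sq_top (act X)) = Dom K (carr X)"
    "Dom K (sq_bot (act X)) = TO T (Cod K (carr X))" "Cod K (sq_bot (act X)) = Cod K (carr X)"
    "sq_top (act X) \<in> Tight K" "sq_bot (act X) \<in> Tight K"
    using sq t(5) by (simp_all add: is_square_def in_hom)
  have ce: "sc_top (unitor X) \<in> cells K (Id1 K (Dom K (carr X))) (sq_top (act X) \<odot> eta T
      (Dom K (carr X)))"
    "sc_bot (unitor X) \<in> cells K (Id1 K (Cod K (carr X))) (sq_bot (act X) \<odot> eta T (Cod K (carr X)))"
    "sc_top (multor X) \<in> cells K (sq_top (act X) \<odot> TM T (sq_top (act X))) (sq_top (act X) \<odot> mu T
        (Dom K (carr X)))"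
    "sc_bot (multor X) \<in> cells K (sq_bot (act X) \<odot> TM T (sq_bot (act X))) (sq_bot (act X) \<odot> mu T
        (Cod K (carr X)))"
    using sq(2,3) t(7,8,10,11) by (simp_all add: is_square_cell_def compatible_pair_def sq_comp_def)
  note eqs = assms[unfolded lax_algebra_def Let_def, THEN conjunct2, THEN conjunct2, THEN conjunct2,
      THEN conjunct2, THEN conjunct2]
  note e1 = eqs[THEN conjunct1] and e2 = eqs[THEN conjunct2, THEN conjunct1]
    and e3 = eqs[THEN conjunct2, THEN conjunct2]
  show "lax_algebra K T (top_alg K X)"
    unfolding lax_algebra_def top_alg_def lax_alg.sel Let_def
    using ty sq(4) ce arg_cong[OF e1, of sc_top] arg_cong[OF e2, of sc_top] arg_cong[OF e3, of
        sc_top]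
    by (simp add: sq in_hom)
  show "lax_algebra K T (bot_alg K X)"
    unfolding lax_algebra_def bot_alg_def lax_alg.sel Let_def
    using ty sq(4) ce arg_cong[OF e1, of sc_bot] arg_cong[OF e2, of sc_bot] arg_cong[OF e3, of
        sc_bot]
    by (simp add: sq in_hom)
qed

lemma lax_morphism_projections:
  assumes "lax_morphism (arrow_2cat K) (arrow_monad K T) F"
  shows "lax_morphism K T (top_mor K F)" "lax_morphism K T (bot_mor K F)"
proof -
  let ?L = "arrow_2cat K" and ?M = "arrow_monad K T"
  interpret A: enhanced_2_monad ?L ?M by (rule enhanced_2_monad_arrow)
  note t = A.lax_mor_typing[OF assms]
  note t1 = A.lax_alg_typing[OF t(1)] and t2 = A.lax_alg_typing[OF t(2)]
  have sq: "is_square K (und F)" "is_square_cell K (bar F)"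
    "sq_dom (und F) = carr (lm_dom F)" "sq_cod (und F) = carr (lm_cod F)"
    "sq_dom (act (lm_dom F)) = TM T (carr (lm_dom F))"
    "sq_dom (act (lm_cod F)) = TM T (carr (lm_cod F))"
    using t t1 t2 by simp_all
  have ty: "sq_top (und F) \<in> hom K (Dom K (carr (lm_dom F))) (Dom K (carr (lm_cod F)))"
    "sq_bot (und F) \<in> hom K (Cod K (carr (lm_dom F))) (Cod K (carr (lm_cod F)))"
    using sq(1,3,4) by (simp_all add: is_square_def)
  have ce: "sc_top (bar F) \<in> cells K (sq_top (act (lm_cod F)) \<odot> TM T (sq_top (und F)))
      (sq_top (und F) \<odot> sq_top (act (lm_dom F)))"
    "sc_bot (bar F) \<in> cells K (sq_bot (act (lm_cod F)) \<odot> TM T (sq_bot (und F))) (sq_bot (und F) \<odot>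
        sq_bot (act (lm_dom F)))"
    using sq(2) t(7,8) by (simp_all add: is_square_cell_def compatible_pair_def sq_comp_def)
  note eqs = assms[unfolded lax_morphism_def Let_def, THEN conjunct2, THEN conjunct2, THEN
      conjunct2,
      THEN conjunct2]
  note e1 = eqs[THEN conjunct1] and e2 = eqs[THEN conjunct2]
  show "lax_morphism K T (top_mor K F)"
    unfolding lax_morphism_def top_mor_def top_alg_def lax_mor.sel lax_alg.sel Let_def
    using ty ce lax_algebra_projections(1)[OF t(1)] lax_algebra_projections(1)[OF t(2)]
      arg_cong[OF e1, of sc_top] arg_cong[OF e2, of sc_top]
    by (simp add: sq top_alg_def)
  show "lax_morphism K T (bot_mor K F)"
    unfolding lax_morphism_def bot_mor_def bot_alg_def lax_mor.sel lax_alg.sel Let_def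
    using ty ce lax_algebra_projections(2)[OF t(1)] lax_algebra_projections(2)[OF t(2)]
      arg_cong[OF e1, of sc_bot] arg_cong[OF e2, of sc_bot]
    by (simp add: sq bot_alg_def)
qed

lemma T_2_morphism_projections:
  assumes "T_2_morphism (arrow_2cat K) (arrow_monad K T) \<Phi>"
  shows "T_2_morphism K T
      (LaxCell (top_mor K (lc_src \<Phi>)) (top_mor K (lc_tgt \<Phi>)) (sc_top (und_cell \<Phi>)))"
    "T_2_morphism K T
      (LaxCell (bot_mor K (lc_src \<Phi>)) (bot_mor K (lc_tgt \<Phi>)) (sc_bot (und_cell \<Phi>)))"
proof -
  have l: "lax_morphism (arrow_2cat K) (arrow_monad K T) (lc_src \<Phi>)"
    "lax_morphism (arrow_2cat K) (arrow_monad K T) (lc_tgt \<Phi>)"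
    and d: "lm_dom (lc_src \<Phi>) = lm_dom (lc_tgt \<Phi>)" "lm_cod (lc_src \<Phi>) = lm_cod (lc_tgt \<Phi>)"
    and c: "und_cell \<Phi> \<in> cells (arrow_2cat K) (und (lc_src \<Phi>)) (und (lc_tgt \<Phi>))"
    using assms by (simp_all add: T_2_morphism_def Let_def)
  have e: "(und_cell \<Phi> \<rhd>\<^bsub>arrow_2cat K\<^esub> act (lm_dom (lc_src \<Phi>))) \<cdot>\<^bsub>arrow_2cat K\<^esub> bar (lc_src \<Phi>) =
      bar (lc_tgt \<Phi>) \<cdot>\<^bsub>arrow_2cat K\<^esub> (act (lm_cod (lc_src \<Phi>)) \<lhd>\<^bsub>arrow_2cat K\<^esub> TC (arrow_monad K T)
          (und_cell \<Phi>))"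
    using assms unfolding T_2_morphism_def Let_def by (elim conjE) (simp only:)
  have ce: "sc_top (und_cell \<Phi>) \<in> cells K (sq_top (und (lc_src \<Phi>))) (sq_top (und (lc_tgt \<Phi>)))"
    "sc_bot (und_cell \<Phi>) \<in> cells K (sq_bot (und (lc_src \<Phi>))) (sq_bot (und (lc_tgt \<Phi>)))"
    using c unfolding in_cells[of _ "arrow_2cat K"]
    by (auto simp: is_square_cell_def compatible_pair_def)
  show "T_2_morphism K T
      (LaxCell (top_mor K (lc_src \<Phi>)) (top_mor K (lc_tgt \<Phi>)) (sc_top (und_cell \<Phi>)))"
    using lax_morphism_projections(1)[OF l(1)] lax_morphism_projections(1)[OF l(2)] ce
      arg_cong[OF e, of sc_top] d
    by (simp add: T_2_morphism_def Let_def) (simp add: top_mor_def top_alg_def)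
  show "T_2_morphism K T
      (LaxCell (bot_mor K (lc_src \<Phi>)) (bot_mor K (lc_tgt \<Phi>)) (sc_bot (und_cell \<Phi>)))"
    using lax_morphism_projections(2)[OF l(1)] lax_morphism_projections(2)[OF l(2)] ce
      arg_cong[OF e, of sc_bot] d
    by (simp add: T_2_morphism_def Let_def) (simp add: bot_mor_def bot_alg_def)
qed

lemma strict_mor_eqs:
  assumes "strict_morphism K T P"
  shows "und P \<odot> act (lm_dom P) = act (lm_cod P) \<odot> TM T (und P)"
    "und P \<lhd> unitor (lm_dom P) = unitor (lm_cod P) \<rhd> und P"
    "und P \<lhd> multor (lm_dom P) = multor (lm_cod P) \<rhd> TM T (TM T (und P))"
proof -
  have P: "lax_morphism K T P" and b: "bar P = Id2 K (und P \<odot> act (lm_dom P))"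
    using assms by (auto simp: strict_morphism_def)
  note t = lax_mor_typing[OF P] lax_alg_typing[OF lax_mor_typing(1)[OF P]]
    lax_alg_typing[OF lax_mor_typing(2)[OF P]]
  show e: "und P \<odot> act (lm_dom P) = act (lm_cod P) \<odot> TM T (und P)"
    using t(7) unfolding b using t by simp
  show "und P \<lhd> unitor (lm_dom P) = unitor (lm_cod P) \<rhd> und P"
  proof -
    have "und P \<lhd> unitor (lm_dom P) =
        (bar P \<rhd> eta T (carr (lm_dom P))) \<cdot> (unitor (lm_cod P) \<rhd> und P)"
      using P unfolding lax_morphism_def Let_def by blast
    then show ?thesis unfolding b using t by (simp add: e)
  qed
  have "TM T (und P \<odot> act (lm_dom P)) = TM T (act (lm_cod P) \<odot> TM T (und P))"
    by (simp only: e)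
  then have Te: "TM T (und P) \<odot> TM T (act (lm_dom P)) = TM T (act (lm_cod P)) \<odot> TM T (TM T (und P))"
    using t by (simp add: TM_Comp_simp[of "act (lm_dom P)" "und P"])
  show "und P \<lhd> multor (lm_dom P) = multor (lm_cod P) \<rhd> TM T (TM T (und P))"
  proof -
    have "(und P \<lhd> multor (lm_dom P)) \<cdot> (bar P \<rhd> TM T (act (lm_dom P)))
        \<cdot> (act (lm_cod P) \<lhd> TC T (bar P)) =
        (bar P \<rhd> mu T (carr (lm_dom P))) \<cdot> (multor (lm_cod P) \<rhd> TM T (TM T (und P)))"
      using P unfolding lax_morphism_def Let_def by blast
    then show ?thesis
      unfolding b using t by (simp add: e Te Comp_extend[OF e] Comp_extend[OF Te])
  qed
qed

lemma arrow_alg_simps [simp]: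
  "carr (arrow_alg K T P) = und P"
  "act (arrow_alg K T P) = Square (TM T (und P)) (und P) (act (lm_dom P)) (act (lm_cod P))"
  "sc_top (unitor (arrow_alg K T P)) = unitor (lm_dom P)"
  "sc_bot (unitor (arrow_alg K T P)) = unitor (lm_cod P)"
  "sc_top (multor (arrow_alg K T P)) = multor (lm_dom P)"
  "sc_bot (multor (arrow_alg K T P)) = multor (lm_cod P)"
  by (simp_all add: arrow_alg_def Let_def)

lemma lax_algebra_arrow_alg:
  assumes P: "strict_morphism K T P"
  shows "lax_algebra (arrow_2cat K) (arrow_monad K T) (arrow_alg K T P)"
proof -
  have l: "lax_morphism K T P" using P by (simp add: strict_morphism_def)
  note e = strict_mor_eqs[OF P]
  note t = lax_mor_typing[OF l] lax_alg_typing[OF lax_mor_typing(1)[OF l]]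
    lax_alg_typing[OF lax_mor_typing(2)[OF l]]
  interpret A: enhanced_2_monad "arrow_2cat K" "arrow_monad K T" by (rule enhanced_2_monad_arrow)
  define a where "a = Square (TM T (und P)) (und P) (act (lm_dom P)) (act (lm_cod P))"
  have a: "a \<in> Loose (arrow_2cat K)" "sq_dom a = TM T (und P)" "sq_cod a = und P"
    using t e(1) by (simp_all add: a_def is_square_def in_hom)
  have sq: "is_square K (Id1 (arrow_2cat K) (und P))"
    "is_square K (a \<odot>\<^bsub>arrow_2cat K\<^esub> eta (arrow_monad K T) (und P))"
    "is_square K (a \<odot>\<^bsub>arrow_2cat K\<^esub> TM (arrow_monad K T) a)"
    "is_square K (a \<odot>\<^bsub>arrow_2cat K\<^esub> mu (arrow_monad K T) (und P))"
    using A.Comp_simps(1)[of "eta (arrow_monad K T) (und P)" a] A.Comp_simps(1)[of "TM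
        (arrow_monad K T) a" a]
      A.Comp_simps(1)[of "mu (arrow_monad K T) (und P)" a] A.Id1_simps(1)[of "und P"]
      A.TM_simps(1)[of a] A.eta_Tight[of "und P"] A.mu_Tight[of "und P"] a t(3) by simp_all
  have X: "lax_algebra K T (lm_dom P)" "lax_algebra K T (lm_cod P)" using t by auto
  show ?thesis
    using X a sq t e(2,3) unfolding lax_algebra_def Let_def arrow_alg_simps a_def[symmetric]
    by (simp add: in_hom in_cells is_square_cell_def compatible_pair_def)
      (simp add: a_def arrow_alg_def sq_comp_def Let_def)
qed

end

section \<open>Pullbacks and discrete opfibrations\<close>

text \<open>The uniqueness half of a discrete opfibration, in a form that passes to pullbacks.\<close>

definition unique_lifts :: "('o, 'm, 'c, 'z) enhanced_2cat_scheme \<Rightarrow> 'm \<Rightarrow> bool" where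
  "unique_lifts K p \<longleftrightarrow> p \<in> Loose K \<and> (\<forall>l l'. l \<in> Cell K \<longrightarrow> l' \<in> Cell K \<longrightarrow>
     Cod K (Src K l) = Dom K p \<longrightarrow> Src K l = Src K l' \<longrightarrow> p \<lhd>\<^bsub>K\<^esub> l = p \<lhd>\<^bsub>K\<^esub> l' \<longrightarrow> l = l')"

context two_category
begin

lemma pullback_typing:
  assumes "is_pullback K p b q h"
  shows "p \<in> Loose K" "b \<in> Loose K" "q \<in> Loose K" "h \<in> Loose K" "Cod K b = Cod K p"
    "Cod K q = Dom K b" "Dom K h = Dom K q" "Cod K h = Dom K p" "p \<odot> h = b \<odot> q"
  using assms by (simp_all add: is_pullback_def in_hom)

lemma pullback_square: "is_pullback K p b q h \<Longrightarrow> is_square K (Square q p h b)"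
  using pullback_typing[of p b q h] by (simp add: is_square_def in_hom)

lemma pullback_map:
  assumes "is_pullback K p b q h" "x \<in> Loose K" "y \<in> Loose K" "Dom K y = Dom K x"
    "Cod K x = Cod K q" "Cod K y = Cod K h" "p \<odot> y = b \<odot> x"
  obtains t where "t \<in> Loose K" "Dom K t = Dom K x" "Cod K t = Dom K q" "q \<odot> t = x" "h \<odot> t = y"
proof -
  note t = pullback_typing[OF assms(1)]
  have "\<exists>!t. t \<in> hom K (Dom K x) (Dom K q) \<and> q \<odot> t = x \<and> h \<odot> t = y"
    using assms t by (auto simp: is_pullback_def in_hom)
  then show ?thesis using that by (auto simp: in_hom)
qed

lemma pullback_map_eq:
  assumes "is_pullback K p b q h" "t \<in> Loose K" "t' \<in> Loose K" "Dom K t = Dom K t'"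
    "Cod K t = Dom K q" "Cod K t' = Dom K q" "q \<odot> t = q \<odot> t'" "h \<odot> t = h \<odot> t'"
  shows "t = t'"
proof -
  note ty = pullback_typing[OF assms(1)]
  have "p \<odot> (h \<odot> t) = (p \<odot> h) \<odot> t" using ty(1-8) assms(2-6) by simp
  also have "\<dots> = b \<odot> (q \<odot> t)" unfolding ty(9) using ty(1-8) assms(2-6) by simp
  finally have "p \<odot> (h \<odot> t) = b \<odot> (q \<odot> t)" .
  then have "\<exists>!s. s \<in> hom K (Dom K t) (Dom K q) \<and> q \<odot> s = q \<odot> t \<and> h \<odot> s = h \<odot> t"
    using assms(1)[unfolded is_pullback_def, THEN conjunct2, THEN conjunct2, THEN conjunct2,
      THEN conjunct2, THEN conjunct2, THEN conjunct1, rule_format, of "q \<odot> t" "Dom K t" "h \<odot> t"]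
      assms(2-6) ty(1-8) by (simp add: in_hom)
  then show ?thesis using assms by (auto simp: in_hom)
qed

lemma pullback_cell:
  assumes "is_pullback K p b q h" "\<phi> \<in> Cell K" "\<psi> \<in> Cell K"
    "Dom K (Src K \<psi>) = Dom K (Src K \<phi>)" "Cod K (Src K \<phi>) = Cod K q" "Cod K (Src K \<psi>) = Cod K h"
    "p \<lhd> \<psi> = b \<lhd> \<phi>"
  obtains \<chi> where "\<chi> \<in> Cell K" "Dom K (Src K \<chi>) = Dom K (Src K \<phi>)" "Cod K (Src K \<chi>) = Dom K q"
    "q \<lhd> \<chi> = \<phi>" "h \<lhd> \<chi> = \<psi>"
proof -
  note t = pullback_typing[OF assms(1)]
  have "\<exists>!\<chi>. \<chi> \<in> Cell K \<and> Dom K (Src K \<chi>) = Dom K (Src K \<phi>) \<and> Cod K (Src K \<chi>) = Dom K q \<and>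
           q \<lhd> \<chi> = \<phi> \<and> h \<lhd> \<chi> = \<psi>"
    using assms(1)[unfolded is_pullback_def, THEN conjunct2, THEN conjunct2, THEN conjunct2,
      THEN conjunct2, THEN conjunct2, THEN conjunct2, rule_format,
      of "Src K \<phi>" "Dom K (Src K \<phi>)" "Tgt K \<phi>" "Src K \<psi>" "Tgt K \<psi>" \<phi> \<psi>]
      assms(2-7) t(1-8) by (simp add: in_hom in_cells)
  then show ?thesis using that by auto
qed

lemma pullback_cell_eq:
  assumes "is_pullback K p b q h" "\<chi> \<in> Cell K" "\<chi>' \<in> Cell K"
    "Dom K (Src K \<chi>) = Dom K (Src K \<chi>')" "Cod K (Src K \<chi>) = Dom K q" "Cod K (Src K \<chi>') = Dom K q"
    "q \<lhd> \<chi> = q \<lhd> \<chi>'" "h \<lhd> \<chi> = h \<lhd> \<chi>'"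
  shows "\<chi> = \<chi>'"
proof -
  note t = pullback_typing[OF assms(1)]
  have "p \<lhd> (h \<lhd> \<chi>) = (Id2 K (p \<odot> h)) \<star> \<chi>" using t(1-8) assms(2-6) by simp
  also have "\<dots> = b \<lhd> (q \<lhd> \<chi>)" unfolding t(9) using t(1-8) assms(2-6) by simp
  finally have e: "p \<lhd> (h \<lhd> \<chi>) = b \<lhd> (q \<lhd> \<chi>)" .
  have "\<exists>!\<theta>. \<theta> \<in> Cell K \<and> Dom K (Src K \<theta>) = Dom K (Src K \<chi>) \<and> Cod K (Src K \<theta>) = Dom K q \<and>
           q \<lhd> \<theta> = q \<lhd> \<chi> \<and> h \<lhd> \<theta> = h \<lhd> \<chi>"
    using assms(1)[unfolded is_pullback_def, THEN conjunct2, THEN conjunct2, THEN conjunct2,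
      THEN conjunct2, THEN conjunct2, THEN conjunct2, rule_format,
      of "q \<odot> Src K \<chi>" "Dom K (Src K \<chi>)" "q \<odot> Tgt K \<chi>" "h \<odot> Src K \<chi>" "h \<odot> Tgt K \<chi>" "q \<lhd> \<chi>" "h \<lhd> \<chi>"]
      assms(2-6) t(1-8) e by (simp add: in_hom in_cells)
  then show ?thesis using assms by auto
qed

text \<open>Separates existence from uniqueness and quantifies over 1-cells and 2-cells only, which is the
  form in which pullbacks are pasted.\<close>

lemma is_pullbackI:
  assumes "is_square K (Square q p h b)"
    and ex: "\<And>x y. \<lbrakk>x \<in> Loose K; y \<in> Loose K; Dom K y = Dom K x; Cod K x = Cod K q;
      Cod K y = Cod K h; p \<odot> y = b \<odot> x\<rbrakk> \<Longrightarrow>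
      \<exists>t. t \<in> Loose K \<and> Dom K t = Dom K x \<and> Cod K t = Dom K q \<and> q \<odot> t = x \<and> h \<odot> t = y"
    and eq: "\<And>t t'. \<lbrakk>t \<in> Loose K; t' \<in> Loose K; Dom K t = Dom K t'; Cod K t = Dom K q;
      Cod K t' = Dom K q; q \<odot> t = q \<odot> t'; h \<odot> t = h \<odot> t'\<rbrakk> \<Longrightarrow> t = t'"
    and ex2: "\<And>\<phi> \<psi>. \<lbrakk>\<phi> \<in> Cell K; \<psi> \<in> Cell K; Dom K (Src K \<psi>) = Dom K (Src K \<phi>);
      Cod K (Src K \<phi>) = Cod K q; Cod K (Src K \<psi>) = Cod K h; p \<lhd> \<psi> = b \<lhd> \<phi>\<rbrakk> \<Longrightarrow>
      \<exists>\<chi>. \<chi> \<in> Cell K \<and> Dom K (Src K \<chi>) = Dom K (Src K \<phi>) \<and> Cod K (Src K \<chi>) = Dom K q \<and>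
        q \<lhd> \<chi> = \<phi> \<and> h \<lhd> \<chi> = \<psi>"
    and eq2: "\<And>\<chi> \<chi>'. \<lbrakk>\<chi> \<in> Cell K; \<chi>' \<in> Cell K; Dom K (Src K \<chi>) = Dom K (Src K \<chi>');
      Cod K (Src K \<chi>) = Dom K q; Cod K (Src K \<chi>') = Dom K q; q \<lhd> \<chi> = q \<lhd> \<chi>'; h \<lhd> \<chi> = h \<lhd> \<chi>'\<rbrakk> \<Longrightarrow> \<chi>
          = \<chi>'"
  shows "is_pullback K p b q h"
proof -
  have t: "p \<in> Loose K" "b \<in> Loose K" "q \<in> Loose K" "h \<in> Loose K" "Cod K b = Cod K p"
    "Cod K q = Dom K b" "Dom K h = Dom K q" "Cod K h = Dom K p" "p \<odot> h = b \<odot> q"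
    using assms(1) by (simp_all add: is_square_def in_hom)
  show ?thesis
    unfolding is_pullback_def
  proof (intro conjI allI impI)
    fix X x y assume a: "x \<in> hom K X (Dom K b)" "y \<in> hom K X (Dom K p)" "p \<odot> y = b \<odot> x"
    have c: "x \<in> Loose K" "y \<in> Loose K" "Dom K x = X" "Cod K x = Dom K b" "Dom K y = X"
      "Cod K y = Dom K p"
      using a(1,2) by (simp_all add: in_hom)
    have "\<exists>t. t \<in> Loose K \<and> Dom K t = Dom K x \<and> Cod K t = Dom K q \<and> q \<odot> t = x \<and> h \<odot> t = y"
      by (rule ex[OF c(1,2) _ _ _ a(3)]) (simp_all only: c t)
    then obtain t where t: "t \<in> Loose K" "Dom K t = X" "Cod K t = Dom K q" "q \<odot> t = x" "h \<odot> t = y"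
      unfolding c by blast
    show "\<exists>!t. t \<in> hom K X (Dom K q) \<and> q \<odot> t = x \<and> h \<odot> t = y"
    proof (intro ex1I conjI)
      show "t \<in> hom K X (Dom K q)" using t by (simp add: in_hom)
      fix t' assume "t' \<in> hom K X (Dom K q) \<and> q \<odot> t' = x \<and> h \<odot> t' = y"
      then show "t' = t" by (intro eq[of t' t]) (simp_all add: in_hom t)
    qed (fact t)+
  next
    fix X x x' y y' \<phi> \<psi>
    assume a: "x \<in> hom K X (Dom K b)" "y \<in> hom K X (Dom K p)"
      "\<phi> \<in> cells K x x'" "\<psi> \<in> cells K y y'" "p \<lhd> \<psi> = b \<lhd> \<phi>"
    obtain \<chi> where c: "\<chi> \<in> Cell K" "Dom K (Src K \<chi>) = X" "Cod K (Src K \<chi>) = Dom K q"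
      "q \<lhd> \<chi> = \<phi>" "h \<lhd> \<chi> = \<psi>"
    proof -
      have c: "\<phi> \<in> Cell K" "Src K \<phi> = x" "\<psi> \<in> Cell K" "Src K \<psi> = y" "Dom K x = X"
        "Cod K x = Dom K b" "Dom K y = X" "Cod K y = Dom K p"
        using a(1-4) by (simp_all add: in_hom in_cells)
      have "\<exists>\<chi>. \<chi> \<in> Cell K \<and> Dom K (Src K \<chi>) = Dom K (Src K \<phi>) \<and>
          Cod K (Src K \<chi>) = Dom K q \<and> q \<lhd> \<chi> = \<phi> \<and> h \<lhd> \<chi> = \<psi>"
        by (rule ex2[OF c(1,3) _ _ _ a(5)]) (simp_all only: c t)
      then show thesis unfolding c using that by blast
    qed
    show "\<exists>!\<chi>. \<chi> \<in> Cell K \<and> Dom K (Src K \<chi>) = X \<and> Cod K (Src K \<chi>) = Dom K q \<and>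
        q \<lhd> \<chi> = \<phi> \<and> h \<lhd> \<chi> = \<psi>"
    proof (intro ex1I conjI)
      fix \<chi>' assume "\<chi>' \<in> Cell K \<and> Dom K (Src K \<chi>') = X \<and> Cod K (Src K \<chi>') = Dom K q \<and>
        q \<lhd> \<chi>' = \<phi> \<and> h \<lhd> \<chi>' = \<psi>"
      then show "\<chi>' = \<chi>" by (intro eq2[of \<chi>' \<chi>]) (simp_all add: c)
    qed (fact c)+
  qed (use t in \<open>auto simp: in_hom\<close>)
qed

lemma pullback_paste:
  assumes P: "is_pullback K p b q h" and Q: "is_pullback K q c r k"
  shows "is_pullback K p (b \<odot> c) r (h \<odot> k)"
proof -
  note p = pullback_typing[OF P] and q = pullback_typing[OF Q]
  have e: "p \<odot> (h \<odot> k) = b \<odot> (c \<odot> r)"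
    using Comp_extend[OF p(9), of k] p(1-8) q by simp
  show ?thesis
  proof (rule is_pullbackI)
    show "is_square K (Square r p (h \<odot> k) (b \<odot> c))"
      using p(1-8) q(1-8) e by (simp add: is_square_def in_hom)
  next
    fix x y assume a: "x \<in> Loose K" "y \<in> Loose K" "Dom K y = Dom K x" "Cod K x = Cod K r"
      "Cod K y = Cod K (h \<odot> k)" "p \<odot> y = (b \<odot> c) \<odot> x"
    obtain s where s: "s \<in> Loose K" "Dom K s = Dom K x" "Cod K s = Dom K q" "q \<odot> s = c \<odot> x"
      "h \<odot> s = y"
      by (rule pullback_map[OF P, of "c \<odot> x" y]) (use a p(1-8) q(1-8) in simp_all)
    obtain t where t: "t \<in> Loose K" "Dom K t = Dom K x" "Cod K t = Dom K r" "r \<odot> t = x" "k \<odot> t = s"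
      by (rule pullback_map[OF Q, of x s]) (use a s p(1-8) q(1-8) in simp_all)
    show "\<exists>t. t \<in> Loose K \<and> Dom K t = Dom K x \<and> Cod K t = Dom K r \<and> r \<odot> t = x \<and> (h \<odot> k) \<odot> t = y"
      using t s p(1-8) q(1-8) by (intro exI[of _ t]) simp
  next
    fix t t' assume a: "t \<in> Loose K" "t' \<in> Loose K" "Dom K t = Dom K t'" "Cod K t = Dom K r"
      "Cod K t' = Dom K r" and b: "r \<odot> t = r \<odot> t'" "(h \<odot> k) \<odot> t = (h \<odot> k) \<odot> t'"
    have "q \<odot> (k \<odot> t) = q \<odot> (k \<odot> t')"
      using Comp_extend[OF q(9), of t] Comp_extend[OF q(9), of t'] a b q(1-8) by simp
    moreover have "h \<odot> (k \<odot> t) = h \<odot> (k \<odot> t')" using a b p(1-8) q(1-8) by simp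
    ultimately have "k \<odot> t = k \<odot> t'"
      by (rule pullback_map_eq[OF P, rotated -2]) (use a p(1-8) q(1-8) in simp_all)
    then show "t = t'" by (rule pullback_map_eq[OF Q, rotated -1]) (use a b in simp_all)
  next
    fix \<phi> \<psi> assume a: "\<phi> \<in> Cell K" "\<psi> \<in> Cell K" "Dom K (Src K \<psi>) = Dom K (Src K \<phi>)"
      "Cod K (Src K \<phi>) = Cod K r" "Cod K (Src K \<psi>) = Cod K (h \<odot> k)" "p \<lhd> \<psi> = (b \<odot> c) \<lhd> \<phi>"
    obtain s where s: "s \<in> Cell K" "Dom K (Src K s) = Dom K (Src K \<phi>)" "Cod K (Src K s) = Dom K q"
      "q \<lhd> s = c \<lhd> \<phi>" "h \<lhd> s = \<psi>"
      by (rule pullback_cell[OF P, of "c \<lhd> \<phi>" \<psi>]) (use a p(1-8) q(1-8) in simp_all)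
    obtain t where t: "t \<in> Cell K" "Dom K (Src K t) = Dom K (Src K \<phi>)" "Cod K (Src K t) = Dom K r"
      "r \<lhd> t = \<phi>" "k \<lhd> t = s"
      by (rule pullback_cell[OF Q, of \<phi> s]) (use a s p(1-8) q(1-8) in simp_all)
    have "(h \<odot> k) \<lhd> t = \<psi>"
      using Hcomp_Id2_merge[of k h t] t s p(1-8) q(1-8) by simp
    then show "\<exists>\<chi>. \<chi> \<in> Cell K \<and> Dom K (Src K \<chi>) = Dom K (Src K \<phi>) \<and> Cod K (Src K \<chi>) = Dom K r \<and>
        r \<lhd> \<chi> = \<phi> \<and> (h \<odot> k) \<lhd> \<chi> = \<psi>"
      using t by blast
  next
    fix t t' assume a: "t \<in> Cell K" "t' \<in> Cell K" "Dom K (Src K t) = Dom K (Src K t')"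
      "Cod K (Src K t) = Dom K r" "Cod K (Src K t') = Dom K r"
      and b: "r \<lhd> t = r \<lhd> t'" "(h \<odot> k) \<lhd> t = (h \<odot> k) \<lhd> t'"
    have "c \<lhd> (r \<lhd> t) = c \<lhd> (r \<lhd> t')" by (simp only: b)
    then have "q \<lhd> (k \<lhd> t) = q \<lhd> (k \<lhd> t')" using a q by simp
    moreover have "h \<lhd> (k \<lhd> t) = h \<lhd> (k \<lhd> t')" using a b p(1-8) q(1-8) by simp
    ultimately have "k \<lhd> t = k \<lhd> t'"
      by (rule pullback_cell_eq[OF P, rotated -2]) (use a p(1-8) q(1-8) in simp_all)
    then show "t = t'" by (rule pullback_cell_eq[OF Q, rotated -1]) (use a b in simp_all)
  qed
qed

lemma opfibration_lift:
  assumes "tight_discrete_opfibration K p" "p \<in> Loose K" "e \<in> Loose K" "Cod K e = Dom K p"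
    "\<phi> \<in> Cell K" "Src K \<phi> = p \<odot> e"
  obtains l where "l \<in> Cell K" "Src K l = e" "p \<lhd> l = \<phi>"
proof -
  have "Dom K (Tgt K \<phi>) = Dom K e" "Cod K (Tgt K \<phi>) = Cod K p"
    using assms by simp_all
  then have "\<exists>!l. l \<in> Cell K \<and> Src K l = e \<and> p \<lhd> l = \<phi>"
    using assms(1)[unfolded tight_discrete_opfibration_def, THEN conjunct2, rule_format,
      of e "Dom K e" "Tgt K \<phi>" \<phi>] assms by (simp add: in_hom in_cells)
  then show ?thesis using that by blast
qed

lemma opfibration_unique_lifts:
  assumes "tight_discrete_opfibration K p" "p \<in> Loose K"
  shows "unique_lifts K p"
  unfolding unique_lifts_def
proof (intro conjI allI impI)
  fix l l' assume a: "l \<in> Cell K" "l' \<in> Cell K" "Cod K (Src K l) = Dom K p" "Src K l = Src K l'"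
    "p \<lhd> l = p \<lhd> l'"
  have "\<exists>!k. k \<in> Cell K \<and> Src K k = Src K l \<and> p \<lhd> k = p \<lhd> l"
    using assms(1)[unfolded tight_discrete_opfibration_def, THEN conjunct2, rule_format,
      of "Src K l" "Dom K (Src K l)" "p \<odot> Tgt K l" "p \<lhd> l"] assms a(1,3)
        by (simp add: in_hom in_cells)
  then show "l = l'" using a by metis
qed fact

lemma unique_liftsD:
  assumes "unique_lifts K p" "l \<in> Cell K" "l' \<in> Cell K" "Src K l = e" "Src K l' = e"
    "Cod K e = Dom K p"
    "p \<lhd> l = p \<lhd> l'"
  shows "l = l'"
  using assms(1)[unfolded unique_lifts_def, THEN conjunct2, rule_format, of l l'] assms(2-) by simp

text \<open>Two lifts along \<open>q\<close> of the same 2-cell become lifts along \<open>p\<close> of the same 2-cell after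
  composing with \<open>h\<close>, so their images under both projections agree.\<close>

lemma unique_lifts_pullback:
  assumes p: "unique_lifts K p" and P: "is_pullback K p b q h"
  shows "unique_lifts K q"
  unfolding unique_lifts_def
proof (intro conjI allI impI)
  note t = pullback_typing[OF P]
  show "q \<in> Loose K" by (fact t)
  fix l l' assume a: "l \<in> Cell K" "l' \<in> Cell K" "Cod K (Src K l) = Dom K q" "Src K l = Src K l'"
    "q \<lhd> l = q \<lhd> l'"
  have "b \<lhd> (q \<lhd> l) = b \<lhd> (q \<lhd> l')" by (simp only: a(5))
  then have "(p \<odot> h) \<lhd> l = (p \<odot> h) \<lhd> l'" using a(1-4) t by simp
  then have "p \<lhd> (h \<lhd> l) = p \<lhd> (h \<lhd> l')" using a(1-4) t(1-8) by simp
  then have "h \<lhd> l = h \<lhd> l'"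
    by (rule unique_liftsD[OF p, of _ _ "h \<odot> Src K l", rotated -1]) (use a t(1-8) in simp_all)
  then show "l = l'" by (rule pullback_cell_eq[OF P, rotated -1]) (use a t(1-8) in simp_all)
qed

end

section \<open>Pullback squares over the classifier are initial\<close>

context two_category
begin

text \<open>The universal property of a classifier speaks of 2-cells into \<open>d u \<circ> t\<close> rather than into \<open>t\<close>;
  the isomorphism of \<open>d u\<close> with the identity removes that detour.\<close>

lemma initial_1cell_up_to_iso_Id1:
  assumes s: "s \<in> Loose K" "Cod K s = u" and i: "\<iota> \<in> cells K r (Id1 K u)" "invertible_cell K \<iota>"
    and ex: "\<And>t. t \<in> hom K (Dom K s) u \<Longrightarrow> \<exists>!\<phi>. \<phi> \<in> cells K s (r \<odot> t)"
  shows "initial_1cell K s"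
proof -
  have u: "u \<in> Obj K" using s by auto
  have i': "\<iota> \<in> Cell K" "Src K \<iota> = r" "Tgt K \<iota> = Id1 K u" using i by (auto simp: in_cells)
  have r: "r \<in> Loose K" "Dom K r = u" "Cod K r = u"
    using i' Src_Loose[of \<iota>] Dom_Tgt[of \<iota>] Cod_Tgt[of \<iota>] u by simp_all
  have "\<exists>!\<phi>. \<phi> \<in> cells K s t" if t: "t \<in> hom K (Dom K s) u" for t
  proof -
    have t': "t \<in> Loose K" "Dom K t = Dom K s" "Cod K t = u" using t by (auto simp: in_hom)
    obtain \<phi> where p: "\<phi> \<in> cells K s (r \<odot> t)" and uniq: "\<And>\<psi>. \<psi> \<in> cells K s (r \<odot> t) \<Longrightarrow> \<psi> = \<phi>"
      using ex[OF t] by blast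
    have p': "\<phi> \<in> Cell K" "Src K \<phi> = s" "Tgt K \<phi> = r \<odot> t" using p by (auto simp: in_cells)
    obtain \<kappa> where k: "\<kappa> \<in> cells K (Id1 K u) r" "\<iota> \<cdot> \<kappa> = Id2 K (Id1 K u)"
      using invertible_cellE[OF i(2,1)] .
    have k': "\<kappa> \<in> Cell K" "Src K \<kappa> = Id1 K u" "Tgt K \<kappa> = r" using k by (auto simp: in_cells)
    show ?thesis
    proof (rule ex1I)
      show "(\<iota> \<rhd> t) \<cdot> \<phi> \<in> cells K s t" using p' i' t' r by (simp add: in_cells)
      fix \<theta> assume "\<theta> \<in> cells K s t"
      then have th: "\<theta> \<in> Cell K" "Src K \<theta> = s" "Tgt K \<theta> = t" by (auto simp: in_cells)
      have "(\<kappa> \<rhd> t) \<cdot> \<theta> = \<phi>" by (rule uniq) (use th k' t' r u in \<open>simp add: in_cells\<close>)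
      then have "(\<iota> \<rhd> t) \<cdot> \<phi> = (\<iota> \<rhd> t) \<cdot> ((\<kappa> \<rhd> t) \<cdot> \<theta>)" by (simp only:)
      also have "\<dots> = ((\<iota> \<rhd> t) \<cdot> (\<kappa> \<rhd> t)) \<cdot> \<theta>" using th k' t' r u i' by simp
      also have "(\<iota> \<rhd> t) \<cdot> (\<kappa> \<rhd> t) = (\<iota> \<cdot> \<kappa>) \<rhd> t"
        using k' t' r u i' by (subst whisker_right_Vcomp) simp_all
      also have "\<dots> \<cdot> \<theta> = \<theta>" unfolding k(2) using th t' u by simp
      finally show "\<theta> = (\<iota> \<rhd> t) \<cdot> \<phi>" by simp
    qed
  qed
  then show ?thesis using s by (simp add: initial_1cell_def)
qed

lemma compatible_pair_cells:
  assumes "is_square K (Square p q x y)" "is_square K (Square p q x' y')"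
  shows "compatible_pair K q p x x' y y' (\<gamma>\<^sub>1, \<gamma>) \<longleftrightarrow>
    SquareCell (Square p q x y) (Square p q x' y') \<gamma>\<^sub>1 \<gamma>
      \<in> cells (arrow_2cat K) (Square p q x y) (Square p q x' y')"
  using assms by (simp add: in_cells is_square_cell_def)

lemma square_cell_cases:
  assumes "\<gamma> \<in> cells (arrow_2cat K) s t"
  shows "\<gamma> = SquareCell s t (sc_top \<gamma>) (sc_bot \<gamma>)"
    "sc_top \<gamma> \<in> cells K (sq_top s) (sq_top t)" "sc_bot \<gamma> \<in> cells K (sq_bot s) (sq_bot t)"
    "sq_cod s \<lhd> sc_top \<gamma> = sc_bot \<gamma> \<rhd> sq_dom s"
    "is_square K s" "is_square K t" "sq_dom t = sq_dom s" "sq_cod t = sq_cod s"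
  using assms unfolding in_cells[of \<gamma>]
  by (auto simp: is_square_cell_def compatible_pair_def square_cell.expand)

lemma invertible_square_cell:
  assumes g: "\<gamma> \<in> cells (arrow_2cat K) s t"
    and i: "invertible_cell K (sc_top \<gamma>)" "invertible_cell K (sc_bot \<gamma>)"
  shows "invertible_cell (arrow_2cat K) \<gamma>"
proof -
  interpret L: two_category "arrow_2cat K" by (rule two_category_arrow)
  note c = square_cell_cases[OF g]
  have c': "sc_top \<gamma> \<in> Cell K" "Src K (sc_top \<gamma>) = sq_top s" "Tgt K (sc_top \<gamma>) = sq_top t"
    "sc_bot \<gamma> \<in> Cell K" "Src K (sc_bot \<gamma>) = sq_bot s" "Tgt K (sc_bot \<gamma>) = sq_bot t"
    using c(2,3) by (auto simp: in_cells)
  have ty: "sq_cod s \<in> Loose K" "sq_dom s \<in> Loose K" "Cod K (sq_top s) = Dom K (sq_cod s)"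
    "Dom K (sq_bot s) = Cod K (sq_dom s)" "Cod K (sq_top t) = Dom K (sq_cod s)"
    "Dom K (sq_bot t) = Cod K (sq_dom s)" "sq_top s \<in> Loose K" "sq_bot s \<in> Loose K"
    "sq_top t \<in> Loose K" "sq_bot t \<in> Loose K"
    using c(5,6) by (simp_all add: is_square_def in_hom c(7,8))
  obtain \<phi> where f: "\<phi> \<in> Cell K" "Src K \<phi> = sq_top t" "Tgt K \<phi> = sq_top s"
    "\<phi> \<cdot> sc_top \<gamma> = Id2 K (sq_top s)" "sc_top \<gamma> \<cdot> \<phi> = Id2 K (sq_top t)"
    using invertible_cellE[OF i(1) c(2)] by (auto simp: in_cells)
  obtain \<psi> where g: "\<psi> \<in> Cell K" "Src K \<psi> = sq_bot t" "Tgt K \<psi> = sq_bot s"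
    "\<psi> \<cdot> sc_bot \<gamma> = Id2 K (sq_bot s)" "sc_bot \<gamma> \<cdot> \<psi> = Id2 K (sq_bot t)"
    using invertible_cellE[OF i(2) c(3)] by (auto simp: in_cells)
  have eqs: "sq_cod s \<odot> sq_top s = sq_bot s \<odot> sq_dom s" "sq_cod s \<odot> sq_top t = sq_bot t \<odot> sq_dom s"
    using c(5,6) by (simp_all add: is_square_def c(7,8))
  \<comment> \<open>The inverses are compatible because \<open>(\<psi> \<rhd> p)\<close> is inverse to \<open>\<gamma> \<rhd> p = q \<lhd> \<gamma>\<^sub>1\<close>.\<close>
  have "sq_cod s \<lhd> \<phi> = ((\<psi> \<cdot> sc_bot \<gamma>) \<rhd> sq_dom s) \<cdot> (sq_cod s \<lhd> \<phi>)"
    unfolding g(4) using ty f eqs by simp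
  also have "(\<psi> \<cdot> sc_bot \<gamma>) \<rhd> sq_dom s = (\<psi> \<rhd> sq_dom s) \<cdot> (sq_cod s \<lhd> sc_top \<gamma>)"
    unfolding c(4) using ty g(1-3) c' by simp
  also have "\<dots> \<cdot> (sq_cod s \<lhd> \<phi>) = (\<psi> \<rhd> sq_dom s) \<cdot> ((sq_cod s \<lhd> sc_top \<gamma>) \<cdot> (sq_cod s \<lhd> \<phi>))"
    using ty g(1-3) c' f(1-3) eqs by simp
  also have "(sq_cod s \<lhd> sc_top \<gamma>) \<cdot> (sq_cod s \<lhd> \<phi>) = sq_cod s \<lhd> (sc_top \<gamma> \<cdot> \<phi>)"
    using ty c' f(1-3) by (subst whisker_left_Vcomp) simp_all
  also have "(\<psi> \<rhd> sq_dom s) \<cdot> \<dots> = \<psi> \<rhd> sq_dom s"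
    unfolding f(5) using ty g(1-3) eqs by simp
  finally have e: "sq_cod s \<lhd> \<phi> = \<psi> \<rhd> sq_dom s" .
  show ?thesis
  proof (rule L.invertible_cellI[OF assms(1), of "SquareCell t s \<phi> \<psi>"])
    show "SquareCell t s \<phi> \<psi> \<in> cells (arrow_2cat K) t s"
      using e f(1-3) g(1-3) c(5-8) by (simp add: in_cells is_square_cell_def compatible_pair_def)
  qed (use f g c(1) in \<open>simp_all, (metis square_cell.sel)+\<close>)
qed

lemma invertible_square_cell_components:
  assumes "\<gamma> \<in> cells (arrow_2cat K) s t" "invertible_cell (arrow_2cat K) \<gamma>"
  shows "invertible_cell K (sc_top \<gamma>)" "invertible_cell K (sc_bot \<gamma>)"
proof -
  interpret L: two_category "arrow_2cat K" by (rule two_category_arrow)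
  obtain \<delta> where d: "\<delta> \<in> cells (arrow_2cat K) t s" "\<delta> \<cdot>\<^bsub>arrow_2cat K\<^esub> \<gamma> = Id2 (arrow_2cat K) s"
    "\<gamma> \<cdot>\<^bsub>arrow_2cat K\<^esub> \<delta> = Id2 (arrow_2cat K) t"
    using L.invertible_cellE[OF assms(2,1)] .
  note g = square_cell_cases[OF assms(1)] and d' = square_cell_cases[OF d(1)]
  show "invertible_cell K (sc_top \<gamma>)"
    by (rule invertible_cellI[OF g(2) d'(2)]) (use d(2,3) in simp_all)
  show "invertible_cell K (sc_bot \<gamma>)"
    by (rule invertible_cellI[OF g(3) d'(3)]) (use d(2,3) in simp_all)
qed

end

context representable_plumbus
begin

abbreviation "u \<equiv> cl_u D"

abbreviation "L \<equiv> arrow_2cat K"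

definition classifying_square :: "'m \<Rightarrow> 'm square" where
  "classifying_square p = Square p u (cl_top D p) (cl_map D p)"

definition cartesian_squares :: "'m square set" where
  "cartesian_squares = {Square q u h b | q h b. is_pullback K u b q h}"

sublocale L: two_category L by (rule two_category_arrow)

lemma Small_Loose [simp]: "p \<in> Small S \<Longrightarrow> p \<in> Loose K"
  using Small_opfib Tight_Loose by (auto simp: tight_discrete_opfibration_def)

lemma u_Small [simp]: "u \<in> Small S"
  using classifier by (simp add: enhanced_2_classifier_def)

lemma classifying_pullback: "p \<in> Small S \<Longrightarrow> is_pullback K u (cl_map D p) p (cl_top D p)"
  using classifier by (simp add: enhanced_2_classifier_def)

lemma classifying_square_is_square: "p \<in> Small S \<Longrightarrow> is_square K (classifying_square p)"
  unfolding classifying_square_def by (intro pullback_square classifying_pullback)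

lemma classifier_cells:
  assumes p: "p \<in> Small S" and t: "t \<in> hom L p u"
  shows "\<exists>!\<gamma>. \<gamma> \<in> cells L (classifying_square p) (classifying_square u \<odot>\<^bsub>L\<^esub> t)"
proof -
  obtain g f where t': "t = Square p u g f" "is_square K t"
    using t by (cases t) (simp add: in_hom)
  let ?s = "classifying_square p" and ?t = "Square p u (cl_top D u \<odot> g) (cl_map D u \<odot> f)"
  have st: "classifying_square u \<odot>\<^bsub>L\<^esub> t = ?t"
    by (simp add: t' sq_comp_def classifying_square_def)
  have sq: "is_square K ?s" "is_square K ?t"
    using L.Comp_simps(1)[of t "classifying_square u"] t classifying_square_is_square p
    by (simp_all add: in_hom st t'(1) classifying_square_def sq_comp_def)
  have gf: "g \<in> hom K (Dom K p) (Dom K u)" "f \<in> hom K (Cod K p) (Cod K u)" "u \<odot> g = f \<odot> p"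
    using t' by (simp_all add: is_square_def)
  have "\<exists>!\<gamma>s. compatible_pair K u p (cl_top D p) (cl_top D u \<odot> g) (cl_map D p) (cl_map D u \<odot> f) \<gamma>s"
    using classifier[unfolded enhanced_2_classifier_def, THEN conjunct2, THEN conjunct2, THEN
        conjunct1,
      rule_format, OF p u_Small gf] .
  then obtain \<gamma>1 \<gamma>0 where c: "compatible_pair K u p (cl_top D p) (cl_top D u \<odot> g) (cl_map D p)
      (cl_map D u \<odot> f) (\<gamma>1, \<gamma>0)"
    and uniq: "\<And>\<delta>1 \<delta>0. compatible_pair K u p (cl_top D p) (cl_top D u \<odot> g) (cl_map D p)
        (cl_map D u \<odot> f) (\<delta>1, \<delta>0)
      \<Longrightarrow> \<delta>1 = \<gamma>1 \<and> \<delta>0 = \<gamma>0"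
    by (metis prod.exhaust prod.inject)
  note cp = compatible_pair_cells[of p u "cl_top D p" "cl_map D p" "cl_top D u \<odot> g" "cl_map D u \<odot>
      f",
      folded classifying_square_def, OF sq]
  show ?thesis
    unfolding st
  proof (rule ex1I)
    show "SquareCell ?s ?t \<gamma>1 \<gamma>0 \<in> cells L ?s ?t" using c cp by blast
    fix \<delta> assume d: "\<delta> \<in> cells L ?s ?t"
    note d' = square_cell_cases(1)[OF d]
    have "compatible_pair K u p (cl_top D p) (cl_top D u \<odot> g) (cl_map D p) (cl_map D u \<odot> f)
        (sc_top \<delta>, sc_bot \<delta>)"
      using d d' cp by metis
    then show "\<delta> = SquareCell ?s ?t \<gamma>1 \<gamma>0" using uniq d' by metis
  qed
qed

lemma classifier_Id_iso:
  obtains \<iota> where "\<iota> \<in> cells L (classifying_square u) (Id1 L u)" "invertible_cell L \<iota>"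
proof -
  obtain \<iota>1 \<iota>0 where i: "compatible_pair K u u (cl_top D u) (Id1 K (Dom K u)) (cl_map D u)
      (Id1 K (Cod K u)) (\<iota>1, \<iota>0)"
    "invertible_cell K \<iota>1" "invertible_cell K \<iota>0"
    using classifier[unfolded enhanced_2_classifier_def, THEN conjunct2, THEN conjunct2, THEN
        conjunct2, THEN conjunct2]
    by blast
  have sq: "is_square K (Square u u (Id1 K (Dom K u)) (Id1 K (Cod K u)))"
    using L.Id1_simps(1)[of u] by simp
  have c: "SquareCell (classifying_square u) (Id1 L u) \<iota>1 \<iota>0 \<in> cells L (classifying_square u)
      (Id1 L u)"
    using compatible_pair_cells[of u u "cl_top D u" "cl_map D u", folded classifying_square_def,
        OF classifying_square_is_square[OF u_Small] sq] i by simp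
  show ?thesis by (rule that[OF c]) (rule invertible_square_cell[OF c], use i in simp_all)
qed

lemma classifying_square_initial:
  assumes "p \<in> Small S"
  shows "initial_1cell L (classifying_square p)"
proof -
  obtain \<iota> where "\<iota> \<in> cells L (classifying_square u) (Id1 L u)" "invertible_cell L \<iota>"
    by (rule classifier_Id_iso)
  then show ?thesis
    using classifying_square_is_square[OF assms] classifier_cells[OF assms]
    by (intro L.initial_1cell_up_to_iso_Id1[where u=u]) (simp_all add: classifying_square_def)
qed

text \<open>The comparison from the classifying square, which is initial, is invertible by the clause on
  pullback squares in the definition of a classifier.\<close>

lemma small_pullback_initial:
  assumes p: "p \<in> Small S" and P: "is_pullback K u b p h"
  shows "initial_1cell L (Square p u h b)"
proof -
  let ?s = "Square p u h b"
  have s: "?s \<in> hom L p u" using pullback_square[OF P] by (simp add: in_hom)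
  obtain \<gamma> where g: "\<gamma> \<in> cells L (classifying_square p) (classifying_square u \<odot>\<^bsub>L\<^esub> ?s)"
    using classifier_cells[OF p s] by blast
  note g' = square_cell_cases[OF g]
  have "compatible_pair K u p (cl_top D p) (cl_top D u \<odot> h) (cl_map D p) (cl_map D u \<odot> b)
      (sc_top \<gamma>, sc_bot \<gamma>)"
    using g'(2-4) by (simp add: compatible_pair_def classifying_square_def sq_comp_def)
  then have "invertible_cell K (sc_top \<gamma>)" "invertible_cell K (sc_bot \<gamma>)"
    using classifier[unfolded enhanced_2_classifier_def, THEN conjunct2, THEN conjunct2, THEN
        conjunct2,
      THEN conjunct1, rule_format, OF p u_Small P] by blast+
  then have inv: "invertible_cell L \<gamma>" by (rule invertible_square_cell[OF g])
  obtain \<iota> where i: "\<iota> \<in> cells L (classifying_square u) (Id1 L u)" "invertible_cell L \<iota>"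
    by (rule classifier_Id_iso)
  have c: "\<iota> \<in> Cell L" "Src L \<iota> = classifying_square u" "Tgt L \<iota> = Id1 L u"
    "\<gamma> \<in> Cell L" "Src L \<gamma> = classifying_square p" "Tgt L \<gamma> = classifying_square u \<odot>\<^bsub>L\<^esub> ?s"
    using i(1) g unfolding in_cells by blast+
  have cs: "Cod L ?s = Dom L (classifying_square u)" "?s \<in> Loose L"
    using s by (simp_all add: in_hom classifying_square_def)
  have "invertible_cell L (\<iota> \<rhd>\<^bsub>L\<^esub> ?s)"
    by (rule L.invertible_whisker_right[OF i(2) cs(2)]) (simp only: c cs)
  moreover have "\<iota> \<rhd>\<^bsub>L\<^esub> ?s \<in> cells L (classifying_square u \<odot>\<^bsub>L\<^esub> ?s) ?s"
    using L.Hcomp_simps[of "Id2 L ?s" \<iota>] L.Id2_simps[OF cs(2)] L.Comp_Id1(2)[OF cs(2), of u] c cs s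
    unfolding in_cells in_hom by metis
  ultimately show ?thesis
    using L.initial_1cell_iso[OF L.initial_1cell_iso[OF classifying_square_initial[OF p] inv g]]
    by blast
qed

text \<open>Initiality passes from the chosen pullback of \<open>u\<close> along \<open>b\<close>, which is small, to any other
  pullback \<open>q\<close> along the isomorphism between them. This is applied to 1-cells such as \<open>T p\<close>.\<close>

lemma cartesian_squares_initial:
  assumes P: "is_pullback K u b q h"
  shows "initial_1cell L (Square q u h b)"
proof -
  define p k where "p = Pb S u b" and "k = PbTop S u b"
  note t = pullback_typing[OF P]
  have "left_tight_pullback K u b p k"
    unfolding p_def k_def
    by (rule Pb_pullback[OF u_Small, of b "Dom K b"]) (use t in \<open>simp add: in_hom\<close>)
  then have p: "p \<in> Small S" and Q: "is_pullback K u b p k"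
    using Small_stable[OF u_Small] by (auto simp: left_tight_pullback_def)
  note r = pullback_typing[OF Q]
  obtain i where i: "i \<in> Loose K" "Dom K i = Dom K q" "Cod K i = Dom K p" "p \<odot> i = q" "k \<odot> i = h"
    by (rule pullback_map[OF Q, of q h]) (use t r in simp_all)
  obtain j where j: "j \<in> Loose K" "Dom K j = Dom K p" "Cod K j = Dom K q" "q \<odot> j = p" "h \<odot> j = k"
    by (rule pullback_map[OF P, of p k]) (use t r in simp_all)
  have ij: "i \<odot> j = Id1 K (Dom K p)"
    by (rule pullback_map_eq[OF Q])
      (use i j r Comp_extend[OF i(4), of j] Comp_extend[OF i(5), of j] in simp_all)
  have ji: "j \<odot> i = Id1 K (Dom K q)"
    by (rule pullback_map_eq[OF P])
      (use i j t r Comp_extend[OF j(4), of i] Comp_extend[OF j(5), of i] in simp_all)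
  let ?i = "Square q p i (Id1 K (Cod K q))" and ?j = "Square p q j (Id1 K (Cod K p))"
  have c: "Cod K p = Cod K q" using r t by simp
  have "initial_1cell L (Square p u k b \<odot>\<^bsub>L\<^esub> ?i)"
  proof (rule L.initial_1cell_precomp_iso[OF small_pullback_initial[OF p Q], of _ q ?j])
    show "?i \<in> hom L q (Dom L (Square p u k b))" "?j \<in> hom L (Dom L (Square p u k b)) q"
      using i j t(1-8) r(1-8) c by (simp_all add: in_hom is_square_def)
    show "?i \<odot>\<^bsub>L\<^esub> ?j = Id1 L (Dom L (Square p u k b))" "?j \<odot>\<^bsub>L\<^esub> ?i = Id1 L q"
      using ij ji c t by (simp_all add: sq_comp_def)
  qed
  moreover have "Square p u k b \<odot>\<^bsub>L\<^esub> ?i = Square q u h b"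
    using i t by (simp add: sq_comp_def)
  ultimately show ?thesis by simp
qed

text \<open>Functoriality of the chosen pullbacks makes \<open>u\<close> its own chosen pullback along the identity.
  Hence \<open>u\<close> detects tightness, which makes \<open>\<omega>\<^sub>\<bullet>\<close> tight.\<close>

lemma u_left_tight: "left_tight_pullback K u (Id1 K (Cod K u)) u (Id1 K (Dom K u))"
  using Pb_pullback[OF u_Small, of "Id1 K (Cod K u)" "Cod K u"] Pb_Id1[OF u_Small]
      PbTop_Id1[OF u_Small]
  by (simp add: in_hom)

text \<open>The link between the definite descriptions of structure cells as pairs and the initial
  cells of the arrow 2-category.\<close>

lemma THE_compatible_pair:
  assumes i: "initial_1cell L (Square p u x y)" and t: "is_square K (Square p u x' y')"
  shows "(THE \<gamma>s. compatible_pair K u p x x' y y' \<gamma>s) =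
    (sc_top (initial_cell L (Square p u x y) (Square p u x' y')),
     sc_bot (initial_cell L (Square p u x y) (Square p u x' y')))"
proof (rule the_equality)
  let ?s = "Square p u x y" and ?t = "Square p u x' y'"
  have s: "is_square K ?s" using i by (simp add: initial_1cell_def)
  note cp = compatible_pair_cells[OF s t]
  have c: "initial_cell L ?s ?t \<in> cells L ?s ?t"
    by (rule L.initial_cell_in[OF i]) (use t in \<open>simp add: in_hom\<close>)
  show "compatible_pair K u p x x' y y' (sc_top (initial_cell L ?s ?t), sc_bot (initial_cell L ?s
      ?t))"
    using c square_cell_cases(1)[OF c] cp by metis
  fix \<gamma>s assume "compatible_pair K u p x x' y y' \<gamma>s"
  then have "SquareCell ?s ?t (fst \<gamma>s) (snd \<gamma>s) \<in> cells L ?s ?t" using cp by (metis prod.collapse)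
  then have "initial_cell L ?s ?t = SquareCell ?s ?t (fst \<gamma>s) (snd \<gamma>s)"
    by (rule L.initial_cell_eq[OF i])
  then show "\<gamma>s = (sc_top (initial_cell L ?s ?t), sc_bot (initial_cell L ?s ?t))" by simp
qed

end

section \<open>The comparison map\<close>

context two_category
begin

text \<open>An invertible 2-cell \<open>j \<delta> \<Rightarrow> id\<close> can be corrected so that \<open>q \<delta>\<close> sends it to an identity; lifts
  along \<open>q \<delta>\<close> being unique, the corrected 2-cell is itself an identity.\<close>

lemma split_equivalence_over_unique_lifts:
  assumes r: "unique_lifts K (q \<odot> \<delta>)" and q: "q \<in> Loose K" "Cod K \<delta> = Dom K q"
    and d: "split_equivalence K \<delta>"
  obtains j where "j \<in> hom K (Cod K \<delta>) (Dom K \<delta>)" "\<delta> \<odot> j = Id1 K (Cod K \<delta>)"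
  "j \<odot> \<delta> = Id1 K (Dom K \<delta>)"
proof -
  obtain j e where j: "j \<in> hom K (Cod K \<delta>) (Dom K \<delta>)" "\<delta> \<odot> j = Id1 K (Cod K \<delta>)"
    and e: "e \<in> cells K (j \<odot> \<delta>) (Id1 K (Dom K \<delta>))" "invertible_cell K e" and dl: "\<delta> \<in> Loose K"
    using d by (auto simp: split_equivalence_def)
  have e': "e \<in> Cell K" "Src K e = j \<odot> \<delta>" "Tgt K e = Id1 K (Dom K \<delta>)" using e
    by (auto simp: in_cells)
  have j': "j \<in> Loose K" "Dom K j = Cod K \<delta>" "Cod K j = Dom K \<delta>" using j by (auto simp: in_hom)
  have djx: "\<delta> \<odot> (j \<odot> x) = x" if "x \<in> Loose K" "Cod K x = Cod K \<delta>" for x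
    using Comp_extend[OF j(2), of x] j' dl that by simp
  obtain g where g: "g \<in> Cell K" "Src K g = Id1 K (Dom K \<delta>)" "Tgt K g = j \<odot> \<delta>"
    "e \<cdot> g = Id2 K (Id1 K (Dom K \<delta>))"
    using invertible_cellE[OF e(2,1)] by (auto simp: in_cells)
  define g' where "g' = (j \<odot> \<delta>) \<lhd> g"
  have g': "g' \<in> Cell K" "Src K g' = j \<odot> \<delta>" "Tgt K g' = j \<odot> \<delta>"
    using g j' dl by (simp_all add: g'_def djx)
  \<comment> \<open>Correcting the counit by the inverse of \<open>j \<delta> e\<close> makes its image under \<open>\<delta>\<close> an identity.\<close>
  define e1 where "e1 = e \<cdot> g'"
  have e1: "e1 \<in> Cell K" "Src K e1 = j \<odot> \<delta>" "Tgt K e1 = Id1 K (Dom K \<delta>)"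
    using e' g' by (simp_all add: e1_def)
  have jd: "(\<delta> \<odot> (j \<odot> \<delta>)) = \<delta>" using djx[OF dl] by simp
  have "\<delta> \<lhd> g' = (\<delta> \<odot> (j \<odot> \<delta>)) \<lhd> g" unfolding g'_def using g j' dl by simp
  then have dg: "\<delta> \<lhd> g' = \<delta> \<lhd> g" unfolding jd .
  have "\<delta> \<lhd> e1 = (\<delta> \<lhd> e) \<cdot> (\<delta> \<lhd> g)"
    unfolding e1_def using e' g' dl j' by (simp add: dg)
  also have "\<dots> = \<delta> \<lhd> (e \<cdot> g)" using e' g(1-3) dl j' by simp
  also have "\<dots> = Id2 K \<delta>" unfolding g(4) using dl by simp
  finally have de: "\<delta> \<lhd> e1 = Id2 K \<delta>" .
  have "(q \<odot> \<delta>) \<lhd> e1 = q \<lhd> (\<delta> \<lhd> e1)" using q dl e1 j' by simp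
  also have "\<dots> = Id2 K (q \<odot> \<delta>)" unfolding de using q dl by simp
  also have "\<dots> = (q \<odot> \<delta>) \<lhd> Id2 K (j \<odot> \<delta>)" using q dl j' jd by simp
  finally have "e1 = Id2 K (j \<odot> \<delta>)"
    by (rule unique_liftsD[OF r, of _ _ "j \<odot> \<delta>", rotated -1]) (use q dl e1 j' in simp_all)
  then have "j \<odot> \<delta> = Id1 K (Dom K \<delta>)" using e1(3) j' dl by simp
  then show thesis using j that by blast
qed

text \<open>Here \<open>r\<close> and \<open>q\<close> are pullbacks of \<open>u\<close> along \<open>b\<^sub>0\<close> and \<open>b\<^sub>1\<close>, and \<open>\<gamma> : b\<^sub>0 \<cong> b\<^sub>1\<close>. The inverse
  of \<open>\<delta>\<close> is classified by the target of the lift of \<open>\<gamma>\<^sup>-\<^sup>1 q\<close> along \<open>u\<close> at \<open>h\<^sub>1\<close>. Both composites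
  are identities because composing this lift with \<open>\<gamma>\<^sub>1\<close>, in either order, gives a lift of an
  identity.\<close>

lemma invertible_bottom_gives_inverse:
  assumes u: "tight_discrete_opfibration K u" "u \<in> Loose K"
    and R: "is_pullback K u b\<^sub>0 r h\<^sub>0" and Q: "is_pullback K u b\<^sub>1 q h\<^sub>1"
    and d: "\<delta> \<in> Loose K" "Dom K \<delta> = Dom K r" "Cod K \<delta> = Dom K q" "q \<odot> \<delta> = r"
    and g: "\<gamma>\<^sub>1 \<in> cells K h\<^sub>0 (h\<^sub>1 \<odot> \<delta>)" "\<gamma> \<in> cells K b\<^sub>0 b\<^sub>1" "u \<lhd> \<gamma>\<^sub>1 = \<gamma> \<rhd> r"
    "invertible_cell K \<gamma>"
  obtains j where "j \<in> hom K (Dom K q) (Dom K r)" "\<delta> \<odot> j = Id1 K (Dom K q)"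
  "j \<odot> \<delta> = Id1 K (Dom K r)"
proof -
  note ul = opfibration_unique_lifts[OF u]
  note tr = pullback_typing[OF R] and tq = pullback_typing[OF Q]
  have g': "\<gamma>\<^sub>1 \<in> Cell K" "Src K \<gamma>\<^sub>1 = h\<^sub>0" "Tgt K \<gamma>\<^sub>1 = h\<^sub>1 \<odot> \<delta>"
    "\<gamma> \<in> Cell K" "Src K \<gamma> = b\<^sub>0" "Tgt K \<gamma> = b\<^sub>1"
    using g by (auto simp: in_cells)
  obtain \<psi> where p: "\<psi> \<in> Cell K" "Src K \<psi> = b\<^sub>1" "Tgt K \<psi> = b\<^sub>0"
    "\<psi> \<cdot> \<gamma> = Id2 K b\<^sub>0" "\<gamma> \<cdot> \<psi> = Id2 K b\<^sub>1"
    using invertible_cellE[OF g(4,2)] by (auto simp: in_cells)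
  have cd: "Dom K b\<^sub>1 = Dom K b\<^sub>0" "Cod K q = Dom K b\<^sub>0"
    using tq(6) Dom_Tgt[OF g'(4)] unfolding g'(5,6) by simp_all
  obtain l where l: "l \<in> Cell K" "Src K l = h\<^sub>1" "u \<lhd> l = \<psi> \<rhd> q"
    by (rule opfibration_lift[OF u, of h\<^sub>1 "\<psi> \<rhd> q"]) (use tq tr(1-8) p(1-3) cd in simp_all)
  have "Tgt K (u \<lhd> l) = Tgt K (\<psi> \<rhd> q)" by (simp only: l)
  then have ly: "u \<odot> Tgt K l = b\<^sub>0 \<odot> q" using l(1,2) tq(1-8) tr(1-8) p(1-3) cd u by simp
  obtain j where j: "j \<in> Loose K" "Dom K j = Dom K q" "Cod K j = Dom K r" "r \<odot> j = q"
    "h\<^sub>0 \<odot> j = Tgt K l"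
    by (rule pullback_map[OF R, of q "Tgt K l"]) (use l(1,2) ly tq(1-8) tr(1-8) cd in simp_all)
  have qdx: "q \<odot> (\<delta> \<odot> x) = r \<odot> x" if "x \<in> Loose K" "Cod K x = Dom K r" for x
    using Comp_extend[OF d(4), of x] d tq that by simp
  have lt: "Tgt K l = h\<^sub>0 \<odot> j" using j by simp
  have dh: "Dom K h\<^sub>0 = Dom K r" "Cod K h\<^sub>0 = Dom K u" using tr(7,8) by simp_all
  have "u \<lhd> ((\<gamma>\<^sub>1 \<rhd> j) \<cdot> l) = (u \<lhd> (\<gamma>\<^sub>1 \<rhd> j)) \<cdot> (u \<lhd> l)"
    by (rule whisker_left_Vcomp) (use g' j(1-3) lt l(1,2) u tq(1-8) dh d tr(1-8) in simp_all)
  also have "u \<lhd> (\<gamma>\<^sub>1 \<rhd> j) = (\<gamma> \<rhd> r) \<rhd> j"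
    unfolding g(3)[symmetric] using g' j(1-3) u dh d tr(1-8) tq(1-8) by simp
  also have "\<dots> = \<gamma> \<rhd> q"
    using g' j tr(1-8) cd by simp
  also have "(\<gamma> \<rhd> q) \<cdot> (u \<lhd> l) = (\<gamma> \<cdot> \<psi>) \<rhd> q"
    unfolding l(3) using g' p(1-3) tq(1-8) tr(1-8) cd by simp
  also have "\<dots> = u \<lhd> Id2 K h\<^sub>1"
    unfolding p(5) using tq tr(1-8) cd by simp
  finally have "(\<gamma>\<^sub>1 \<rhd> j) \<cdot> l = Id2 K h\<^sub>1"
    by (rule unique_liftsD[OF ul, of _ _ "h\<^sub>1", rotated -1])
      (use g' j(1-3) lt l(1,2) u tq(1-8) dh d tr(1-8) in simp_all)
  then have "Tgt K ((\<gamma>\<^sub>1 \<rhd> j) \<cdot> l) = Tgt K (Id2 K h\<^sub>1)" by simp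
  then have hdj: "h\<^sub>1 \<odot> (\<delta> \<odot> j) = h\<^sub>1"
    using g' j(1-3) lt l(1,2) u tq(1-8) dh d by simp
  have dj: "\<delta> \<odot> j = Id1 K (Dom K q)"
    by (rule pullback_map_eq[OF Q]) (use hdj j d qdx[of j] tq(1-8) in simp_all)
  have dld: "Tgt K (l \<rhd> \<delta>) = h\<^sub>0 \<odot> (j \<odot> \<delta>)" using l(1,2) lt d j(1-3) tq(1-8) tr(1-8) dh by simp
  have "u \<lhd> ((l \<rhd> \<delta>) \<cdot> \<gamma>\<^sub>1) = (u \<lhd> (l \<rhd> \<delta>)) \<cdot> (u \<lhd> \<gamma>\<^sub>1)"
    by (rule whisker_left_Vcomp) (use g' lt l(1,2) u tq(1-8) dh d tr(1-8) in simp_all)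
  also have "u \<lhd> (l \<rhd> \<delta>) = (\<psi> \<rhd> q) \<rhd> \<delta>"
    unfolding l(3)[symmetric] using l(1,2) u d tq(1-8) by simp
  also have "\<dots> = \<psi> \<rhd> r"
    using p(1-3) d tq(1-8) tr(1-8) cd by simp
  also have "(\<psi> \<rhd> r) \<cdot> (u \<lhd> \<gamma>\<^sub>1) = (\<psi> \<cdot> \<gamma>) \<rhd> r"
    unfolding g(3) using g' p(1-3) tr(1-8) cd by simp
  also have "\<dots> = u \<lhd> Id2 K h\<^sub>0"
    unfolding p(4) using tr cd by simp
  finally have "(l \<rhd> \<delta>) \<cdot> \<gamma>\<^sub>1 = Id2 K h\<^sub>0"
    by (rule unique_liftsD[OF ul, of _ _ "h\<^sub>0", rotated -1])
      (use g' lt l(1,2) u tq(1-8) dh d tr(1-8) in simp_all)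
  then have "Tgt K ((l \<rhd> \<delta>) \<cdot> \<gamma>\<^sub>1) = Tgt K (Id2 K h\<^sub>0)" by simp
  then have hjd: "h\<^sub>0 \<odot> (j \<odot> \<delta>) = h\<^sub>0"
    using g' j(1-3) lt l(1,2) u tq(1-8) tr(1-8) dh d by simp
  have rj: "r \<odot> (j \<odot> \<delta>) = r" using Comp_extend[OF j(4), of \<delta>] d j(1-3) tr(1-8) by simp
  have "j \<odot> \<delta> = Id1 K (Dom K r)"
    by (rule pullback_map_eq[OF R]) (use hjd rj j(1-3) d tr(1-8) in simp_all)
  then show thesis using that[of j] dj j by (simp add: in_hom)
qed

lemma iso_split_equivalence:
  assumes "\<delta> \<in> Loose K" "j \<in> hom K (Cod K \<delta>) (Dom K \<delta>)" "\<delta> \<odot> j = Id1 K (Cod K \<delta>)"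
    "j \<odot> \<delta> = Id1 K (Dom K \<delta>)"
  shows "split_equivalence K \<delta>"
proof -
  have "Id2 K (Id1 K (Dom K \<delta>)) \<in> cells K (j \<odot> \<delta>) (Id1 K (Dom K \<delta>))"
    using assms by (simp add: in_cells)
  moreover have "invertible_cell K (Id2 K (Id1 K (Dom K \<delta>)))"
    using assms by (intro invertible_Id2) simp
  ultimately show ?thesis
    using assms unfolding split_equivalence_def by blast
qed

end

section \<open>The lifted classifier\<close>

locale opfibrantly_cartesian_monad = representable_plumbus K S D + enhanced_2_monad K T
  for K :: "('o, 'm, 'c, 'z) enhanced_2cat_scheme" (structure)
    and S :: "'m smallness" and D :: "'m classifier" and T :: "('o, 'm, 'c) two_monad" +
  assumes opfib_cartesian: "opfibrantly_cartesian K S D T"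
begin

abbreviation "M \<equiv> arrow_monad K T"

abbreviation "w \<equiv> classifying_square (TM T u)"

lemma Tu_Small: "TM T u \<in> Small S"
  using opfib_cartesian by (simp add: opfibrantly_cartesian_def)

text \<open>Paste the image under \<open>T\<close> of a pullback square with the classifying square of \<open>T u\<close>.\<close>

lemma cartesian_squares_step:
  assumes "s \<in> cartesian_squares"
  shows "w \<odot>\<^bsub>L\<^esub> TM M s \<in> cartesian_squares"
proof -
  obtain q h b where s: "s = Square q u h b" and P: "is_pullback K u b q h"
    using assms by (auto simp: cartesian_squares_def)
  have "is_pullback K (TM T u) (TM T b) (TM T q) (TM T h)"
    using opfib_cartesian P by (simp add: opfibrantly_cartesian_def)
  from pullback_paste[OF classifying_pullback[OF Tu_Small] this] show ?thesis
    by (auto simp: s cartesian_squares_def classifying_square_def sq_comp_def)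
qed

lemma classifying_square_cartesian: "p \<in> Small S \<Longrightarrow> classifying_square p \<in> cartesian_squares"
  using classifying_pullback by (auto simp: cartesian_squares_def classifying_square_def)

lemma w_Tight: "w \<in> Tight L"
proof -
  have b: "cl_map D (TM T u) \<in> Tight K"
    using opfib_cartesian by (simp add: opfibrantly_cartesian_def)
  note t = pullback_typing[OF classifying_pullback[OF Tu_Small]]
  have "u \<in> Tight K" using Small_opfib[OF u_Small] by (simp add: tight_discrete_opfibration_def)
  then have "u \<odot> cl_top D (TM T u) \<in> Tight K"
    unfolding t(9) using b t by (intro Comp_Tight) simp_all
  then have "cl_top D (TM T u) \<in> Tight K"
    using u_left_tight t(1-8) unfolding left_tight_pullback_def by (auto simp: in_hom)
  then show ?thesis
    using b classifying_square_is_square[OF Tu_Small] by (simp add: classifying_square_def)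
qed

sublocale A: initial_lifting L M u w cartesian_squares
proof -
  interpret enhanced_2_monad L M by (rule enhanced_2_monad_arrow)
  show "initial_lifting L M u w cartesian_squares"
  proof unfold_locales
    show "u \<in> Obj L" by simp
    show "w \<in> Tight L" by (rule w_Tight)
    show "w \<in> hom L (TO M u) u"
      using classifying_square_is_square[OF Tu_Small] by (simp add: in_hom classifying_square_def)
    show "Id1 L u \<in> cartesian_squares"
      using u_left_tight by (auto simp: cartesian_squares_def left_tight_pullback_def)
    fix s assume s: "s \<in> cartesian_squares"
    then show "w \<odot>\<^bsub>L\<^esub> TM M s \<in> cartesian_squares" by (rule cartesian_squares_step)
    show "initial_1cell L s" "Cod L s = u"
      using s by (auto simp: cartesian_squares_def cartesian_squares_initial)
  qed
qed

lemma base_alg_sel: "carr A.base_alg = u" "act A.base_alg = w"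
  by (simp_all only: A.base_alg_def lax_alg.sel)

lemma base_alg_components:
  "top_alg K A.base_alg = Omega_top_alg K D T" "bot_alg K A.base_alg = Omega_alg K D T"
proof -
  have c: "initial_1cell L (Id1 L u)" "initial_1cell L (w \<odot>\<^bsub>L\<^esub> TM M w)"
    by (intro A.C_initial A.C_Id1 A.C_step A.w_in_C)+
  have eqs: "Id1 L u = Square u u (Id1 K (Dom K u)) (Id1 K (Cod K u))"
    "w \<odot>\<^bsub>L\<^esub> eta M u = Square u u (omega_top D T \<odot> eta T (Dom K u)) (omega D T \<odot> eta T (Cod K u))"
    "w \<odot>\<^bsub>L\<^esub> TM M w = Square (TM T (TM T u)) u
      (omega_top D T \<odot> TM T (omega_top D T)) (omega D T \<odot> TM T (omega D T))"
    "w \<odot>\<^bsub>L\<^esub> mu M u = Square (TM T (TM T u)) u (omega_top D T \<odot> mu T (Dom K u)) (omega D T \<odot> mu T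
        (Cod K u))"
    by (simp_all add: sq_comp_def classifying_square_def omega_def omega_top_def)
  have sq: "w \<odot>\<^bsub>L\<^esub> eta M u \<in> Loose L" "w \<odot>\<^bsub>L\<^esub> mu M u \<in> Loose L"
    using A.base_unitor A.base_multor L.Tgt_Loose unfolding in_cells by metis+
  have "omega_unitors K D T = (sc_top (unitor A.base_alg), sc_bot (unitor A.base_alg))"
    unfolding omega_unitors_def Let_def A.base_alg_def lax_alg.sel eqs(1,2)
    by (rule THE_compatible_pair[OF c(1)[unfolded eqs] sq(1)[unfolded eqs arrow_2cat_simps(2)]])
  moreover have "omega_multors K D T = (sc_top (multor A.base_alg), sc_bot (multor A.base_alg))"
    unfolding omega_multors_def Let_def A.base_alg_def lax_alg.sel eqs(3,4)
    by (rule THE_compatible_pair[OF c(2)[unfolded eqs] sq(2)[unfolded eqs arrow_2cat_simps(2)]])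
  ultimately show "top_alg K A.base_alg = Omega_top_alg K D T"
    "bot_alg K A.base_alg = Omega_alg K D T"
    unfolding top_alg_def bot_alg_def Omega_top_alg_def Omega_alg_def base_alg_sel
    by (simp_all add: classifying_square_def omega_def omega_top_def)
qed

definition classifying_mor :: "('o, 'm, 'c) lax_mor \<Rightarrow> ('m, 'm square, ('m, 'c) square_cell)
    lax_mor" where
  "classifying_mor P = A.initial_mor (arrow_alg K T P) (classifying_square (und P))"

lemma classifying_mor_sel:
  "lm_dom (classifying_mor P) = arrow_alg K T P" "lm_cod (classifying_mor P) = A.base_alg"
  "und (classifying_mor P) = classifying_square (und P)"
  by (simp_all only: classifying_mor_def A.initial_mor_def lax_mor.sel)

context
  fixes P :: "('o, 'm, 'c) lax_mor"
  assumes P: "P \<in> lax_Small K S T"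
begin

lemma P_strict: "strict_morphism K T P" and und_P_Small: "und P \<in> Small S"
  using P by (auto simp: lax_Small_def)

lemma P_lax: "lax_morphism K T P"
  using P_strict by (simp add: strict_morphism_def)

lemmas P_typing = lax_mor_typing[OF P_lax] lax_alg_typing[OF lax_mor_typing(1)[OF P_lax]]
    lax_alg_typing[OF lax_mor_typing(2)[OF P_lax]]

lemma arrow_alg_P:
  "lax_algebra L M (arrow_alg K T P)"
  "top_alg K (arrow_alg K T P) = lm_dom P" "bot_alg K (arrow_alg K T P) = lm_cod P"
  using lax_algebra_arrow_alg[OF P_strict] P_typing
  by (simp_all add: top_alg_def bot_alg_def lax_alg.expand)

lemma classifying_square_P:
  "classifying_square (und P) \<in> cartesian_squares"
  "Dom L (classifying_square (und P)) = carr (arrow_alg K T P)"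
  using classifying_square_cartesian[OF und_P_Small] by (simp_all add: classifying_square_def)

lemma classifying_mor_lax: "lax_morphism L M (classifying_mor P)"
  unfolding classifying_mor_def
  by (rule A.lax_morphism_initial_mor[OF arrow_alg_P(1) classifying_square_P])

lemma classifying_bars_components:
  "classifying_bars K D T P = (sc_top (bar (classifying_mor P)), sc_bot (bar (classifying_mor P)))"
proof -
  have c: "initial_1cell L (w \<odot>\<^bsub>L\<^esub> TM M (classifying_square (und P)))"
    by (intro A.C_initial A.C_step classifying_square_P)
  have eqs: "w \<odot>\<^bsub>L\<^esub> TM M (classifying_square (und P)) = Square (TM T (und P)) u
      (omega_top D T \<odot> TM T (cl_top D (und P))) (omega D T \<odot> TM T (cl_map D (und P)))"
    "classifying_square (und P) \<odot>\<^bsub>L\<^esub> act (arrow_alg K T P) = Square (TM T (und P)) u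
      (cl_top D (und P) \<odot> act (lm_dom P)) (cl_map D (und P) \<odot> act (lm_cod P))"
    by (simp_all add: sq_comp_def classifying_square_def omega_def omega_top_def)
  have sq: "classifying_square (und P) \<odot>\<^bsub>L\<^esub> act (arrow_alg K T P) \<in> Loose L"
    using A.initial_mor_bar[OF arrow_alg_P(1) classifying_square_P] L.Tgt_Loose
    unfolding in_cells by metis
  show ?thesis
    unfolding classifying_bars_def Let_def classifying_mor_def A.initial_mor_def lax_mor.sel eqs
    by (rule THE_compatible_pair[OF c[unfolded eqs] sq[unfolded eqs arrow_2cat_simps(2)]])
qed

lemma classifying_mor_components:
  "top_mor K (classifying_mor P) = cl_top (lax_classifier K D T) P"
  "bot_mor K (classifying_mor P) = cl_map (lax_classifier K D T) P"
  unfolding top_mor_def bot_mor_def lax_classifier_def classifying_mor_sel base_alg_components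
    arrow_alg_P
  by (simp_all add: classifying_bars_components) (simp_all add: classifying_square_def)

lemma lax_classifying_maps:
  "lax_morphism K T (cl_top (lax_classifier K D T) P)"
  "lax_morphism K T (cl_map (lax_classifier K D T) P)"
  using lax_morphism_projections[OF classifying_mor_lax]
  by (simp_all add: classifying_mor_components)

text \<open>The structure 2-cell of \<open>dp\<close> compares two squares from \<open>T p\<close> to \<open>u\<close>; the first is a pullback, and
  the second factors through the pullback on \<open>\<beta>\<^sup>*E\<close> by the comparison map \<open>\<delta>\<close>.\<close>

lemma pseudo_iff_T_cartesian:
  "pseudo_morphism K T (cl_map (lax_classifier K D T) P) \<longleftrightarrow> T_cartesian K T P"
proof -
  let ?p = "und P" and ?\<epsilon> = "act (lm_dom P)" and ?\<beta> = "act (lm_cod P)"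
  let ?k = "cl_top D ?p" and ?f = "cl_map D ?p"
  let ?h\<^sub>0 = "cl_top D (TM T u) \<odot> TM T ?k" and ?b\<^sub>0 = "cl_map D (TM T u) \<odot> TM T ?f"
  define \<gamma> where "\<gamma> = bar (classifying_mor P)"
  have u: "tight_discrete_opfibration K u" "u \<in> Loose K" using Small_opfib by auto
  let ?s = "w \<odot>\<^bsub>L\<^esub> TM M (classifying_square ?p)"
  let ?t = "classifying_square ?p \<odot>\<^bsub>L\<^esub> act (arrow_alg K T P)"
  have st: "?s = Square (TM T ?p) u ?h\<^sub>0 ?b\<^sub>0" "?t = Square (TM T ?p) u (?k \<odot> ?\<epsilon>) (?f \<odot> ?\<beta>)"
    by (simp_all add: sq_comp_def classifying_square_def)
  have g: "\<gamma> \<in> cells L ?s ?t"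
    unfolding \<gamma>_def classifying_mor_def
    by (rule A.initial_mor_bar[OF arrow_alg_P(1) classifying_square_P])
  note g' = square_cell_cases[OF g, unfolded st square.sel]
  have s_cart: "?s \<in> cartesian_squares" by (intro A.C_step classifying_square_P)
  then have R: "is_pullback K u ?b\<^sub>0 (TM T ?p) ?h\<^sub>0" unfolding st cartesian_squares_def by simp
  note K = classifying_pullback[OF und_P_Small]
  note tk = pullback_typing[OF K] and tr = pullback_typing[OF R]
  have ps: "pseudo_morphism K T (cl_map (lax_classifier K D T) P) \<longleftrightarrow> invertible_cell K (sc_bot \<gamma>)"
    using lax_classifying_maps(2)
    by (simp add: pseudo_morphism_def \<gamma>_def classifying_mor_components(2)[symmetric] bot_mor_def)
  show ?thesis
    unfolding ps
  proof
    assume inv: "invertible_cell K (sc_bot \<gamma>)"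
    define q h where "q = Pb S ?p ?\<beta>" and "h = PbTop S ?p ?\<beta>"
    have lt: "left_tight_pullback K ?p ?\<beta> q h"
      unfolding q_def h_def
      by (rule Pb_pullback[OF und_P_Small, of _ "TO T (carr (lm_cod P))"]) (use P_typing in \<open>simp
          add: in_hom\<close>)
    then have Q: "is_pullback K ?p ?\<beta> q h" by (simp add: left_tight_pullback_def)
    note tq = pullback_typing[OF Q]
    obtain \<delta> where d: "\<delta> \<in> Loose K" "Dom K \<delta> = TO T (carr (lm_dom P))" "Cod K \<delta> = Dom K q"
      "q \<odot> \<delta> = TM T ?p" "h \<odot> \<delta> = ?\<epsilon>"
      by (rule pullback_map[OF Q, of "TM T ?p" "?\<epsilon>"])
        (use P_typing tq strict_mor_eqs(1)[OF P_strict] in simp_all)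
    have kd: "(?k \<odot> h) \<odot> \<delta> = ?k \<odot> ?\<epsilon>" using d tq(1-8) tk(1-8) by simp
    obtain j where j: "j \<in> hom K (Dom K q) (Dom K (TM T ?p))" "\<delta> \<odot> j = Id1 K (Dom K q)"
      "j \<odot> \<delta> = Id1 K (Dom K (TM T ?p))"
    proof (rule invertible_bottom_gives_inverse[OF u R pullback_paste[OF K Q], of \<delta> "sc_top \<gamma>"
    "sc_bot \<gamma>"])
      show "sc_top \<gamma> \<in> cells K ?h\<^sub>0 ((?k \<odot> h) \<odot> \<delta>)" using g'(2) kd by simp
    qed (use d inv g'(3,4) P_typing in simp_all)
    have "split_equivalence K \<delta>"
      by (rule iso_split_equivalence[of _ j]) (use d j P_typing in simp_all)
    then show "T_cartesian K T P"
      unfolding T_cartesian_def using P_strict lt d by (auto simp: in_hom)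
  next
    assume "T_cartesian K T P"
    then obtain q h \<delta> where lt: "left_tight_pullback K ?p ?\<beta> q h"
      and d: "\<delta> \<in> Loose K" "Dom K \<delta> = TO T (carr (lm_dom P))" "Cod K \<delta> = Dom K q"
      "q \<odot> \<delta> = TM T ?p" "h \<odot> \<delta> = ?\<epsilon>" and se: "split_equivalence K \<delta>"
      by (auto simp: T_cartesian_def in_hom)
    have Q: "is_pullback K ?p ?\<beta> q h" using lt by (simp add: left_tight_pullback_def)
    note tq = pullback_typing[OF Q]
    have ul: "unique_lifts K (q \<odot> \<delta>)"
      unfolding d(4) by (rule unique_lifts_pullback[OF opfibration_unique_lifts[OF u] R])
    obtain j where j: "j \<in> hom K (Cod K \<delta>) (Dom K \<delta>)" "\<delta> \<odot> j = Id1 K (Cod K \<delta>)"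
      "j \<odot> \<delta> = Id1 K (Dom K \<delta>)"
      by (rule split_equivalence_over_unique_lifts[OF ul tq(3) d(3) se])
    have j': "j \<in> Loose K" "Dom K j = Dom K q" "Cod K j = TO T (carr (lm_dom P))"
      using j d by (auto simp: in_hom)
    let ?c = "Square q u (?k \<odot> h) (?f \<odot> ?\<beta>)"
    let ?d = "Square (TM T ?p) q \<delta> (Id1 K (Cod K q))"
        and ?j = "Square q (TM T ?p) j (Id1 K (Cod K q))"
    have cq: "Cod K q = TO T (Cod K ?p)" using tq P_typing by simp
    have "TM T ?p \<odot> j = q \<odot> (\<delta> \<odot> j)" using Comp_extend[OF d(4), of j] d(1-3) j' tq by simp
    also have "\<dots> = q" using j d tq by simp
    finally have qj: "TM T ?p \<odot> j = q" .
    have "initial_1cell L (?c \<odot>\<^bsub>L\<^esub> ?d)"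
    proof (rule L.initial_1cell_precomp_iso[OF cartesian_squares_initial[OF pullback_paste[OF K
        Q]], of _ "TM T ?p" ?j])
      show "?d \<in> hom L (TM T ?p) (Dom L ?c)" "?j \<in> hom L (Dom L ?c) (TM T ?p)"
        using d j' cq qj tq(1-8) P_typing by (simp_all add: in_hom is_square_def)
      show "?d \<odot>\<^bsub>L\<^esub> ?j = Id1 L (Dom L ?c)" "?j \<odot>\<^bsub>L\<^esub> ?d = Id1 L (TM T ?p)"
        using j d(1-3) cq tq(3) P_typing by (simp_all add: sq_comp_def)
    qed
    moreover have "?c \<odot>\<^bsub>L\<^esub> ?d = ?t"
      unfolding st using d tq(1-8) tk(1-8) P_typing by (simp add: sq_comp_def)
    ultimately have "initial_1cell L ?t" by simp
    from L.initial_1cells_invertible[OF A.C_initial[OF s_cart] this g]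
    show "invertible_cell K (sc_bot \<gamma>)" by (rule invertible_square_cell_components[OF g])
  qed
qed

end

end

section \<open>Independence of the classifier\<close>

lemma LAXALG_simps [simp]:
  "f \<in> Loose (LAXALG K T) \<longleftrightarrow> lax_morphism K T f"
  "\<Phi> \<in> Cell (LAXALG K T) \<longleftrightarrow> T_2_morphism K T \<Phi>"
  "Dom (LAXALG K T) = lm_dom" "Cod (LAXALG K T) = lm_cod"
  "Src (LAXALG K T) = lc_src" "Tgt (LAXALG K T) = lc_tgt"
  "Id1 (LAXALG K T) X = LaxMor X X (Id1 K (carr X)) (Id2 K (act X))"
  "Id2 (LAXALG K T) F = LaxCell F F (Id2 K (und F))"
  "Comp (LAXALG K T) = lax_comp K T"
  "\<Psi> \<star>\<^bsub>LAXALG K T\<^esub> \<Phi> = LaxCell (lax_comp K T (lc_src \<Psi>) (lc_src \<Phi>))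
       (lax_comp K T (lc_tgt \<Psi>) (lc_tgt \<Phi>)) (und_cell \<Psi> \<star>\<^bsub>K\<^esub> und_cell \<Phi>)"
  "\<Psi> \<cdot>\<^bsub>LAXALG K T\<^esub> \<Phi> = LaxCell (lc_src \<Phi>) (lc_tgt \<Psi>) (und_cell \<Psi> \<cdot>\<^bsub>K\<^esub> und_cell \<Phi>)"
  by (simp_all add: LAXALG_def)

context enhanced_2_monad
begin

lemma T_2_typing:
  assumes "T_2_morphism K T (LaxCell F G \<phi>)"
  shows "lax_morphism K T F" "lax_morphism K T G" "lm_dom F = lm_dom G" "lm_cod F = lm_cod G"
    "\<phi> \<in> Cell K" "Src K \<phi> = und F" "Tgt K \<phi> = und G"
    "(\<phi> \<rhd> act (lm_dom G)) \<cdot> bar F = bar G \<cdot> (act (lm_cod G) \<lhd> TC T \<phi>)"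
proof -
  have a: "lax_morphism K T F" "lax_morphism K T G" "lm_dom F = lm_dom G" "lm_cod F = lm_cod G"
    "\<phi> \<in> cells K (und F) (und G)"
    "(\<phi> \<rhd> act (lm_dom F)) \<cdot> bar F = bar G \<cdot> (act (lm_cod F) \<lhd> TC T \<phi>)"
    using assms unfolding T_2_morphism_def Let_def lax_cell.sel by blast+
  show "lax_morphism K T F" "lax_morphism K T G" "lm_dom F = lm_dom G" "lm_cod F = lm_cod G"
    "\<phi> \<in> Cell K" "Src K \<phi> = und F" "Tgt K \<phi> = und G"
    "(\<phi> \<rhd> act (lm_dom G)) \<cdot> bar F = bar G \<cdot> (act (lm_cod G) \<lhd> TC T \<phi>)"
    using a(1-5) a(6)[unfolded a(3,4)] by (simp_all add: in_cells)
qed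

lemma T_2_morphismI:
  assumes "lax_morphism K T F" "lax_morphism K T G" "lm_dom F = lm_dom G" "lm_cod F = lm_cod G"
    "\<phi> \<in> Cell K" "Src K \<phi> = und F" "Tgt K \<phi> = und G"
    "(\<phi> \<rhd> act (lm_dom G)) \<cdot> bar F = bar G \<cdot> (act (lm_cod G) \<lhd> TC T \<phi>)"
  shows "T_2_morphism K T (LaxCell F G \<phi>)"
  using assms unfolding T_2_morphism_def Let_def lax_cell.sel assms(3,4) by (simp add: in_cells)

lemma T_2_Vcomp:
  assumes F: "T_2_morphism K T (LaxCell F G \<phi>)" and G: "T_2_morphism K T (LaxCell G H \<psi>)"
  shows "T_2_morphism K T (LaxCell F H (\<psi> \<cdot> \<phi>))"
proof -
  note f = T_2_typing[OF F] and g = T_2_typing[OF G]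
  note h = lax_mor_typing[OF g(2)] and h' = lax_mor_typing[OF g(1)]
      and h'' = lax_mor_typing[OF f(1)]
  note a = lax_alg_typing[OF h(1)] and b = lax_alg_typing[OF h(2)]
  let ?a = "act (lm_dom H)" and ?b = "act (lm_cod H)"
  have "((\<psi> \<cdot> \<phi>) \<rhd> ?a) \<cdot> bar F = (\<psi> \<rhd> ?a) \<cdot> ((\<phi> \<rhd> ?a) \<cdot> bar F)"
    using f(3-7) g(3-7) h'(3-8) h''(3-8) h(3-8) a(1-4) b(1-4) by simp
  also have "\<dots> = (\<psi> \<rhd> ?a) \<cdot> (bar G \<cdot> (?b \<lhd> TC T \<phi>))"
    using f(8) by (simp only: g(3,4))
  also have "\<dots> = ((\<psi> \<rhd> ?a) \<cdot> bar G) \<cdot> (?b \<lhd> TC T \<phi>)"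
    using f(3-7) g(3-7) h'(3-8) h''(3-8) h(3-8) a(1-4) b(1-4) by simp
  also have "\<dots> = bar H \<cdot> (?b \<lhd> TC T (\<psi> \<cdot> \<phi>))"
    unfolding g(8) using f(3-7) g(3-7) h'(3-8) h''(3-8) h(3-8) a(1-4) b(1-4) by simp
  finally have "((\<psi> \<cdot> \<phi>) \<rhd> ?a) \<cdot> bar F = bar H \<cdot> (?b \<lhd> TC T (\<psi> \<cdot> \<phi>))" .
  then show ?thesis
    by (intro T_2_morphismI) (use f(1,3-7) g(2,3-7) in simp_all)
qed

lemma T_2_Id2:
  assumes "lax_morphism K T F"
  shows "T_2_morphism K T (LaxCell F F (Id2 K (und F)))"
proof -
  note h = lax_mor_typing[OF assms]
  note a = lax_alg_typing[OF h(1)] and b = lax_alg_typing[OF h(2)]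
  show ?thesis by (rule T_2_morphismI) (use assms h(3-8) a(1-4) b(1-4) in simp_all)
qed

text \<open>The structure 2-cell of the composite is that of \<open>G\<close> followed by that of \<open>H\<close>; the whiskered \<open>\<phi>\<close>
  slides past the latter by interchange and past the former by hypothesis on \<open>\<phi>\<close>.\<close>

lemma T_2_whisker_right:
  assumes G: "T_2_morphism K T (LaxCell G G' \<phi>)" and H: "lax_morphism K T H" "lm_cod H = lm_dom G"
    and c: "lax_morphism K T (lax_comp K T G H)" "lax_morphism K T (lax_comp K T G' H)"
  shows "T_2_morphism K T (LaxCell (lax_comp K T G H) (lax_comp K T G' H) (\<phi> \<rhd> und H))"
proof -
  note g = T_2_typing[OF G]
  note t = lax_mor_typing[OF g(1)] and t' = lax_mor_typing[OF g(2)] and h = lax_mor_typing[OF H(1)]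
  note x = lax_alg_typing[OF h(1)] and y = lax_alg_typing[OF t'(1)] and z = lax_alg_typing[OF t'(2)]
  define f \<gamma> k k' \<kappa> \<kappa>' a b c where "f = und H" "\<gamma> = bar H" "k = und G" "k' = und G'" "\<kappa> = bar G"
  "\<kappa>' = bar G'"
    "a = act (lm_dom H)" "b = act (lm_dom G')" "c = act (lm_cod G')"
  note d = this
  have H': "lm_cod H = lm_dom G'" using H g(3) by simp
  have ty: "f \<in> Loose K" "\<gamma> \<in> Cell K" "Src K \<gamma> = b \<odot> TM T f" "Tgt K \<gamma> = f \<odot> a"
    "k \<in> Loose K" "\<kappa> \<in> Cell K" "Src K \<kappa> = c \<odot> TM T k" "Tgt K \<kappa> = k \<odot> b"
    "k' \<in> Loose K" "\<kappa>' \<in> Cell K" "Src K \<kappa>' = c \<odot> TM T k'" "Tgt K \<kappa>' = k' \<odot> b"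
    "\<phi> \<in> Cell K" "Src K \<phi> = k" "Tgt K \<phi> = k'" "a \<in> Loose K" "b \<in> Loose K" "c \<in> Loose K"
    "Cod K a = Dom K f" "Cod K f = Dom K k" "Dom K k' = Dom K k" "Cod K k' = Cod K k"
    "Cod K b = Dom K k" "Dom K b = TO T (Dom K k)" "Dom K c = TO T (Cod K k)"
    "Dom K a = TO T (Dom K f)"
    using t(3-8) t'(3-8) h(3-8) g(3-7) x(1-4) y(1-4) z(1-4) unfolding d by (simp_all add: H')
  have e: "(\<phi> \<rhd> b) \<cdot> \<kappa> = \<kappa>' \<cdot> (c \<lhd> TC T \<phi>)" using g(8) by (simp add: d)
  have "(\<phi> \<rhd> (f \<odot> a)) \<cdot> (k \<lhd> \<gamma>) = (k' \<lhd> \<gamma>) \<cdot> (\<phi> \<rhd> (b \<odot> TM T f))"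
    by (rule whisker_exchange) (use ty in \<open>simp_all add: in_cells\<close>)
  then have "((\<phi> \<rhd> f) \<rhd> a) \<cdot> ((k \<lhd> \<gamma>) \<cdot> (\<kappa> \<rhd> TM T f)) =
      (k' \<lhd> \<gamma>) \<cdot> ((\<phi> \<rhd> (b \<odot> TM T f)) \<cdot> (\<kappa> \<rhd> TM T f))"
    using ty by (simp flip: Vcomp_assoc_simp)
  also have "(\<phi> \<rhd> (b \<odot> TM T f)) \<cdot> (\<kappa> \<rhd> TM T f) = ((\<phi> \<rhd> b) \<cdot> \<kappa>) \<rhd> TM T f"
    using ty by simp
  also have "(k' \<lhd> \<gamma>) \<cdot> \<dots> = ((k' \<lhd> \<gamma>) \<cdot> (\<kappa>' \<rhd> TM T f)) \<cdot> (c \<lhd> TC T (\<phi> \<rhd> f))"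
    unfolding e using ty by simp
  finally have "((\<phi> \<rhd> f) \<rhd> a) \<cdot> ((k \<lhd> \<gamma>) \<cdot> (\<kappa> \<rhd> TM T f)) =
    ((k' \<lhd> \<gamma>) \<cdot> (\<kappa>' \<rhd> TM T f)) \<cdot> (c \<lhd> TC T (\<phi> \<rhd> f))" .
  then show ?thesis
    by (intro T_2_morphismI c) (use ty g(4) in \<open>simp_all add: lax_comp_def d[symmetric]\<close>)
qed

lemma lax_comp_Id1:
  assumes "lax_morphism K T F"
  shows "lax_comp K T F (LaxMor (lm_dom F) (lm_dom F) (Id1 K (carr (lm_dom F)))
      (Id2 K (act (lm_dom F)))) = F"
    "lax_comp K T (LaxMor (lm_cod F) (lm_cod F) (Id1 K (carr (lm_cod F)))
        (Id2 K (act (lm_cod F)))) F = F"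
proof -
  note h = lax_mor_typing[OF assms]
  note a = lax_alg_typing[OF h(1)] and b = lax_alg_typing[OF h(2)]
  show "lax_comp K T F (LaxMor (lm_dom F) (lm_dom F) (Id1 K (carr (lm_dom F)))
      (Id2 K (act (lm_dom F)))) = F"
    "lax_comp K T (LaxMor (lm_cod F) (lm_cod F) (Id1 K (carr (lm_cod F)))
        (Id2 K (act (lm_cod F)))) F = F"
    using h(3-8) a(1-4) b(1-4) by (simp_all add: lax_comp_def lax_mor.expand)
qed

lemma lax_morphism_Id1:
  assumes "lax_algebra K T X"
  shows "lax_morphism K T (LaxMor X X (Id1 K (carr X)) (Id2 K (act X)))"
proof -
  note a = lax_alg_typing[OF assms]
  show ?thesis
    unfolding lax_morphism_def Let_def lax_mor.sel
    using assms a by (simp add: in_hom in_cells)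
qed

lemma invertible_TC:
  assumes "invertible_cell K \<phi>"
  shows "invertible_cell K (TC T \<phi>)"
proof -
  have c: "\<phi> \<in> Cell K" using assms by (simp add: invertible_cell_def)
  obtain \<psi> where "\<psi> \<in> cells K (Tgt K \<phi>) (Src K \<phi>)" "\<psi> \<cdot> \<phi> = Id2 K (Src K \<phi>)"
    "\<phi> \<cdot> \<psi> = Id2 K (Tgt K \<phi>)" using invertible_inverse[OF assms] .
  then show ?thesis
    using c TC_Vcomp_simp[of \<phi> \<psi>] TC_Vcomp_simp[of \<psi> \<phi>]
    by (intro invertible_cellI[of _ "TM T (Src K \<phi>)" "TM T (Tgt K \<phi>)" "TC T \<psi>"])
        (simp_all add: in_cells)
qed

text \<open>In \<open>(\<phi> \<alpha>) f' = g' (\<beta> T\<phi>)\<close>, where \<open>f'\<close> and \<open>g'\<close> are the structure 2-cells, the whiskerings of \<open>\<phi>\<close>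
  are invertible.\<close>

lemma bar_invertible_iff:
  assumes G: "T_2_morphism K T (LaxCell F G \<phi>)" and i: "invertible_cell K \<phi>"
  shows "invertible_cell K (bar F) \<longleftrightarrow> invertible_cell K (bar G)"
proof -
  note g = T_2_typing[OF G]
  note t = lax_mor_typing[OF g(1)] and t' = lax_mor_typing[OF g(2)]
  note y = lax_alg_typing[OF t'(1)] and z = lax_alg_typing[OF t'(2)]
  have 1: "invertible_cell K (\<phi> \<rhd> act (lm_dom G))"
    by (rule invertible_whisker_right[OF i]) (use g(3-7) t(3-5) y(1-4) in simp_all)
  have 2: "invertible_cell K (act (lm_cod G) \<lhd> TC T \<phi>)"
    by (rule invertible_whisker_left[OF invertible_TC[OF i]]) (use g(3-7) t(3-5) z(1-4) in simp_all)
  have "invertible_cell K (bar F) \<longleftrightarrow> invertible_cell K ((\<phi> \<rhd> act (lm_dom G)) \<cdot> bar F)"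
    using invertible_cancel_left[OF _ 1, of "bar F"] invertible_Vcomp[OF _ 1, of "bar F"]
      g(3-7) t(3-8) y(1-4) by auto
  also have "\<dots> \<longleftrightarrow> invertible_cell K (bar G)"
    unfolding g(8)
    using invertible_cancel_right[OF _ 2, of "bar G"] invertible_Vcomp[OF 2, of "bar G"]
      g(3-7) t(3-5) t'(3-8) z(1-4) by auto
  finally show ?thesis .
qed

end

context enhanced_2_monad
begin

text \<open>With \<open>P\<close> and \<open>Q\<close> strict, commutation of the lax square on structure 2-cells is exactly the
  compatibility condition for a 2-cell of the arrow 2-category.\<close>

lemma lax_square_bars:
  assumes P: "strict_morphism K T P" and Q: "strict_morphism K T Q"
    and F: "lax_morphism K T F\<^sub>1" "lm_dom F\<^sub>1 = lm_dom P" "lm_cod F\<^sub>1 = lm_dom Q"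
      "lax_morphism K T F" "lm_dom F = lm_cod P" "lm_cod F = lm_cod Q"
    and e: "und Q \<odot> und F\<^sub>1 = und F \<odot> und P"
  shows "lax_comp K T Q F\<^sub>1 = lax_comp K T F P \<longleftrightarrow> und Q \<lhd> bar F\<^sub>1 = bar F \<rhd> TM T (und P)"
proof -
  have b: "bar P = Id2 K (und P \<odot> act (lm_dom P))" "bar Q = Id2 K (und Q \<odot> act (lm_dom Q))"
    and l: "lax_morphism K T P" "lax_morphism K T Q"
    using P Q by (auto simp: strict_morphism_def)
  note p = lax_mor_typing[OF l(1)] and q = lax_mor_typing[OF l(2)]
    and f1 = lax_mor_typing[OF F(1)] and f = lax_mor_typing[OF F(4)]
  note x = lax_alg_typing[OF p(1)] lax_alg_typing[OF p(2)] lax_alg_typing[OF q(1)]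
      lax_alg_typing[OF q(2)]
  have 1: "(und Q \<lhd> bar F\<^sub>1) \<cdot> (bar Q \<rhd> TM T (und F\<^sub>1)) = und Q \<lhd> bar F\<^sub>1"
    unfolding b(2) using q(3-5) f1(3-8) F x by simp
  have 2: "(und F \<lhd> bar P) \<cdot> (bar F \<rhd> TM T (und P)) = bar F \<rhd> TM T (und P)"
  proof -
    have "Tgt K (bar F \<rhd> TM T (und P)) = und F \<odot> (und P \<odot> act (lm_dom P))"
      using p(3-5) f(3-8) F x strict_mor_eqs(1)[OF P] by simp
    then show ?thesis
      unfolding b(1) using p(3-5) f(3-8) F x by simp
  qed
  show ?thesis unfolding lax_comp_def 1 2 using F e by simp
qed

lemma lax_comp_eq_und:
  "lax_comp K T Q F\<^sub>1 = lax_comp K T F P \<Longrightarrow> und Q \<odot> und F\<^sub>1 = und F \<odot> und P"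
  by (simp add: lax_comp_def)

lemma arrow_mor_sel [simp]:
  "lm_dom (arrow_mor K T P Q F\<^sub>1 F) = arrow_alg K T P" "lm_cod (arrow_mor K T P Q F\<^sub>1 F)
      = arrow_alg K T Q"
  "und (arrow_mor K T P Q F\<^sub>1 F) = Square (und P) (und Q) (und F\<^sub>1) (und F)"
  "sc_top (bar (arrow_mor K T P Q F\<^sub>1 F)) = bar F\<^sub>1" "sc_bot (bar (arrow_mor K T P Q F\<^sub>1 F))
      = bar F"
  by (simp_all add: arrow_mor_def Let_def)

lemma lax_morphism_arrow_mor:
  assumes P: "strict_morphism K T P" and Q: "strict_morphism K T Q"
    and F: "lax_morphism K T F\<^sub>1" "lm_dom F\<^sub>1 = lm_dom P" "lm_cod F\<^sub>1 = lm_dom Q"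
      "lax_morphism K T F" "lm_dom F = lm_cod P" "lm_cod F = lm_cod Q"
    and c: "lax_comp K T Q F\<^sub>1 = lax_comp K T F P"
  shows "lax_morphism (arrow_2cat K) (arrow_monad K T) (arrow_mor K T P Q F\<^sub>1 F)"
proof -
  let ?L = "arrow_2cat K" and ?M = "arrow_monad K T"
  interpret A: enhanced_2_monad ?L ?M by (rule enhanced_2_monad_arrow)
  note e = lax_comp_eq_und[OF c]
  have b: "und Q \<lhd> bar F\<^sub>1 = bar F \<rhd> TM T (und P)" using lax_square_bars[OF P Q F e] c by blast
  have l: "lax_morphism K T P" "lax_morphism K T Q" using P Q by (auto simp: strict_morphism_def)
  note p = lax_mor_typing[OF l(1)] and q = lax_mor_typing[OF l(2)]
    and f1 = lax_mor_typing[OF F(1)] and f = lax_mor_typing[OF F(4)]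
  note AP = lax_algebra_arrow_alg[OF P] and AQ = lax_algebra_arrow_alg[OF Q]
  note ap = A.lax_alg_typing[OF AP] and aq = A.lax_alg_typing[OF AQ]
  define s where "s = Square (und P) (und Q) (und F\<^sub>1) (und F)"
  have s: "is_square K s" using e p(3-5) q(3-5) f1(3-5) f(3-5) F
    by (simp add: s_def is_square_def in_hom)
  define \<gamma> where "\<gamma> = bar (arrow_mor K T P Q F\<^sub>1 F)"
  have g: "\<gamma> = SquareCell (act (arrow_alg K T Q) \<odot>\<^bsub>?L\<^esub> TM ?M s) (s \<odot>\<^bsub>?L\<^esub> act (arrow_alg K T P))
      (bar F\<^sub>1) (bar F)"
    by (simp add: \<gamma>_def arrow_mor_def Let_def s_def)
  have sq: "is_square K (act (arrow_alg K T Q) \<odot>\<^bsub>?L\<^esub> TM ?M s)"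
    "is_square K (s \<odot>\<^bsub>?L\<^esub> act (arrow_alg K T P))"
    using A.Comp_simps(1)[of "TM ?M s" "act (arrow_alg K T Q)"] A.Comp_simps(1)[of "act
        (arrow_alg K T P)" s]
      ap(2) aq(2) is_square_TM[OF s] s by (simp_all add: s_def)
  have gc: "\<gamma> \<in> cells ?L (act (arrow_alg K T Q) \<odot>\<^bsub>?L\<^esub> TM ?M s) (s \<odot>\<^bsub>?L\<^esub> act (arrow_alg K T P))"
    using sq b f1(6-8) f(6-8) F unfolding g
    by (simp add: in_cells is_square_cell_def compatible_pair_def) (simp add: s_def sq_comp_def)
  have f1e: "und F\<^sub>1 \<lhd> unitor (lm_dom P) = (bar F\<^sub>1 \<rhd> eta T (carr (lm_dom P)))
      \<cdot> (unitor (lm_dom Q) \<rhd> und F\<^sub>1)"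
    "(und F\<^sub>1 \<lhd> multor (lm_dom P)) \<cdot> (bar F\<^sub>1 \<rhd> TM T (act (lm_dom P)))
        \<cdot> (act (lm_dom Q) \<lhd> TC T (bar F\<^sub>1)) =
      (bar F\<^sub>1 \<rhd> mu T (carr (lm_dom P))) \<cdot> (multor (lm_dom Q) \<rhd> TM T (TM T (und F\<^sub>1)))"
    using F(1) unfolding lax_morphism_def Let_def F by blast+
  have fe: "und F \<lhd> unitor (lm_cod P) = (bar F \<rhd> eta T (carr (lm_cod P)))
      \<cdot> (unitor (lm_cod Q) \<rhd> und F)"
    "(und F \<lhd> multor (lm_cod P)) \<cdot> (bar F \<rhd> TM T (act (lm_cod P)))
        \<cdot> (act (lm_cod Q) \<lhd> TC T (bar F)) =
      (bar F \<rhd> mu T (carr (lm_cod P))) \<cdot> (multor (lm_cod Q) \<rhd> TM T (TM T (und F)))"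
    using F(4) unfolding lax_morphism_def Let_def F by blast+
  note x = lax_alg_typing[OF p(1)] lax_alg_typing[OF p(2)] lax_alg_typing[OF q(1)]
      lax_alg_typing[OF q(2)]
  have unit: "s \<lhd>\<^bsub>?L\<^esub> unitor (arrow_alg K T P) =
      (\<gamma> \<rhd>\<^bsub>?L\<^esub> eta ?M (und P)) \<cdot>\<^bsub>?L\<^esub> (unitor (arrow_alg K T Q) \<rhd>\<^bsub>?L\<^esub> s)" (is "?l = ?r")
  proof (rule square_cell.expand, intro conjI)
    show "sc_src ?l = sc_src ?r" "sc_tgt ?l = sc_tgt ?r"
      using p(3-5) q(3-5) f1(3-5) f(3-5) F x
      by (simp_all add: s_def g sq_comp_def) (simp_all add: arrow_alg_def Let_def sq_comp_def)
    show "sc_top ?l = sc_top ?r" "sc_bot ?l = sc_bot ?r"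
      using f1e(1) fe(1) p(4,5) by (simp_all add: s_def g)
  qed
  have mult: "(s \<lhd>\<^bsub>?L\<^esub> multor (arrow_alg K T P)) \<cdot>\<^bsub>?L\<^esub> (\<gamma> \<rhd>\<^bsub>?L\<^esub> TM ?M (act (arrow_alg K T P))) \<cdot>\<^bsub>?L\<^esub>
        (act (arrow_alg K T Q) \<lhd>\<^bsub>?L\<^esub> TC ?M \<gamma>) =
      (\<gamma> \<rhd>\<^bsub>?L\<^esub> mu ?M (und P)) \<cdot>\<^bsub>?L\<^esub> (multor (arrow_alg K T Q) \<rhd>\<^bsub>?L\<^esub> TM ?M (TM ?M s))" (is "?l = ?r")
  proof (rule square_cell.expand, intro conjI)
    show "sc_src ?l = sc_src ?r" "sc_tgt ?l = sc_tgt ?r"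
      using p(3-5) q(3-5) f1(3-5) f(3-5) F x
      by (simp_all add: s_def g sq_comp_def) (simp_all add: arrow_alg_def Let_def sq_comp_def)
    show "sc_top ?l = sc_top ?r" "sc_bot ?l = sc_bot ?r"
      using f1e(2) fe(2) p(4,5) by (simp_all add: s_def g)
  qed
  have sel: "carr (arrow_alg K T P) = und P" "carr (arrow_alg K T Q) = und Q" by simp_all
  have sh: "s \<in> hom ?L (und P) (und Q)" using s by (simp add: in_hom s_def)
  show ?thesis
    unfolding lax_morphism_def Let_def arrow_mor_sel \<gamma>_def[symmetric] s_def[symmetric] sel
    using AP AQ sh gc unit mult by blast
qed

text \<open>Converse to \<open>lax_morphism_arrow_mor\<close>: lax morphisms in the arrow 2-category are the commuting squares
  of lax morphisms over strict ones.\<close>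

lemma lax_square_of_arrow_mor:
  assumes P: "strict_morphism K T P" and Q: "strict_morphism K T Q"
    and H: "lax_morphism (arrow_2cat K) (arrow_monad K T) H"
      "lm_dom H = arrow_alg K T P" "lm_cod H = arrow_alg K T Q"
    and t: "top_alg K (arrow_alg K T P) = lm_dom P" "top_alg K (arrow_alg K T Q) = lm_dom Q"
      "bot_alg K (arrow_alg K T P) = lm_cod P" "bot_alg K (arrow_alg K T Q) = lm_cod Q"
  shows "lax_comp K T Q (top_mor K H) = lax_comp K T (bot_mor K H) P"
proof -
  let ?L = "arrow_2cat K" and ?M = "arrow_monad K T"
  interpret A: enhanced_2_monad ?L ?M by (rule enhanced_2_monad_arrow)
  note h = A.lax_mor_typing[OF H(1), unfolded H]
  note l = lax_morphism_projections[OF H(1)]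
  have sq: "is_square K (und H)" "sq_dom (und H) = und P" "sq_cod (und H) = und Q"
    "is_square_cell K (bar H)" "sq_dom (sc_src (bar H)) = TM T (und P)"
    "sq_cod (sc_src (bar H)) = und Q"
    using h by (simp_all add: sq_comp_def)
  show ?thesis
    using lax_square_bars[OF P Q l(1) _ _ l(2)] sq
    by (simp add: top_mor_def bot_mor_def H t is_square_def is_square_cell_def compatible_pair_def)
qed

end

context opfibrantly_cartesian_monad
begin

context
  fixes P :: "('o, 'm, 'c) lax_mor" and D' :: "('o, 'm, 'c) lax_mor classifier"
  assumes P: "P \<in> lax_Small K S T"
    and D': "enhanced_2_classifier (LAXALG K T) (lax_Small K S T) D'"
    and U: "cl_u D' = cl_u (lax_classifier K D T)"
begin

lemma U_small: "cl_u D' \<in> lax_Small K S T"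
  using D' unfolding enhanced_2_classifier_def by blast

lemma U_strict: "strict_morphism K T (cl_u D')"
  using U_small by (simp add: lax_Small_def)

text \<open>By this identification the squares of every classifier on the canonical \<open>u\<close> are lax morphisms into
  \<open>base_alg\<close> in the arrow 2-category, and initiality applies to them.\<close>

lemma arrow_alg_U: "arrow_alg K T (cl_u D') = A.base_alg"
proof -
  have s: "und (cl_u D') = u" "lm_dom (cl_u D') = Omega_top_alg K D T"
    "lm_cod (cl_u D') = Omega_alg K D T"
    unfolding U by (simp_all add: lax_classifier_def)
  have a: "act (Omega_top_alg K D T) = sq_top w" "act (Omega_alg K D T) = sq_bot w"
    "unitor (Omega_top_alg K D T) = sc_top (unitor A.base_alg)"
    "unitor (Omega_alg K D T) = sc_bot (unitor A.base_alg)"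
    "multor (Omega_top_alg K D T) = sc_top (multor A.base_alg)"
    "multor (Omega_alg K D T) = sc_bot (multor A.base_alg)"
    unfolding base_alg_components[symmetric] top_alg_def bot_alg_def base_alg_sel by simp_all
  have w: "Square (TM T u) u (sq_top w) (sq_bot w) = w"
    by (simp add: classifying_square_def)
  note v = square_cell_cases(1)[OF A.base_unitor] and m = square_cell_cases(1)[OF A.base_multor]
  show ?thesis
    unfolding arrow_alg_def Let_def s a w
    by (rule lax_alg.expand) (simp only: lax_alg.sel base_alg_sel v[symmetric] m[symmetric]
        simp_thms)
qed

text \<open>The square given by \<open>D'\<close> and the lifted classifying square admit 2-morphisms to each other. The
  composites are endomorphisms, hence identities: on the lifted square by initiality, on the other
  by the uniqueness clause for \<open>D'\<close> applied to the identity square on \<open>P\<close>.\<close>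

lemma classifier_invertible_iff:
  "invertible_cell K (bar (cl_map D' P)) \<longleftrightarrow>
   invertible_cell K (bar (cl_map (lax_classifier K D T) P))"
  and cl_map_lax: "lax_morphism K T (cl_map D' P)"
proof -
  let ?A = "LAXALG K T" and ?U = "cl_u D'"
  have ua: "und ?U = u" by (simp add: U lax_classifier_def)
  define G\<^sub>1 G F\<^sub>1 F where "G\<^sub>1 = cl_top D' P" and "G = cl_map D' P"
    and "F\<^sub>1 = cl_top (lax_classifier K D T) P" and "F = cl_map (lax_classifier K D T) P"
  have F_mor: "top_mor K (classifying_mor P) = F\<^sub>1" "bot_mor K (classifying_mor P) = F"
    using classifying_mor_components[OF P] by (simp_all add: F\<^sub>1_def F_def)
  note cm = classifying_mor_lax[OF P] and arP = arrow_alg_P[OF P] and Ps = P_strict[OF P]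
  have U_alg: "top_alg K (arrow_alg K T ?U) = lm_dom ?U" "bot_alg K (arrow_alg K T ?U) = lm_cod ?U"
    using arrow_alg_P(2,3)[OF U_small] .
  have F: "lax_morphism K T F\<^sub>1" "lm_dom F\<^sub>1 = lm_dom P" "lm_cod F\<^sub>1 = lm_dom ?U"
    "lax_morphism K T F" "lm_dom F = lm_cod P" "lm_cod F = lm_cod ?U"
    using lax_classifying_maps[OF P] by (simp_all add: F\<^sub>1_def F_def lax_classifier_def U)
  have UF: "lax_comp K T ?U F\<^sub>1 = lax_comp K T F P"
    unfolding F_mor[symmetric]
    by (rule lax_square_of_arrow_mor[OF Ps U_strict cm])
      (simp_all only: classifying_mor_sel arrow_alg_U[symmetric] arP U_alg)
  have pb: "is_pullback ?A ?U G P G\<^sub>1"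
    unfolding G_def G\<^sub>1_def using D' P unfolding enhanced_2_classifier_def by blast
  then have G: "lax_morphism K T G\<^sub>1" "lm_dom G\<^sub>1 = lm_dom P" "lm_cod G\<^sub>1 = lm_dom ?U"
    "lax_morphism K T G" "lm_dom G = lm_cod P" "lm_cod G = lm_cod ?U"
    and UG: "lax_comp K T ?U G\<^sub>1 = lax_comp K T G P"
    unfolding is_pullback_def in_hom by simp_all
  show "lax_morphism K T (cl_map D' P)" using G(4) by (simp add: G_def)

  \<comment> \<open>The comparison from the lifted square, by its initiality.\<close>
  define H where "H = arrow_mor K T P ?U G\<^sub>1 G"
  have Hl: "lax_morphism L M H"
    unfolding H_def by (rule lax_morphism_arrow_mor[OF Ps U_strict G UG])
  have Hs: "lm_dom H = arrow_alg K T P" "lm_cod H = A.base_alg"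
    "und H = Square (und P) u (und G\<^sub>1) (und G)"
    using arrow_alg_U by (simp_all add: H_def U lax_classifier_def)
  have H_mor: "top_mor K H = G\<^sub>1" "bot_mor K H = G"
    unfolding H_def top_mor_def bot_mor_def arrow_mor_sel arP U_alg
    using G by (simp_all add: lax_mor.expand)
  let ?s = "classifying_square (und P)"
  have i: "initial_1cell L ?s" by (intro A.C_initial classifying_square_P[OF P])
  define \<theta> where "\<theta> = initial_cell L ?s (und H)"
  have th: "\<theta> \<in> cells L ?s (und H)"
    unfolding \<theta>_def
    by (rule L.initial_cell_in[OF i])
      (use L.Src_Loose A.lax_mor_typing(3)[OF Hl] in \<open>simp add: in_hom Hs classifying_square_def\<close>)
  have "T_2_morphism L M (LaxCell (classifying_mor P) H \<theta>)"
    unfolding classifying_mor_def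
    using A.T_2_morphism_initial[OF Hl Hs(2) _ _ th] classifying_square_P[OF P] Hs(1) by metis
  from T_2_morphism_projections[OF this]
  have th2: "T_2_morphism K T (LaxCell F\<^sub>1 G\<^sub>1 (sc_top \<theta>))"
    "T_2_morphism K T (LaxCell F G (sc_bot \<theta>))"
    by (simp_all add: F_mor H_mor)

  \<comment> \<open>The comparison to the lifted square, from the other classifier.\<close>
  obtain \<Gamma>\<^sub>1 \<Gamma>
      where Ga: "compatible_pair ?A ?U P G\<^sub>1 (cl_top D' ?U \<odot>\<^bsub>?A\<^esub> F\<^sub>1) G (cl_map D' ?U \<odot>\<^bsub>?A\<^esub> F)
      (\<Gamma>\<^sub>1, \<Gamma>)"
  proof -
    have "\<exists>!\<gamma>s. compatible_pair ?A ?U P G\<^sub>1 (cl_top D' ?U \<odot>\<^bsub>?A\<^esub> F\<^sub>1) G (cl_map D' ?U \<odot>\<^bsub>?A\<^esub> F) \<gamma>s"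
      unfolding G\<^sub>1_def G_def
      using D'[unfolded enhanced_2_classifier_def, THEN conjunct2, THEN conjunct2, THEN conjunct1,
        rule_format, OF P U_small, of F\<^sub>1 F] F UF by (simp add: in_hom)
    then show thesis using that by (metis prod.exhaust)
  qed
  obtain I\<^sub>1 I where I: "compatible_pair ?A ?U ?U (cl_top D' ?U) (Id1 ?A (lm_dom ?U))
      (cl_map D' ?U) (Id1 ?A (lm_cod ?U)) (I\<^sub>1, I)"
    using D'[unfolded enhanced_2_classifier_def, THEN conjunct2, THEN conjunct2, THEN conjunct2,
        THEN conjunct2]
    by auto
  define \<zeta>\<^sub>1 \<zeta> where "\<zeta>\<^sub>1 = (und_cell I\<^sub>1 \<rhd> und F\<^sub>1) \<cdot> und_cell \<Gamma>\<^sub>1"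
      and "\<zeta> = (und_cell I \<rhd> und F) \<cdot> und_cell \<Gamma>"
  have Ga0: "T_2_morphism K T \<Gamma>\<^sub>1" "lc_src \<Gamma>\<^sub>1 = G\<^sub>1" "lc_tgt \<Gamma>\<^sub>1 = lax_comp K T (cl_top D' ?U) F\<^sub>1"
    "T_2_morphism K T \<Gamma>" "lc_src \<Gamma> = G" "lc_tgt \<Gamma> = lax_comp K T (cl_map D' ?U) F"
    and Ga_c: "u \<lhd> und_cell \<Gamma>\<^sub>1 = und_cell \<Gamma> \<rhd> und P"
    using Ga unfolding compatible_pair_def in_cells by (simp_all add: ua)
  have I0: "T_2_morphism K T I\<^sub>1" "lc_src I\<^sub>1 = cl_top D' ?U" "lc_tgt I\<^sub>1 = Id1 ?A (lm_dom ?U)"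
    "T_2_morphism K T I" "lc_src I = cl_map D' ?U" "lc_tgt I = Id1 ?A (lm_cod ?U)"
    and I_c: "u \<lhd> und_cell I\<^sub>1 = und_cell I \<rhd> u"
    using I unfolding compatible_pair_def in_cells by (simp_all add: ua)
  have Ga': "T_2_morphism K T (LaxCell G\<^sub>1 (lax_comp K T (cl_top D' ?U) F\<^sub>1) (und_cell \<Gamma>\<^sub>1))"
    "T_2_morphism K T (LaxCell G (lax_comp K T (cl_map D' ?U) F) (und_cell \<Gamma>))"
    using Ga0 lax_cell.collapse by metis+
  have I': "T_2_morphism K T (LaxCell (cl_top D' ?U) (Id1 ?A (lm_dom ?U)) (und_cell I\<^sub>1))"
    "T_2_morphism K T (LaxCell (cl_map D' ?U) (Id1 ?A (lm_cod ?U)) (und_cell I))"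
    using I0 lax_cell.collapse by metis+
  note G1t = T_2_typing[OF Ga'(1)] and Gt = T_2_typing[OF Ga'(2)]
  note I1t = T_2_typing[OF I'(1)] and It = T_2_typing[OF I'(2)]
  have id: "lax_comp K T (Id1 ?A (lm_dom ?U)) F\<^sub>1 = F\<^sub>1" "lax_comp K T (Id1 ?A (lm_cod ?U)) F = F"
    using lax_comp_Id1(2)[OF F(1)] lax_comp_Id1(2)[OF F(4)] F by simp_all
  have l2: "T_2_morphism K T (LaxCell G\<^sub>1 F\<^sub>1 \<zeta>\<^sub>1)" "T_2_morphism K T (LaxCell G F \<zeta>)"
    unfolding \<zeta>\<^sub>1_def \<zeta>_def
    using T_2_Vcomp[OF Ga'(1) T_2_whisker_right[OF I'(1) F(1), unfolded id]]
      T_2_Vcomp[OF Ga'(2) T_2_whisker_right[OF I'(2) F(4), unfolded id]]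
      I1t(3) It(3) F G1t(2) Gt(2) by simp_all
  note l1 = T_2_typing[OF l2(1)] and l0 = T_2_typing[OF l2(2)]
    and t1 = T_2_typing[OF th2(1)] and t0 = T_2_typing[OF th2(2)]
  note f1 = lax_mor_typing(3-5)[OF F(1)] and f = lax_mor_typing(3-5)[OF F(4)]
    and g1 = lax_mor_typing(3-5)[OF G(1)] and g = lax_mor_typing(3-5)[OF G(4)]
  note p = P_typing(3-5)[OF P]
  have uu: "u \<in> Loose K" "Dom K u = carr (lm_dom ?U)" "Cod K u = carr (lm_cod ?U)"
    using P_typing(3-5)[OF U_small] by (simp_all add: ua)
  have uf: "u \<odot> und F\<^sub>1 = und F \<odot> und P" using lax_comp_eq_und[OF UF] by (simp add: ua)
  have ug: "u \<odot> und G\<^sub>1 = und G \<odot> und P" using lax_comp_eq_und[OF UG] by (simp add: ua)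
  have c: "Cod K (und F\<^sub>1) = Dom K u" "Cod K (und F) = Cod K u" "Dom K (und F) = Cod K (und P)"
    "Dom K (und F\<^sub>1) = Dom K (und P)" "Cod K (und G\<^sub>1) = Dom K u" "Cod K (und G) = Cod K u"
    "Dom K (und G) = Cod K (und P)" "Dom K (und G\<^sub>1) = Dom K (und P)"
    using f1 f g1 g p uu F G by simp_all
  have l_c: "u \<lhd> \<zeta>\<^sub>1 = \<zeta> \<rhd> und P"
  proof -
    have ty: "und_cell I\<^sub>1 \<in> Cell K" "Src K (und_cell I\<^sub>1) = und (cl_top D' ?U)"
      "Tgt K (und_cell I\<^sub>1) = Id1 K (Dom K u)"
      "und_cell I \<in> Cell K" "Src K (und_cell I) = und (cl_map D' ?U)"
      "Tgt K (und_cell I) = Id1 K (Cod K u)"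
      "und_cell \<Gamma>\<^sub>1 \<in> Cell K" "Src K (und_cell \<Gamma>\<^sub>1) = und G\<^sub>1"
      "Tgt K (und_cell \<Gamma>\<^sub>1) = und (cl_top D' ?U) \<odot> und F\<^sub>1"
      "und_cell \<Gamma> \<in> Cell K" "Src K (und_cell \<Gamma>) = und G"
      "Tgt K (und_cell \<Gamma>) = und (cl_map D' ?U) \<odot> und F"
      using I1t(5-7) It(5-7) G1t(5-7) Gt(5-7) by (simp_all add: lax_comp_def uu)
    have kd: "und (cl_top D' ?U) \<in> Loose K" "und (cl_map D' ?U) \<in> Loose K"
      "Dom K (und (cl_top D' ?U)) = Dom K u" "Cod K (und (cl_top D' ?U)) = Dom K u"
      "Dom K (und (cl_map D' ?U)) = Cod K u" "Cod K (und (cl_map D' ?U)) = Cod K u"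
      using lax_mor_typing(3-5)[OF I1t(1)] lax_mor_typing(3-5)[OF It(1)] I1t(3,4) It(3,4)
      by (simp_all add: uu)
    have "u \<lhd> \<zeta>\<^sub>1 = ((u \<lhd> und_cell I\<^sub>1) \<rhd> und F\<^sub>1) \<cdot> (u \<lhd> und_cell \<Gamma>\<^sub>1)"
      unfolding \<zeta>\<^sub>1_def using ty kd c f1(1) uu(1) by simp
    also have "\<dots> = (und_cell I \<rhd> (u \<odot> und F\<^sub>1)) \<cdot> (und_cell \<Gamma> \<rhd> und P)"
      unfolding I_c Ga_c using ty kd c f1(1) uu(1) by simp
    also have "\<dots> = \<zeta> \<rhd> und P"
      unfolding \<zeta>_def uf using ty kd c f(1) p(1) by simp
    finally show ?thesis .
  qed
  have th_c: "u \<lhd> sc_top \<theta> = sc_bot \<theta> \<rhd> und P"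
    using square_cell_cases(4)[OF th] by (simp add: classifying_square_def)

  \<comment> \<open>One composite is an endomorphism of an initial 1-cell of the arrow 2-category.\<close>
  have "SquareCell ?s ?s (\<zeta>\<^sub>1 \<cdot> sc_top \<theta>) (\<zeta> \<cdot> sc_bot \<theta>) = Id2 L ?s"
  proof (rule L.initial_1cell_unique[OF i])
    have s: "is_square K ?s" using classifying_square_is_square[OF und_P_Small[OF P]] .
    have ss: "sq_top ?s = und F\<^sub>1" "sq_bot ?s = und F" "sq_dom ?s = und P" "sq_cod ?s = u"
      by (simp_all add: classifying_square_def F\<^sub>1_def F_def lax_classifier_def)
    have "u \<lhd> (\<zeta>\<^sub>1 \<cdot> sc_top \<theta>) = (\<zeta> \<cdot> sc_bot \<theta>) \<rhd> und P"
      using l1(5-7) l0(5-7) t1(5-7) t0(5-7) c uu(1) p(1) by (simp add: l_c th_c)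
    then show "SquareCell ?s ?s (\<zeta>\<^sub>1 \<cdot> sc_top \<theta>) (\<zeta> \<cdot> sc_bot \<theta>) \<in> cells L ?s ?s"
      using s l1(5-7) l0(5-7) t1(5-7) t0(5-7)
      by (simp add: in_cells is_square_cell_def compatible_pair_def ss)
    show "Id2 L ?s \<in> cells L ?s ?s" using L.Id2_cells[of ?s] s by (simp only: arrow_2cat_simps)
  qed
  then have fid: "\<zeta> \<cdot> sc_bot \<theta> = Id2 K (und F)"
    by (simp add: classifying_square_def F_def lax_classifier_def)

  \<comment> \<open>The other is an endomorphism of the other classifying square, which has only one.\<close>
  have endo: "\<delta>\<^sub>1 = \<epsilon>\<^sub>1 \<and> \<delta> = \<epsilon>"
    if a: "T_2_morphism K T (LaxCell G\<^sub>1 G\<^sub>1 \<delta>\<^sub>1)" "T_2_morphism K T (LaxCell G G \<delta>)"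
    "u \<lhd> \<delta>\<^sub>1 = \<delta> \<rhd> und P"
      and b: "T_2_morphism K T (LaxCell G\<^sub>1 G\<^sub>1 \<epsilon>\<^sub>1)" "T_2_morphism K T (LaxCell G G \<epsilon>)"
      "u \<lhd> \<epsilon>\<^sub>1 = \<epsilon> \<rhd> und P"
    for \<delta>\<^sub>1 \<delta> \<epsilon>\<^sub>1 \<epsilon>
  proof -
    let ?i = "Id1 ?A (lm_dom P)" and ?j = "Id1 ?A (lm_cod P)"
    have id: "G\<^sub>1 \<odot>\<^bsub>?A\<^esub> ?i = G\<^sub>1" "G \<odot>\<^bsub>?A\<^esub> ?j = G"
      using lax_comp_Id1(1)[OF G(1)] lax_comp_Id1(1)[OF G(4)] G by simp_all
    have idP: "P \<odot>\<^bsub>?A\<^esub> ?i = ?j \<odot>\<^bsub>?A\<^esub> P"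
      using lax_comp_Id1[OF P_lax[OF P]] by simp
    have ij: "?i \<in> hom ?A (lm_dom P) (lm_dom P)" "?j \<in> hom ?A (lm_cod P) (lm_cod P)"
      using lax_morphism_Id1 P_typing(1,2)[OF P] by (simp_all add: in_hom)
    have ex: "\<exists>!\<gamma>s. compatible_pair ?A ?U P G\<^sub>1 G\<^sub>1 G G \<gamma>s"
      using D'[unfolded enhanced_2_classifier_def, THEN conjunct2, THEN conjunct2, THEN conjunct1,
        rule_format, OF P P, unfolded LAXALG_simps(3,4), OF ij idP]
          unfolding G\<^sub>1_def[symmetric] G_def[symmetric] id .
    have "compatible_pair ?A ?U P G\<^sub>1 G\<^sub>1 G G (LaxCell G\<^sub>1 G\<^sub>1 \<delta>\<^sub>1, LaxCell G G \<delta>)"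
      "compatible_pair ?A ?U P G\<^sub>1 G\<^sub>1 G G (LaxCell G\<^sub>1 G\<^sub>1 \<epsilon>\<^sub>1, LaxCell G G \<epsilon>)"
      using a b UG by (simp_all add: compatible_pair_def in_cells ua)
    then have "(LaxCell G\<^sub>1 G\<^sub>1 \<delta>\<^sub>1, LaxCell G G \<delta>) = (LaxCell G\<^sub>1 G\<^sub>1 \<epsilon>\<^sub>1, LaxCell G G \<epsilon>)"
      using ex by blast
    then show ?thesis by simp
  qed
  have "sc_bot \<theta> \<cdot> \<zeta> = Id2 K (und G)"
  proof (rule endo[THEN conjunct2])
    show "T_2_morphism K T (LaxCell G\<^sub>1 G\<^sub>1 (sc_top \<theta> \<cdot> \<zeta>\<^sub>1))"
      "T_2_morphism K T (LaxCell G G (sc_bot \<theta> \<cdot> \<zeta>))"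
      using T_2_Vcomp[OF l2(1) th2(1)] T_2_Vcomp[OF l2(2) th2(2)] .
    show "T_2_morphism K T (LaxCell G\<^sub>1 G\<^sub>1 (Id2 K (und G\<^sub>1)))"
      "T_2_morphism K T (LaxCell G G (Id2 K (und G)))"
      using T_2_Id2[OF G(1)] T_2_Id2[OF G(4)] .
    show "u \<lhd> (sc_top \<theta> \<cdot> \<zeta>\<^sub>1) = (sc_bot \<theta> \<cdot> \<zeta>) \<rhd> und P"
      using l1(5-7) l0(5-7) t1(5-7) t0(5-7) c uu(1) p(1) by (simp add: l_c th_c)
    show "u \<lhd> Id2 K (und G\<^sub>1) = Id2 K (und G) \<rhd> und P"
      using ug c uu(1) p(1) g1(1) g(1) by simp
  qed
  then have "invertible_cell K (sc_bot \<theta>)"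
    using fid t0(5-7) l0(5-7)
    by (intro invertible_cellI[of _ "und F" "und G" \<zeta>]) (simp_all add: in_cells)
  then have "invertible_cell K (bar F) \<longleftrightarrow> invertible_cell K (bar G)"
    by (rule bar_invertible_iff[OF th2(2)])
  then show "invertible_cell K (bar (cl_map D' P)) \<longleftrightarrow>
      invertible_cell K (bar (cl_map (lax_classifier K D T) P))"
    by (simp add: F_def G_def)
qed

end
end

theorem corollary6p21:
  fixes K :: "('o, 'm, 'c, 'z) enhanced_2cat_scheme"
    and S :: "'m smallness"
    and D :: "'m classifier"
    and T :: "('o, 'm, 'c) two_monad"
    and p :: "('o, 'm, 'c) lax_mor"
  assumes "representable_plumbus K S D"
    and "enhanced_2_monad K T"
    and "opfibrantly_cartesian K S D T"
    and "p \<in> lax_Small K S T"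
  shows "(pseudo_morphism K T (cl_map (lax_classifier K D T) p) \<longleftrightarrow> T_cartesian K T p) \<and>
    (\<forall>D'. enhanced_2_classifier (LAXALG K T) (lax_Small K S T) D' \<and>
        cl_u D' = cl_u (lax_classifier K D T) \<longrightarrow>
        (pseudo_morphism K T (cl_map D' p) \<longleftrightarrow> T_cartesian K T p))"
proof -
  interpret opfibrantly_cartesian_monad K S D T
    using assms(1-3)
    by (intro opfibrantly_cartesian_monad.intro opfibrantly_cartesian_monad_axioms.intro)
  note lifted = pseudo_iff_T_cartesian[OF assms(4)]
  have "pseudo_morphism K T (cl_map D' p) \<longleftrightarrow> T_cartesian K T p"
    if "enhanced_2_classifier (LAXALG K T) (lax_Small K S T) D'"
    "cl_u D' = cl_u (lax_classifier K D T)" for D'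
    using classifier_invertible_iff[OF assms(4) that] cl_map_lax[OF assms(4) that]
      lax_classifying_maps(2)[OF assms(4)] lifted by (simp add: pseudo_morphism_def)
  then show ?thesis using lifted by blast
qed

end
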